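(* Let $n\ge 2$. The family of the $L(\underline{p})$, for $\underline{p}\in\mathcal{E}$, admits a Rhin-Viola group $G$ generated by the automorphisms $\sigma$, $\psi$ and $\phi$ of $\mathcal{E}$ (with $\mathcal{E}$, $\sigma$, $\psi$, $\phi$ defined in the context). More precisely: 1. For $n\ge 4$, this group is isomorphic to $(\mathfrak{S}_3\times\mathfrak{S}_3)\rtimes\mathbb{Z}/2\mathbb{Z}$, hence has order $72$; it leaves invariant $$\frac{L(\underline{p})}{a_{n-1}!\,b_{n-1}!\,a_2!\,b_3!}\ \text{ if } n\ge 5,\qquad\text{and}\qquad \frac{L(\underline{p})}{a_3!\,b_3!\,a_2!}\ \text{ if } n=4.$$ 2. For $n=3$, the group $G$ is isomorphic to $H\rtimes\mathfrak{S}_5$, where $H$ is the hyperplane $\varepsilon_1+\cdots+\varepsilon_5=0$ of $(\mathbb{Z}/2\mathbb{Z})^5$; it leaves invariant $$\frac{L(\underline{p})}{a_1!\,a_2!\,a_3!\,b_1!\,b_2!\,b_3!\,(a_2+b_3-c_3)!\,(b_1+b_3-c_3)!}.$$ 3. For $n=2$, the group $G$ is isomorphic to $\mathfrak{S}_5$, and leaves invariant $$\frac{L(\underline{p})}{a_1!\,a_2!\,b_1!\,b_2!\,(a_1+b_2-c_2)!}.$$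
   Context: $\mathfrak{S}_m$ denotes the symmetric group on $m$ letters. Define functions on $[0,1]^n$ by $\delta_0=1$ and $\delta_k(\underline{x})=1-x_k\,\delta_{k-1}(\underline{x})$ for $1\le k\le n$. For $\underline{p}=(a_1,\ldots,a_n,b_1,\ldots,b_n,c_2,\ldots,c_n)\in\mathbb{Z}^{3n-1}$ define the (possibly infinite) integral $$L(\underline{p})=\int_{[0,1]^n}\frac{\prod_{k=1}^n x_k^{a_k}(1-x_k)^{b_k}}{\prod_{k=2}^n\delta_k(\underline{x})^{c_k}}\,\frac{dx_1\cdots dx_n}{\delta_n(\underline{x})}\in\mathbb{R}_+^*\cup\{\infty\}.$$ The set $\mathcal{E}\subset\mathbb{Z}^{3n-1}$ consists of the $\underline{p}$ satisfying $c_2=\cdots=c_{n-1}=0$ (no condition if $n=2$) and in addition: - if $n=3$: $a_1+b_2=a_3+b_3$; - if $n\ge 4$: $a_2=b_1$, $b_n=c_n$, and $a_k+b_{k+1}=a_{k+2}+b_{k+2}$ for all $k\in\{1,\ldots,n-2\}$. (For $n=2$, $\mathcal{E}=\mathbb{Z}^5$.) That $G$ is a Rhin-Viola group for the family $(L(\underline{p}))_{\underline{p}\in\mathcal{E}}$ means that $L(g\underline{p})/L(\underline{p})$ is a nonzero rational number for all $g\in G$ and all $\underline{p}\in\mathcal{E}$ (with the convention $\infty/\infty=1$), $G$ being a group of automorphisms of the free $\mathbb{Z}$-module $\mathcal{E}$. The following maps stabilize $\mathcal{E}$ and are regarded as automorphisms of $\mathcal{E}$: - $\sigma$ exchanges $a_1$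 and $b_2$, exchanges $a_2$ and $b_1$, and fixes the other coordinates. - $\psi$ sends $\underline{p}$ to $\underline{p}'=(a'_1,\ldots,a'_n,b'_1,\ldots,b'_n,c'_2,\ldots,c'_n)$ with $a'_k=a_{n+1-k}$ for $1\le k\le n$; $b'_k=b_{n+2-k}$ for $2\le k\le n$; $b'_1=a_{n-1}+b_n-c_n$; $c'_k=a_{n+2-k}+b_{n+2-k}+c_{n+1-k}-b_{n+1-k}-a_{n-k}$ for $2\le k\le n-1$; and $c'_n=a_2+b_2-b_1$. - $\phi$ exchanges $a_{n-1}$ and $c_n$, replaces $b_{n-1}$ by $a_{n-1}+b_{n-1}-c_n$, replaces $b_n$ by $a_{n-1}+b_n-c_n$, and fixes the other coordinates.
   Formalization: Rationality of L(gp)/L(p) and the invariance are claimed for all g in G, p in E except when exactly one of L(p), L(gp) is infinite; without this the claim fails (n=2, p=(0,0,0,0,-1), g=φ: L(p)=1, L(φp)=∞). If L(p)=∞, the quotient by factorials is read as ∞. *)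

theory Defs
  imports
    "HOL-Analysis.Analysis"
    "HOL-Algebra.Bij"
    "HOL-Algebra.Generated_Groups"
    "HOL-Algebra.Product_Groups"
    "HOL-Algebra.Sym_Groups"
begin

section \<open>The integrals\<close>

text \<open>The coordinates \<open>a\<^sub>k\<close>, \<open>b\<^sub>k\<close>, \<open>c\<^sub>k\<close> of a parameter vector are indexed by \<open>A k\<close>, \<open>B k\<close>, \<open>C k\<close>.\<close>

datatype coord = A nat | B nat | C nat

definition coords :: "nat \<Rightarrow> coord set" where
  "coords n = A ` {1..n} \<union> B ` {1..n} \<union> C ` {2..n}"

type_synonym params = "coord \<Rightarrow> int"

primrec delta :: "(nat \<Rightarrow> real) \<Rightarrow> nat \<Rightarrow> real" where
  "delta x 0 = 1"
| "delta x (Suc k) = 1 - x (Suc k) * delta x k"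

definition integrand :: "nat \<Rightarrow> params \<Rightarrow> (nat \<Rightarrow> real) \<Rightarrow> real" where
  "integrand n p x =
     (\<Prod>k=1..n. x k powi p (A k) * (1 - x k) powi p (B k))
       / (\<Prod>k=2..n. delta x k powi p (C k)) / delta x n"

text \<open>On the cube every factor is nonnegative, so the integral is a Lebesgue integral with values in
  \<open>[0, \<infinity>]\<close>. A factor vanishes only on a null set, hence the values \<open>0 powi m = 0\<close> for \<open>m < 0\<close> and
  \<open>t / 0 = 0\<close> do not matter.\<close>

definition L :: "nat \<Rightarrow> params \<Rightarrow> ennreal" where
  "L n p = (\<integral>\<^sup>+ x \<in> (\<Pi>\<^sub>E k\<in>{1..n}. {0..1}). ennreal (integrand n p x) \<partial>(\<Pi>\<^sub>M k\<in>{1..n}. lborel))"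

section \<open>The module of parameters and its automorphisms\<close>

definition E_set :: "nat \<Rightarrow> params set" where
  "E_set n = {p \<in> carrier (product_group (coords n) (\<lambda>_. integer_group)).
     (\<forall>k\<in>{2..n-1}. p (C k) = 0) \<and>
     (n = 3 \<longrightarrow> p (A 1) + p (B 2) = p (A 3) + p (B 3)) \<and>
     (n \<ge> 4 \<longrightarrow> p (A 2) = p (B 1) \<and> p (B n) = p (C n) \<and>
        (\<forall>k\<in>{1..n-2}. p (A k) + p (B (k+1)) = p (A (k+2)) + p (B (k+2))))}"

definition E_module :: "nat \<Rightarrow> params monoid" where
  "E_module n = (product_group (coords n) (\<lambda>_. integer_group))\<lparr>carrier := E_set n\<rparr>"

definition \<sigma> :: "nat \<Rightarrow> params \<Rightarrow> params" where
  "\<sigma> n = (\<lambda>p\<in>E_set n. \<lambda>i\<in>coords n. case i of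
      A k \<Rightarrow> if k = 1 then p (B 2) else if k = 2 then p (B 1) else p (A k)
    | B k \<Rightarrow> if k = 1 then p (A 2) else if k = 2 then p (A 1) else p (B k)
    | C k \<Rightarrow> p (C k))"

definition \<psi> :: "nat \<Rightarrow> params \<Rightarrow> params" where
  "\<psi> n = (\<lambda>p\<in>E_set n. \<lambda>i\<in>coords n. case i of
      A k \<Rightarrow> p (A (n+1-k))
    | B k \<Rightarrow> if k = 1 then p (A (n-1)) + p (B n) - p (C n) else p (B (n+2-k))
    | C k \<Rightarrow> if k = n then p (A 2) + p (B 2) - p (B 1)
             else p (A (n+2-k)) + p (B (n+2-k)) + p (C (n+1-k)) - p (B (n+1-k)) - p (A (n-k)))"

definition \<phi> :: "nat \<Rightarrow> params \<Rightarrow> params" where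
  "\<phi> n = (\<lambda>p\<in>E_set n. \<lambda>i\<in>coords n. case i of
      A k \<Rightarrow> if k = n-1 then p (C n) else p (A k)
    | B k \<Rightarrow> if k = n-1 then p (A (n-1)) + p (B (n-1)) - p (C n)
             else if k = n then p (A (n-1)) + p (B n) - p (C n)
             else p (B k)
    | C k \<Rightarrow> if k = n then p (A (n-1)) else p (C k))"

text \<open>\<^const>\<open>subgroup_generated\<close> intersects the generating set with the carrier, so this is the intended
  group once the three maps are known to be automorphisms.\<close>

definition G :: "nat \<Rightarrow> (params \<Rightarrow> params) monoid" where
  "G n = subgroup_generated (AutoGroup (E_module n)) {\<sigma> n, \<psi> n, \<phi> n}"

section \<open>Rhin-Viola groups and invariance\<close>

definition nonzero_rational_quotient :: "ennreal \<Rightarrow> ennreal \<Rightarrow> bool" where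
  "nonzero_rational_quotient u v \<longleftrightarrow>
     u = \<infinity> \<and> v = \<infinity> \<or> u < \<infinity> \<and> v < \<infinity> \<and> enn2real u / enn2real v \<in> \<rat> - {0}"

text \<open>The quotient \<open>F (g p) / F p\<close> is considered unless exactly one of the two values is infinite.
  This restriction cannot be dropped: for \<open>n = 2\<close>, \<open>a\<^sub>1 = a\<^sub>2 = b\<^sub>1 = b\<^sub>2 = 0\<close>, \<open>c\<^sub>2 = -1\<close> the integrand
  of \<open>L p\<close> is 1 almost everywhere, while that of \<open>L (\<phi> p)\<close> is
  \<open>x\<^sub>1\<^sup>-\<^sup>1 (1 - x\<^sub>1) (1 - x\<^sub>2) / (1 - x\<^sub>2 (1 - x\<^sub>1))\<close>, which is not integrable.\<close>

definition rhin_viola_group ::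
    "('a \<Rightarrow> 'a) set \<Rightarrow> ('a, 'm) monoid_scheme \<Rightarrow> ('a \<Rightarrow> ennreal) \<Rightarrow> bool" where
  "rhin_viola_group K M F \<longleftrightarrow> subgroup K (AutoGroup M) \<and>
     (\<forall>g\<in>K. \<forall>p\<in>carrier M. (F (g p) = \<infinity> \<longleftrightarrow> F p = \<infinity>) \<longrightarrow>
        nonzero_rational_quotient (F (g p)) (F p))"

text \<open>\<open>K\<close> leaves \<open>F p / D p\<close> invariant.\<close>

definition leaves_invariant ::
    "('a \<Rightarrow> 'a) set \<Rightarrow> ('a, 'm) monoid_scheme \<Rightarrow> ('a \<Rightarrow> ennreal) \<Rightarrow> ('a \<Rightarrow> nat) \<Rightarrow> bool" where
  "leaves_invariant K M F D \<longleftrightarrow>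
     (\<forall>g\<in>K. \<forall>p\<in>carrier M. (F (g p) = \<infinity> \<longleftrightarrow> F p = \<infinity>) \<longrightarrow>
        F (g p) / of_nat (D (g p)) = F p / of_nat (D p))"

text \<open>In the denominators below all arguments are nonnegative whenever \<open>L n p < \<infinity>\<close>; the value chosen
  for negative arguments only serves to make \<open>L n p / D p\<close> infinite when \<open>L n p\<close> is.\<close>

definition ifact :: "int \<Rightarrow> nat" where
  "ifact m = fact (nat m)"

definition denom_ge5 :: "nat \<Rightarrow> params \<Rightarrow> nat" where
  "denom_ge5 n p = ifact (p (A (n-1))) * ifact (p (B (n-1))) * ifact (p (A 2)) * ifact (p (B 3))"

definition denom4 :: "params \<Rightarrow> nat" where
  "denom4 p = ifact (p (A 3)) * ifact (p (B 3)) * ifact (p (A 2))"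

definition denom3 :: "params \<Rightarrow> nat" where
  "denom3 p = ifact (p (A 1)) * ifact (p (A 2)) * ifact (p (A 3))
     * ifact (p (B 1)) * ifact (p (B 2)) * ifact (p (B 3))
     * ifact (p (A 2) + p (B 3) - p (C 3)) * ifact (p (B 1) + p (B 3) - p (C 3))"

definition denom2 :: "params \<Rightarrow> nat" where
  "denom2 p = ifact (p (A 1)) * ifact (p (A 2)) * ifact (p (B 1)) * ifact (p (B 2))
     * ifact (p (A 1) + p (B 2) - p (C 2))"

section \<open>Semidirect products\<close>

definition semidirect_product ::
    "('a, 'm) monoid_scheme \<Rightarrow> ('b, 'k) monoid_scheme \<Rightarrow> ('b \<Rightarrow> 'a \<Rightarrow> 'a) \<Rightarrow> ('a \<times> 'b) monoid" where
  "semidirect_product N H \<alpha> =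
     \<lparr>carrier = carrier N \<times> carrier H,
      monoid.mult = (\<lambda>(x, h) (y, k). (x \<otimes>\<^bsub>N\<^esub> \<alpha> h y, h \<otimes>\<^bsub>H\<^esub> k)),
      one = (\<one>\<^bsub>N\<^esub>, \<one>\<^bsub>H\<^esub>)\<rparr>"

text \<open>\<open>\<int>/2\<int>\<close> acts on a square by exchanging the two factors.\<close>

definition swap_action :: "int \<Rightarrow> 'a \<times> 'a \<Rightarrow> 'a \<times> 'a" where
  "swap_action t x = (if t = 0 then x else prod.swap x)"

definition S3_S3_Z2 :: "(((nat \<Rightarrow> nat) \<times> (nat \<Rightarrow> nat)) \<times> int) monoid" where
  "S3_S3_Z2 =
     semidirect_product (sym_group 3 \<times>\<times> sym_group 3) (integer_mod_group 2) swap_action"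

definition H_hyperplane :: "(nat \<Rightarrow> int) monoid" where
  "H_hyperplane = (product_group {1..5} (\<lambda>_. integer_mod_group 2))
     \<lparr>carrier := {\<epsilon> \<in> carrier (product_group {1..5} (\<lambda>_. integer_mod_group 2)).
                   (\<Sum>i=1..5. \<epsilon> i) mod 2 = 0}\<rparr>"

text \<open>\<open>\<SS>\<^sub>5\<close> acts on \<open>H\<close> by permuting the coordinates.\<close>

definition perm_action :: "(nat \<Rightarrow> nat) \<Rightarrow> (nat \<Rightarrow> int) \<Rightarrow> nat \<Rightarrow> int" where
  "perm_action \<pi> \<epsilon> = (\<lambda>i\<in>{1..5}. \<epsilon> (inv_into UNIV \<pi> i))"

definition H_S5 :: "((nat \<Rightarrow> int) \<times> (nat \<Rightarrow> nat)) monoid" where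
  "H_S5 = semidirect_product H_hyperplane (sym_group 5) perm_action"

end

theory Submission
  imports Defs "HOL-Computational_Algebra.Polynomial"
begin

text \<open>
  \<open>L\<close> is invariant under \<open>\<sigma>\<close> by the substitution \<open>(x\<^sub>1, x\<^sub>2) \<mapsto> (1 - x\<^sub>2, 1 - x\<^sub>1)\<close>, and under \<open>\<psi>\<close> by
  reversing the coordinates \<open>\<delta>\<^sub>1, \<dots>, \<delta>\<^sub>n\<close>. Euler's integral in the variable \<open>x\<^sub>n\<^sub>-\<^sub>1\<close> expresses \<open>L (\<phi> p)\<close>
  by \<open>L p\<close>, but only if \<open>a\<^sub>n\<^sub>-\<^sub>1\<close>, \<open>b\<^sub>n\<^sub>-\<^sub>1\<close>, \<open>c\<^sub>n\<close> and \<open>a\<^sub>n\<^sub>-\<^sub>1 + b\<^sub>n\<^sub>-\<^sub>1 - c\<^sub>n\<close> are nonnegative; along a word in the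
  generators that joins two convergent integrals, the intermediate ones may diverge.

  This is repaired by analytic continuation in a discrete form. The vector \<open>q\<close> with \<open>a\<^sub>k = b\<^sub>k = c\<^sub>n = 1\<close> and
  all other coordinates \<open>0\<close> is fixed by the generators, and at \<open>p + m q\<close> every step of a given word is
  legitimate once \<open>m\<close> is large. If \<open>L p\<close> is finite, then \<open>L (p + m q)\<close>, multiplied by factors \<open>m! / (m + d)!\<close>,
  is the \<open>m\<close>-th moment of a finite measure on \<open>(0, 1]\<close>. Two moment sequences that agree for all large \<open>m\<close>
  agree at \<open>m = 0\<close>.

  The groups are identified through linear coordinates on \<open>E\<close> in which the generators act by permutations
  and sign changes.
\<close>

section \<open>Moment sequences\<close>

text \<open>The rationality claim and the invariance claim have one source: if L / D is invariant
  for a product D of factorials of linear forms, then L(g p) / L(p) = D(g p) / D(p) whenever both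
  integrals converge. At p + m q every factorial takes the shape (d + m)!, because each of these
  forms has the value 1 at q. This is why the factors m! / (m + d)! must be moment sequences, and
  why d \<ge> 0 has to be extracted from the convergence of L p: each form is an exponent of some
  x_k or 1 - x_k, for p itself or for an image of p under \<open>\<sigma>\<close> and
  \<open>\<psi>\<close>. Products of moment sequences are again moment sequences, so L / D can be
  treated as a whole, up to a power of m! that is common to both sides. The point 0 is excluded from
  the interval on purpose. A point mass at 0 has the moments 1, 0, 0, ..., so on [0, 1] the moments
  of large order would not determine the moment of order 0.\<close>

definition moment_sequence :: "(nat \<Rightarrow> real) \<Rightarrow> bool" where
  "moment_sequence f \<longleftrightarrow> (\<exists>M::real measure. finite_measure M \<and> space M \<subseteq> {0<..1} \<and>
     (\<lambda>x. x) \<in> borel_measurable M \<and> (\<forall>k. 0 \<le> f k \<and> ennreal (f k) = (\<integral>\<^sup>+ x. ennreal (x ^ k) \<partial>M)))"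

text \<open>M may live on any space: the required measure is the image of M under w. The target is
  the Borel space restricted to (0, 1], because \<open>moment_sequence\<close> constrains the space
  itself and not only the support.\<close>

lemma moment_sequenceI:
  fixes w :: "'a \<Rightarrow> real"
  assumes "finite_measure M" and w: "w \<in> borel_measurable M" "\<And>x. x \<in> space M \<Longrightarrow> 0 < w x \<and> w x \<le> 1"
    and f: "\<And>k. 0 \<le> f k" "\<And>k. ennreal (f k) = (\<integral>\<^sup>+ x. ennreal (w x ^ k) \<partial>M)"
  shows "moment_sequence f"
proof -
  interpret finite_measure M by fact
  let ?R = "restrict_space (borel :: real measure) {0<..1}"
  have wR: "w \<in> measurable M ?R"
    using w by (intro measurable_restrict_space2) auto
  have id: "(\<lambda>x. x) \<in> borel_measurable ?R"
    by (intro measurable_restrict_space1) auto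
  have "finite_measure (distr M ?R w)" by (rule finite_measure_distr[OF wR])
  moreover have "ennreal (f k) = (\<integral>\<^sup>+ x. ennreal (x ^ k) \<partial>distr M ?R w)" for k
    unfolding f(2) using id by (subst nn_integral_distr[OF wR]) auto
  ultimately show ?thesis unfolding moment_sequence_def
    using f(1) id by (intro exI[of _ "distr M ?R w"]) (auto simp: space_restrict_space)
qed

text \<open>The measure is the multiplicative convolution, the image of the product measure under
  (x, y) \<mapsto> x y; the identity (x y)^k = x^k y^k separates the double integral.\<close>

lemma moment_sequence_mult:
  assumes "moment_sequence f" "moment_sequence g"
  shows "moment_sequence (\<lambda>k. f k * g k)"
proof -
  obtain M where M: "finite_measure M" "space M \<subseteq> {0<..(1::real)}" and [measurable]: "(\<lambda>x. x) \<in> borel_measurable M"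
    and f: "\<And>k. 0 \<le> f k" "\<And>k. ennreal (f k) = (\<integral>\<^sup>+ x. ennreal (x ^ k) \<partial>M)"
    using assms(1) by (auto simp: moment_sequence_def)
  obtain N where N: "finite_measure N" "space N \<subseteq> {0<..(1::real)}" and [measurable]: "(\<lambda>x. x) \<in> borel_measurable N"
    and g: "\<And>k. 0 \<le> g k" "\<And>k. ennreal (g k) = (\<integral>\<^sup>+ x. ennreal (x ^ k) \<partial>N)"
    using assms(2) by (auto simp: moment_sequence_def)
  interpret M: finite_measure M by fact
  interpret N: finite_measure N by fact
  interpret pair_sigma_finite M N ..
  have fst [measurable]: "(\<lambda>z. fst z) \<in> borel_measurable (M \<Otimes>\<^sub>M N)"
    by (rule measurable_compose[OF measurable_fst]) simp
  have snd [measurable]: "(\<lambda>z. snd z) \<in> borel_measurable (M \<Otimes>\<^sub>M N)"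
    by (rule measurable_compose[OF measurable_snd]) simp
  show ?thesis
  proof (rule moment_sequenceI[where M="M \<Otimes>\<^sub>M N" and w="\<lambda>z. fst z * snd z"])
    show "finite_measure (M \<Otimes>\<^sub>M N)"
      by (rule finite_measureI)
        (simp add: space_pair_measure N.emeasure_pair_measure_Times ennreal_mult_eq_top_iff)
    show "0 < fst z * snd z \<and> fst z * snd z \<le> 1" if "z \<in> space (M \<Otimes>\<^sub>M N)" for z
    proof -
      have "0 < fst z" "fst z \<le> 1" "0 < snd z" "snd z \<le> 1"
        using that M(2) N(2) by (auto simp: space_pair_measure)
      then show ?thesis by (simp add: mult_le_one)
    qed
    show "ennreal (f k * g k) = (\<integral>\<^sup>+ z. ennreal ((fst z * snd z) ^ k) \<partial>(M \<Otimes>\<^sub>M N))" for k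
    proof -
      have "(\<integral>\<^sup>+ z. ennreal ((fst z * snd z) ^ k) \<partial>(M \<Otimes>\<^sub>M N))
          = (\<integral>\<^sup>+ x. \<integral>\<^sup>+ y. ennreal ((x * y) ^ k) \<partial>N \<partial>M)"
        by (subst N.nn_integral_fst[symmetric]) auto
      also have "\<dots> = (\<integral>\<^sup>+ x. \<integral>\<^sup>+ y. ennreal (x ^ k) * ennreal (y ^ k) \<partial>N \<partial>M)"
        using M(2) N(2) by (intro nn_integral_cong) (auto simp: power_mult_distrib ennreal_mult[symmetric] subset_iff less_imp_le)
      also have "\<dots> = ennreal (f k) * ennreal (g k)"
        unfolding f g by (simp add: nn_integral_cmult nn_integral_multc)
      finally show ?thesis using f(1) g(1) by (simp add: ennreal_mult)
    qed
  qed (use f g in auto)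
qed

text \<open>The measure is c times the point mass at 1.\<close>

lemma moment_sequence_const:
  assumes "0 \<le> c" shows "moment_sequence (\<lambda>_. c)"
proof (rule moment_sequenceI[where M="density (count_space {1::real}) (\<lambda>_. ennreal c)" and w="\<lambda>_. 1"])
  show "finite_measure (density (count_space {1::real}) (\<lambda>_. ennreal c))"
    by (rule finite_measureI) (simp add: emeasure_density nn_integral_count_space_finite)
  show "ennreal c = (\<integral>\<^sup>+ x. ennreal (1 ^ k) \<partial>density (count_space {1::real}) (\<lambda>_. ennreal c))" for k
    by (subst nn_integral_density) (auto simp: nn_integral_count_space_finite)
qed (use assms in auto)

text \<open>These are the moments of x^(j - 1) dx on (0, 1]; the total mass is the moment of order
  0.\<close>

lemma moment_sequence_inverse_linear:
  assumes "0 < j" shows "moment_sequence (\<lambda>k. 1 / (real k + real j))"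
proof -
  let ?M = "density (restrict_space lborel {0<..1::real}) (\<lambda>x. ennreal (x ^ (j - 1)))"
  have I: "(\<integral>\<^sup>+ x\<in>{0<..1}. ennreal (x ^ i) \<partial>lborel) = ennreal (1 / (real i + 1))" for i
  proof -
    have "(\<integral>\<^sup>+ x\<in>{0<..1}. ennreal (x ^ i) \<partial>lborel) = (\<integral>\<^sup>+ x\<in>{0..1}. ennreal (x ^ i) \<partial>lborel)"
      by (rule nn_integral_cong_AE) (use AE_lborel_singleton[of "0::real"] in \<open>eventually_elim, auto split: split_indicator\<close>)
    also have "\<dots> = ennreal ((\<lambda>x. x ^ Suc i / real (Suc i)) 1 - (\<lambda>x. x ^ Suc i / real (Suc i)) 0)"
      proof (rule nn_integral_FTC_Icc[where F="\<lambda>x. x ^ Suc i / real (Suc i)"])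
      show "((\<lambda>x. x ^ Suc i / real (Suc i)) has_real_derivative x ^ i) (at x)" if "x \<in> {0..1}" for x :: real
        using DERIV_cdivide[OF DERIV_pow[of "Suc i" x], of "real (Suc i)"]
        by (simp del: power_Suc)
    qed auto
    finally show ?thesis by (simp add: add.commute)
  qed
  have [measurable]: "(\<lambda>x::real. x ^ i) \<in> borel_measurable (restrict_space lborel {0<..1})" for i
    by (intro measurable_restrict_space1) auto
  have K: "(\<integral>\<^sup>+ x. ennreal (x ^ k) \<partial>?M) = ennreal (1 / (real k + real j))" for k
  proof -
    have "(\<integral>\<^sup>+ x. ennreal (x ^ k) \<partial>?M) = (\<integral>\<^sup>+ x. ennreal (x ^ (j-1)) * ennreal (x ^ k) \<partial>restrict_space lborel {0<..1})"
      by (subst nn_integral_density) auto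
    also have "\<dots> = (\<integral>\<^sup>+ x. ennreal (x ^ (j-1+k)) \<partial>restrict_space lborel {0<..1})"
      by (intro nn_integral_cong) (auto simp: space_restrict_space power_add ennreal_mult[symmetric])
    also have "\<dots> = ennreal (1 / (real (j-1+k) + 1))"
      using I[of "j-1+k"] by (subst nn_integral_restrict_space) auto
    finally show ?thesis using assms by (simp add: of_nat_diff add.commute)
  qed
  show ?thesis
  proof (rule moment_sequenceI[where M="?M" and w="\<lambda>x. x"])
    show "finite_measure ?M"
    proof (rule finite_measureI)
      have "emeasure ?M (space ?M) = (\<integral>\<^sup>+ x. ennreal (x ^ 0) \<partial>?M)" by (simp add: nn_integral_indicator[symmetric])
      also have "\<dots> \<noteq> \<infinity>" unfolding K by simp
      finally show "emeasure ?M (space ?M) \<noteq> \<infinity>" .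
    qed
    show "(\<lambda>x. x) \<in> borel_measurable ?M"
      using measurable_restrict_space1[of "\<lambda>x::real. x" lborel borel] by simp
  qed (auto simp: K[symmetric] space_restrict_space)
qed

text \<open>The test functions \<open>(1 - (1 - x) ^ m) ^ N\<close> are combinations of the powers \<open>x ^ k\<close> with
  \<open>k \<ge> N\<close>, are bounded by 1 and tend to 1 on \<open>(0, 1]\<close>.\<close>

lemma moment_sequence_limit:
  assumes "moment_sequence f"
  shows "(\<lambda>m. \<Sum>i\<le>degree ((\<Sum>l<m. [:1, -1::real:] ^ l) ^ N). coeff ((\<Sum>l<m. [:1, -1:] ^ l) ^ N) i * f (N + i))
           \<longlonglongrightarrow> f 0"
proof -
  obtain M where M: "finite_measure M" "space M \<subseteq> {0<..(1::real)}" and [measurable]: "(\<lambda>x. x) \<in> borel_measurable M"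
    and f: "\<And>k. 0 \<le> f k" "\<And>k. ennreal (f k) = (\<integral>\<^sup>+ x. ennreal (x ^ k) \<partial>M)"
    using assms by (auto simp: moment_sequence_def)
  interpret M: finite_measure M by fact
  have x01: "0 < x" "x \<le> 1" if "x \<in> space M" for x using that M(2) by auto
  have int: "integrable M (\<lambda>x. x ^ k)" for k
    by (rule M.integrable_const_bound[where B=1]) (auto intro!: AE_I2 power_le_one simp: x01 less_imp_le)
  have fk: "f k = (\<integral>x. x ^ k \<partial>M)" for k
  proof -
    have "(\<integral>x. x ^ k \<partial>M) = enn2real (\<integral>\<^sup>+ x. ennreal (x ^ k) \<partial>M)"
      by (rule integral_eq_nn_integral) (auto intro!: AE_I2 simp: x01 less_imp_le)
    then show ?thesis by (simp add: f(2)[symmetric] f(1))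
  qed
  \<comment> \<open>\<open>[:1, -1:]\<close> is the polynomial 1 - x, so the geometric sum equals (1
    - (1 - x)^m) / x, and \<open>P m\<close> is the test function divided by x^N.\<close>
  define P where "P m = (\<Sum>l<m. [:1, -1::real:] ^ l) ^ N" for m
  have P: "(1 - (1 - x) ^ m) ^ N = x ^ N * poly (P m) x" for x m
    by (simp add: P_def poly_power poly_sum one_diff_power_eq power_mult_distrib)
  have "(\<lambda>m. \<integral>x. (1 - (1 - x) ^ m) ^ N \<partial>M) \<longlonglongrightarrow> (\<integral>x. 1 \<partial>M)"
  proof (rule integral_dominated_convergence[where w="\<lambda>_. 1"])
    \<comment> \<open>Strict positivity of x gives 1 - x < 1, which forces the pointwise
      limit.\<close>
    show "AE x in M. (\<lambda>m. (1 - (1 - x) ^ m) ^ N) \<longlonglongrightarrow> 1"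
    proof (rule AE_I2)
      fix x assume "x \<in> space M"
      then have "(\<lambda>m. (1 - x) ^ m) \<longlonglongrightarrow> 0" using x01[of x] by (intro LIMSEQ_power_zero) (simp add: abs_if)
      then have "(\<lambda>m. (1 - (1 - x) ^ m) ^ N) \<longlonglongrightarrow> (1 - 0) ^ N" by (intro tendsto_power tendsto_diff tendsto_const)
      then show "(\<lambda>m. (1 - (1 - x) ^ m) ^ N) \<longlonglongrightarrow> 1" by simp
    qed
    show "AE x in M. norm ((1 - (1 - x) ^ m) ^ N) \<le> 1" for m
    proof (rule AE_I2)
      fix x assume "x \<in> space M"
      then have "0 \<le> (1 - x) ^ m" "(1 - x) ^ m \<le> 1" using x01[of x] by (auto intro: power_le_one)
      then show "norm ((1 - (1 - x) ^ m) ^ N) \<le> 1" by (simp add: power_le_one)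
    qed
  qed auto
  moreover have "(\<integral>x. (1 - (1 - x) ^ m) ^ N \<partial>M) = (\<Sum>i\<le>degree (P m). coeff (P m) i * f (N + i))" for m
  proof -
    have "(\<integral>x. (1 - (1 - x) ^ m) ^ N \<partial>M) = (\<integral>x. (\<Sum>i\<le>degree (P m). coeff (P m) i * x ^ (N + i)) \<partial>M)"
      unfolding P by (simp add: poly_altdef sum_distrib_left power_add mult_ac)
    then show ?thesis using int by (simp add: fk)
  qed
  moreover have "(\<integral>x. 1 \<partial>M) = f 0" using fk[of 0] by simp
  ultimately show ?thesis unfolding P_def by simp
qed

text \<open>The limit formula recovers f 0 from the values f k with k \<ge> N alone.\<close>

lemma moment_sequence_unique:
  assumes "moment_sequence f" "moment_sequence g" "\<And>k. k \<ge> N \<Longrightarrow> f k = g k"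
  shows "f 0 = g 0"
  using moment_sequence_limit[OF assms(1), of N] moment_sequence_limit[OF assms(2), of N]
  by (simp add: assms(3) LIMSEQ_unique)

section \<open>Coordinates of the generators\<close>

lemma E_set_iff:
  "p \<in> E_set n \<longleftrightarrow> p \<in> extensional (coords n) \<and> (\<forall>k\<in>{2..n-1}. p (C k) = 0) \<and>
     (n = 3 \<longrightarrow> p (A 1) + p (B 2) = p (A 3) + p (B 3)) \<and>
     (n \<ge> 4 \<longrightarrow> p (A 2) = p (B 1) \<and> p (B n) = p (C n) \<and>
        (\<forall>k\<in>{1..n-2}. p (A k) + p (B (k+1)) = p (A (k+2)) + p (B (k+2))))"
  by (auto simp: E_set_def carrier_product_group PiE_iff integer_group_def)

lemma in_coords [simp]:
  "A k \<in> coords n \<longleftrightarrow> 1 \<le> k \<and> k \<le> n"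
  "B k \<in> coords n \<longleftrightarrow> 1 \<le> k \<and> k \<le> n"
  "C k \<in> coords n \<longleftrightarrow> 2 \<le> k \<and> k \<le> n"
  by (auto simp: coords_def)

lemma params_eqI:
  assumes "p \<in> extensional (coords n)" "q \<in> extensional (coords n)"
    and "\<And>k. 1 \<le> k \<Longrightarrow> k \<le> n \<Longrightarrow> p (A k) = q (A k)" "\<And>k. 1 \<le> k \<Longrightarrow> k \<le> n \<Longrightarrow> p (B k) = q (B k)"
    and "\<And>k. 2 \<le> k \<Longrightarrow> k \<le> n \<Longrightarrow> p (C k) = q (C k)"
  shows "p = q"
proof (rule extensionalityI[OF assms(1,2)])
  show "p i = q i" if "i \<in> coords n" for i using that assms(3-5) by (cases i) auto
qed

lemma \<sigma>_simps:
  assumes "p \<in> E_set n"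
  shows "1 \<le> k \<Longrightarrow> k \<le> n \<Longrightarrow> \<sigma> n p (A k) = (if k = 1 then p (B 2) else if k = 2 then p (B 1) else p (A k))"
    "1 \<le> k \<Longrightarrow> k \<le> n \<Longrightarrow> \<sigma> n p (B k) = (if k = 1 then p (A 2) else if k = 2 then p (A 1) else p (B k))"
    "2 \<le> k \<Longrightarrow> k \<le> n \<Longrightarrow> \<sigma> n p (C k) = p (C k)"
    "\<sigma> n p \<in> extensional (coords n)"
  using assms by (auto simp: \<sigma>_def)

text \<open>The relations of E enter through \<open>C k\<close> with k < n. With j = n - k its
  defining expression is c_{j+1} plus the difference of the two sides of a_j + b_{j+1} = a_{j+2} +
  b_{j+2}, hence 0.\<close>

lemma \<psi>_simps:
  assumes "p \<in> E_set n"
  shows "1 \<le> k \<Longrightarrow> k \<le> n \<Longrightarrow> \<psi> n p (A k) = p (A (n+1-k))"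
    "1 \<le> k \<Longrightarrow> k \<le> n \<Longrightarrow> \<psi> n p (B k) = (if k = 1 then p (A (n-1)) + p (B n) - p (C n) else p (B (n+2-k)))"
    "2 \<le> k \<Longrightarrow> k \<le> n \<Longrightarrow> \<psi> n p (C k) = (if k = n then p (A 2) + p (B 2) - p (B 1) else 0)"
    "\<psi> n p \<in> extensional (coords n)"
proof -
  show "\<psi> n p (C k) = (if k = n then p (A 2) + p (B 2) - p (B 1) else 0)" if k: "2 \<le> k" "k \<le> n"
  proof (cases "k = n")
    case False
    then have j: "n - k \<in> {1..n-2}" "n + 2 - k = (n - k) + 2" "n + 1 - k = (n - k) + 1" "(n - k) + 1 \<in> {2..n-1}" using k by auto
    have 0: "p (C (n + 1 - k)) = 0" using assms j by (auto simp: E_set_iff)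
    have "p (A (n - k)) + p (B (n + 1 - k)) = p (A (n + 2 - k)) + p (B (n + 2 - k))"
    proof (cases "n = 3")
      case True
      then have "k = 2" using k False by auto
      with True show ?thesis using assms by (simp add: E_set_iff numeral_eq_Suc)
    next
      case False
      then have "4 \<le> n" using k \<open>k \<noteq> n\<close> by auto
      then show ?thesis using assms j by (auto simp: E_set_iff)
    qed
    then show ?thesis using assms k False 0 by (simp add: \<psi>_def)
  qed (use assms k in \<open>simp add: \<psi>_def\<close>)
qed (use assms in \<open>auto simp: \<psi>_def\<close>)

lemma \<phi>_simps:
  assumes "p \<in> E_set n"
  shows "1 \<le> k \<Longrightarrow> k \<le> n \<Longrightarrow> \<phi> n p (A k) = (if k = n-1 then p (C n) else p (A k))"
    "1 \<le> k \<Longrightarrow> k \<le> n \<Longrightarrow> \<phi> n p (B k) = (if k = n-1 then p (A (n-1)) + p (B (n-1)) - p (C n)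
             else if k = n then p (A (n-1)) + p (B n) - p (C n) else p (B k))"
    "2 \<le> k \<Longrightarrow> k \<le> n \<Longrightarrow> \<phi> n p (C k) = (if k = n then p (A (n-1)) else p (C k))"
    "\<phi> n p \<in> extensional (coords n)"
  using assms by (auto simp: \<phi>_def)

section \<open>The integral over the open cube\<close>

abbreviation lebesgue_prod :: "nat \<Rightarrow> (nat \<Rightarrow> real) measure" where
  "lebesgue_prod n \<equiv> (\<Pi>\<^sub>M k\<in>{1..n}. lborel)"

text \<open>The index set is a parameter because later arguments split off a coordinate from the
  middle of {1..n}.\<close>

definition open_cube :: "nat set \<Rightarrow> (nat \<Rightarrow> real) set" where
  "open_cube I = (\<Pi>\<^sub>E k\<in>I. {0<..<1})"

abbreviation cube :: "nat \<Rightarrow> (nat \<Rightarrow> real) set" where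
  "cube n \<equiv> open_cube {1..n}"

lemma product_sigma_finite_lborel: "product_sigma_finite (\<lambda>_::'i. lborel :: real measure)"
  by (rule product_sigma_finite.intro) (rule lborel.sigma_finite_measure_axioms)

lemma open_cubeD: "x \<in> open_cube I \<Longrightarrow> k \<in> I \<Longrightarrow> 0 < x k \<and> x k < 1"
  by (auto simp: open_cube_def PiE_iff)

lemma sets_open_cube [measurable]:
  "finite I \<Longrightarrow> open_cube I \<in> sets (\<Pi>\<^sub>M k\<in>I. lborel)"
  unfolding open_cube_def by (intro sets_PiM_I_finite) auto

lemma delta_cong: "(\<And>i. i \<in> {1..k} \<Longrightarrow> x i = y i) \<Longrightarrow> delta x k = delta y k"
  by (induction k) auto

lemma delta_bounds:
  assumes "\<And>i. i \<in> {1..k} \<Longrightarrow> 0 \<le> x i \<and> x i \<le> 1"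
  shows "0 \<le> delta x k" "delta x k \<le> 1"
proof -
  have "0 \<le> delta x k \<and> delta x k \<le> 1" using assms
  proof (induction k)
    case (Suc k)
    then have "0 \<le> delta x k \<and> delta x k \<le> 1" by auto
    moreover have "0 \<le> x (Suc k) \<and> x (Suc k) \<le> 1" using Suc.prems[of "Suc k"] by auto
    ultimately show ?case by (auto simp: mult_le_one)
  qed auto
  then show "0 \<le> delta x k" "delta x k \<le> 1" by auto
qed

lemma mult_less_one:
  assumes "0 \<le> x" "x < 1" "0 \<le> y" "y \<le> (1::real)" shows "x * y < 1"
  using mult_left_mono[of y 1 x] assms by linarith

lemma delta_pos:
  assumes "\<And>i. i \<in> {1..k} \<Longrightarrow> 0 \<le> x i \<and> x i \<le> 1" "k > 0 \<Longrightarrow> x k < 1"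
  shows "0 < delta x k"
proof (cases k)
  case (Suc m)
  have "0 \<le> delta x m" "delta x m \<le> 1" using delta_bounds[of m x] assms(1) Suc by auto
  moreover have "0 \<le> x k" "x k < 1" using assms Suc by auto
  ultimately show ?thesis using mult_less_one[of "x k" "delta x m"] Suc by simp
qed auto

lemma delta_less_1:
  assumes "\<And>i. i \<in> {1..k} \<Longrightarrow> 0 < x i \<and> x i < 1" "k > 0"
  shows "delta x k < 1"
proof -
  obtain m where m: "k = Suc m" using assms(2) by (cases k) auto
  have "0 < delta x m" using assms(1) m by (intro delta_pos) (auto simp: less_imp_le)
  then show ?thesis using assms(1)[of k] m by simp
qed

lemma delta_pos_cube: "x \<in> cube n \<Longrightarrow> k \<le> n \<Longrightarrow> 0 < delta x k"
  using open_cubeD[of x "{1..n}"] by (intro delta_pos) (auto simp: less_imp_le)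

lemma delta_le_1_cube: "x \<in> cube n \<Longrightarrow> k \<le> n \<Longrightarrow> delta x k \<le> 1"
  using open_cubeD[of x "{1..n}"] by (intro delta_bounds) (auto simp: less_imp_le)

lemma measurable_coordinate:
  "k \<in> I \<Longrightarrow> (\<lambda>x. x k) \<in> borel_measurable (\<Pi>\<^sub>M k\<in>I. lborel)"
  using measurable_component_singleton[of k I "\<lambda>_. lborel :: real measure"] by simp

lemma measurable_delta:
  assumes "{1..k} \<subseteq> I"
  shows "(\<lambda>x. delta x k) \<in> borel_measurable (\<Pi>\<^sub>M k\<in>I. lborel)"
  using assms
proof (induction k)
  case (Suc k)
  have [measurable]: "(\<lambda>x. delta x k) \<in> borel_measurable (\<Pi>\<^sub>M k\<in>I. lborel)"
    using Suc.prems by (intro Suc.IH) auto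
  have [measurable]: "(\<lambda>x. x (Suc k)) \<in> borel_measurable (\<Pi>\<^sub>M k\<in>I. lborel)"
    using Suc.prems by (intro measurable_coordinate) auto
  show ?case by simp
qed simp

lemma measurable_power_int [measurable (raw)]:
  fixes f :: "'a \<Rightarrow> real"
  assumes [measurable]: "f \<in> borel_measurable M"
  shows "(\<lambda>x. f x powi m) \<in> borel_measurable M"
  by (cases "m \<ge> 0") (auto simp: power_int_def)

lemma measurable_integrand [measurable]: "integrand n p \<in> borel_measurable (lebesgue_prod n)"
proof -
  have [measurable]: "(\<lambda>x. delta x k) \<in> borel_measurable (lebesgue_prod n)" if "k \<le> n" for k
    using that by (intro measurable_delta) auto
  note [measurable] = measurable_coordinate[where I="{1..n}"]
  show ?thesis unfolding integrand_def by measurable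
qed

text \<open>Both cubes have measure 1, so they differ by a null set. On the open cube all factors of
  the integrand are positive.\<close>

lemma L_open_cube:
  "L n p = (\<integral>\<^sup>+ x. ennreal (integrand n p x) * indicator (cube n) x \<partial>lebesgue_prod n)"
proof -
  interpret product_sigma_finite "\<lambda>_::nat. lborel :: real measure" by (rule product_sigma_finite_lborel)
  let ?C = "\<Pi>\<^sub>E k\<in>{1..n}. {0..1::real}" and ?O = "cube n"
  have C: "emeasure (lebesgue_prod n) ?C = 1" "?C \<in> sets (lebesgue_prod n)"
    by (subst emeasure_PiM) (auto intro!: sets_PiM_I_finite)
  have O: "emeasure (lebesgue_prod n) ?O = 1"
    unfolding open_cube_def by (subst emeasure_PiM) auto
  have sub: "?O \<subseteq> ?C" unfolding open_cube_def by (intro PiE_mono) auto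
  have "emeasure (lebesgue_prod n) (?C - ?O) = 1 - 1"
    using C O sub by (subst emeasure_Diff) auto
  then have "?C - ?O \<in> null_sets (lebesgue_prod n)"
    using C(2) by (intro null_setsI) auto
  then have "AE x in lebesgue_prod n. x \<notin> ?C - ?O" by (rule AE_not_in)
  then have "AE x in lebesgue_prod n. ennreal (integrand n p x) * indicator ?C x
      = ennreal (integrand n p x) * indicator ?O x"
    by eventually_elim (use sub in \<open>auto split: split_indicator\<close>)
  then show ?thesis unfolding L_def by (intro nn_integral_cong_AE)
qed

text \<open>It suffices to compare the two measures on boxes. \<open>\<sigma>\<close> needs a swap
  of two coordinates combined with t \<mapsto> 1 - t, and \<open>\<psi>\<close> needs the reversal
  of all coordinates.\<close>

lemma nn_integral_PiM_reindex:
  fixes r :: "'i \<Rightarrow> real \<Rightarrow> real"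
  assumes "finite I" and pi: "bij_betw \<pi> I I"
    and r [measurable]: "\<And>i. i \<in> I \<Longrightarrow> r i \<in> borel_measurable borel"
    and dr: "\<And>i. i \<in> I \<Longrightarrow> distr lborel borel (r i) = lborel"
    and f: "f \<in> borel_measurable (\<Pi>\<^sub>M k\<in>I. lborel)"
  shows "(\<integral>\<^sup>+ x. f (\<lambda>i\<in>I. r i (x (\<pi> i))) \<partial>(\<Pi>\<^sub>M k\<in>I. lborel)) = (\<integral>\<^sup>+ x. f x \<partial>(\<Pi>\<^sub>M k\<in>I. lborel))"
proof -
  interpret product_sigma_finite "\<lambda>_::'i. lborel :: real measure" by (rule product_sigma_finite_lborel)
  let ?P = "\<Pi>\<^sub>M k\<in>I. (lborel :: real measure)"
  let ?T = "\<lambda>x. \<lambda>i\<in>I. r i (x (\<pi> i))"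
  have piI: "\<pi> i \<in> I" if "i \<in> I" for i using pi that by (auto dest: bij_betwE)
  have T: "?T \<in> measurable ?P ?P"
  proof (rule measurable_restrict)
    fix i assume i: "i \<in> I"
    have "(\<lambda>x. x (\<pi> i)) \<in> measurable ?P lborel"
      by (rule measurable_component_singleton) (rule piI[OF i])
    then show "(\<lambda>x. r i (x (\<pi> i))) \<in> measurable ?P lborel"
      using r[OF i] by (simp add: measurable_compose)
  qed
  have "distr ?P ?P ?T = ?P"
  proof (rule PiM_eqI)
    fix A assume A: "\<And>i. i \<in> I \<Longrightarrow> A i \<in> sets (lborel :: real measure)"
    define \<rho> where "\<rho> = inv_into I \<pi>"
    have rho: "\<rho> j \<in> I" "\<pi> (\<rho> j) = j" if "j \<in> I" for j
      using that pi unfolding \<rho>_def by (auto simp: bij_betw_def inv_into_into f_inv_into_f)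
    have rho2: "\<rho> (\<pi> i) = i" if "i \<in> I" for i
      using that pi unfolding \<rho>_def by (auto simp: bij_betw_def inv_into_f_f)
    have eq: "?T -` Pi\<^sub>E I A \<inter> space ?P = (\<Pi>\<^sub>E j\<in>I. r (\<rho> j) -` A (\<rho> j))"
    proof (intro equalityI subsetI)
      fix x assume x: "x \<in> ?T -` Pi\<^sub>E I A \<inter> space ?P"
      then have "r (\<rho> j) (x j) \<in> A (\<rho> j)" if "j \<in> I" for j
        using rho[OF that] that by (auto simp: PiE_iff dest: bspec[of _ _ "\<rho> j"])
      with x show "x \<in> (\<Pi>\<^sub>E j\<in>I. r (\<rho> j) -` A (\<rho> j))" by (simp add: space_PiM PiE_iff)
    next
      fix x assume x: "x \<in> (\<Pi>\<^sub>E j\<in>I. r (\<rho> j) -` A (\<rho> j))"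
      then have "r i (x (\<pi> i)) \<in> A i" if "i \<in> I" for i
        using piI[OF that] rho2[OF that] by (auto simp: PiE_iff dest: bspec[of _ _ "\<pi> i"])
      with x show "x \<in> ?T -` Pi\<^sub>E I A \<inter> space ?P" by (simp add: space_PiM PiE_iff)
    qed
    have m: "r i -` A i \<in> sets lborel" if "i \<in> I" for i
      using measurable_sets[OF r[OF that], of "A i"] A[OF that] by auto
    have "emeasure (distr ?P ?P ?T) (Pi\<^sub>E I A) = emeasure ?P (\<Pi>\<^sub>E j\<in>I. r (\<rho> j) -` A (\<rho> j))"
      using T A \<open>finite I\<close> by (subst emeasure_distr) (auto intro!: sets_PiM_I_finite simp: eq)
    also have "\<dots> = (\<Prod>j\<in>I. emeasure lborel (r (\<rho> j) -` A (\<rho> j)))"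
      using m rho \<open>finite I\<close> by (subst emeasure_PiM) auto
    also have "\<dots> = (\<Prod>j\<in>I. emeasure lborel (A (\<rho> j)))"
    proof (rule prod.cong)
      fix j assume j: "j \<in> I"
      have "emeasure lborel (A (\<rho> j)) = emeasure (distr lborel borel (r (\<rho> j))) (A (\<rho> j))"
        using dr[OF rho(1)[OF j]] by simp
      also have "\<dots> = emeasure lborel (r (\<rho> j) -` A (\<rho> j))"
        using r[OF rho(1)[OF j]] A[OF rho(1)[OF j]] by (subst emeasure_distr) auto
      finally show "emeasure lborel (r (\<rho> j) -` A (\<rho> j)) = emeasure lborel (A (\<rho> j))" by simp
    qed simp
    also have "\<dots> = (\<Prod>i\<in>I. emeasure lborel (A i))"
      by (rule prod.reindex_bij_betw) (unfold \<rho>_def, rule bij_betw_inv_into[OF pi])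
    finally show "emeasure (distr ?P ?P ?T) (Pi\<^sub>E I A) = (\<Prod>i\<in>I. emeasure lborel (A i))" .
  qed (use \<open>finite I\<close> in auto)
  then have "(\<integral>\<^sup>+ x. f x \<partial>?P) = (\<integral>\<^sup>+ x. f x \<partial>distr ?P ?P ?T)" by simp
  also have "\<dots> = (\<integral>\<^sup>+ x. f (?T x) \<partial>?P)"
    using T f by (subst nn_integral_distr) auto
  finally show ?thesis ..
qed

lemma distr_lborel_reflect: "distr lborel borel (\<lambda>x. 1 - x) = (lborel :: real measure)"
proof -
  have "lborel = density (distr lborel borel (\<lambda>x::real. 1 + (- 1) * x)) (\<lambda>_. \<bar>- 1::real\<bar>)"
    by (rule lborel_real_affine) simp
  then show ?thesis by (simp add: density_1)
qed

section \<open>Changes of variables\<close>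

lemma L_\<sigma>:
  assumes "2 \<le> n" "p \<in> E_set n"
  shows "L n (\<sigma> n p) = L n p"
proof -
  define \<pi> :: "nat \<Rightarrow> nat" where "\<pi> i = (if i = 1 then 2 else if i = 2 then 1 else i)" for i
  define r :: "nat \<Rightarrow> real \<Rightarrow> real" where "r i t = (if i \<le> 2 then 1 - t else t)" for i t
  define T where "T x = (\<lambda>i\<in>{1..n}. r i (x (\<pi> i)))" for x
  have T12: "T x 1 = 1 - x 2" "T x 2 = 1 - x 1" for x using assms(1) by (auto simp: T_def \<pi>_def r_def)
  have Tk: "T x k = x k" if "k > 2" "k \<le> n" for k x using that by (auto simp: T_def \<pi>_def r_def)
  have cube: "T x \<in> cube n \<longleftrightarrow> x \<in> cube n" if "x \<in> extensional {1..n}" for x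
  proof -
    have *: "{1..n} = insert 1 (insert 2 {3..n})" using assms(1) by auto
    have "(\<forall>k\<in>{3..n}. T x k \<in> {0<..<1}) \<longleftrightarrow> (\<forall>k\<in>{3..n}. x k \<in> {0<..<1})"
      by (intro ball_cong) (auto simp: Tk)
    then have "(\<forall>k\<in>{1..n}. T x k \<in> {0<..<1}) \<longleftrightarrow> (\<forall>k\<in>{1..n}. x k \<in> {0<..<1})"
      unfolding * ball_simps(7) T12 by auto
    moreover have "T x \<in> extensional {1..n}" by (simp add: T_def)
    ultimately show ?thesis using that unfolding open_cube_def PiE_iff by simp
  qed
  \<comment> \<open>delta_2 = 1 - x_2 (1 - x_1) is invariant under T, and the later delta_k depend
    on x_1 and x_2 through delta_2 only.\<close>
  have delta: "delta (T x) k = delta x k" if "2 \<le> k" "k \<le> n" for x k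
    using that
  proof (induction k)
    case (Suc k)
    show ?case
    proof (cases "k = 1")
      case True
      have d2: "delta y 2 = 1 - y 2 * (1 - y 1)" for y :: "nat \<Rightarrow> real" by (simp add: numeral_2_eq_2)
      have "delta (T x) 2 = delta x 2" unfolding d2 T12 by (simp add: algebra_simps)
      then show ?thesis using True by (simp add: numeral_2_eq_2)
    next
      case False
      then have "2 \<le> k" using Suc.prems by auto
      then show ?thesis using Suc Tk[of "Suc k" x] by simp
    qed
  qed simp
  have int: "integrand n p (T x) = integrand n (\<sigma> n p) x" for x
  proof -
    note s = \<sigma>_simps(1,2)[OF assms(2)] and sC = \<sigma>_simps(3)[OF assms(2)]
    have split: "(\<Prod>k=1..n. f k) = f 1 * (f 2 * (\<Prod>k=3..n. f k))" for f :: "nat \<Rightarrow> real"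
    proof -
      have "{1..n} = insert 1 (insert 2 {3..n})" using assms(1) by auto
      then show ?thesis by simp
    qed
    have "(\<Prod>k=3..n. T x k powi p (A k) * (1 - T x k) powi p (B k)) =
        (\<Prod>k=3..n. x k powi \<sigma> n p (A k) * (1 - x k) powi \<sigma> n p (B k))"
      by (intro prod.cong) (auto simp: Tk s)
    moreover have "\<sigma> n p (A 1) = p (B 2)" "\<sigma> n p (A 2) = p (B 1)" "\<sigma> n p (B 1) = p (A 2)" "\<sigma> n p (B 2) = p (A 1)"
      using assms(1) by (simp_all add: s)
    ultimately have "(\<Prod>k=1..n. T x k powi p (A k) * (1 - T x k) powi p (B k)) =
        (\<Prod>k=1..n. x k powi \<sigma> n p (A k) * (1 - x k) powi \<sigma> n p (B k))"
      unfolding split T12 by (simp add: mult_ac)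
    moreover have "(\<Prod>k=2..n. delta (T x) k powi p (C k)) = (\<Prod>k=2..n. delta x k powi \<sigma> n p (C k))"
      by (intro prod.cong) (auto simp: delta sC)
    ultimately show ?thesis using delta[of n x] assms(1) unfolding integrand_def by simp
  qed
  let ?f = "\<lambda>x. ennreal (integrand n p x) * indicator (cube n) x"
  have "L n p = (\<integral>\<^sup>+ x. ?f (T x) \<partial>lebesgue_prod n)"
    unfolding L_open_cube T_def
  proof (rule nn_integral_PiM_reindex[symmetric])
    show "bij_betw \<pi> {1..n} {1..n}"
      by (rule bij_betw_byWitness[where f'=\<pi>]) (use assms(1) in \<open>auto simp: \<pi>_def\<close>)
    show "distr lborel borel (r i) = lborel" for i
      using distr_lborel_reflect distr_id2[of borel lborel] by (cases "i \<le> 2") (simp_all add: r_def[abs_def] id_def)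
    show "r i \<in> borel_measurable borel" for i by (simp add: r_def[abs_def])
    show "?f \<in> borel_measurable (lebesgue_prod n)" by measurable
  qed auto
  also have "\<dots> = L n (\<sigma> n p)"
    unfolding L_open_cube int
    by (intro nn_integral_cong) (auto simp: cube space_PiM PiE_def simp del: One_nat_def split: split_indicator)
  finally show ?thesis ..
qed

section \<open>The coordinates delta_1, ..., delta_n and their reversal\<close>

text \<open>This is the image of the open cube under x \<mapsto> (delta_1, ..., delta_n): since x_k
  = (1 - d_k) / d_{k-1}, the bound x_k < 1 says d_{k-1} + d_k > 1. The conditions are symmetric
  under reversal of the indices.\<close>

definition delta_region :: "nat \<Rightarrow> (nat \<Rightarrow> real) set" where
  "delta_region n = {d \<in> cube n. \<forall>k\<in>{1..<n}. 1 < d k + d (Suc k)}"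

lemma sets_delta_region [measurable]: "delta_region n \<in> sets (lebesgue_prod n)"
proof -
  note [measurable] = measurable_coordinate[where I="{1..n}"]
  have "delta_region n = {d \<in> space (lebesgue_prod n). d \<in> cube n \<and> (\<forall>k\<in>{1..<n}. 1 < d k + d (Suc k))}"
    by (auto simp: delta_region_def open_cube_def space_PiM PiE_iff)
  also have "\<dots> \<in> sets (lebesgue_prod n)"
    by measurable
  finally show ?thesis .
qed

lemma fun_upd_in_delta_region:
  assumes "d \<in> extensional {1..n}"
  shows "d(Suc n := u) \<in> delta_region (Suc n) \<longleftrightarrow>
    d \<in> delta_region n \<and> 1 - (if n = 0 then 1 else d n) < u \<and> u < 1"
proof -
  have 1: "d(Suc n := u) \<in> cube (Suc n) \<longleftrightarrow> d \<in> cube n \<and> 0 < u \<and> u < 1"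
    using assms unfolding open_cube_def PiE_iff atLeastAtMostSuc_conv[of 1 n, simplified]
    by (auto simp: extensional_def)
  have 2: "(\<forall>k\<in>{1..<Suc n}. 1 < (d(Suc n := u)) k + (d(Suc n := u)) (Suc k)) \<longleftrightarrow>
      (\<forall>k\<in>{1..<n}. 1 < d k + d (Suc k)) \<and> (n \<noteq> 0 \<longrightarrow> 1 < d n + u)"
    by (auto simp: less_Suc_eq)
  show ?thesis unfolding delta_region_def mem_Collect_eq 1 2
    using open_cubeD[of d "{1..n}" n] by (cases "n = 0") auto
qed

text \<open>The coordinates \<open>d\<^sub>k = \<delta>\<^sub>k(x)\<close>, in which \<open>dx\<^sub>n = dd\<^sub>n / d\<^sub>n\<^sub>-\<^sub>1\<close>.\<close>

lemma nn_integral_delta: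
  assumes "F \<in> borel_measurable (lebesgue_prod n)"
  shows "(\<integral>\<^sup>+ x. F (\<lambda>k\<in>{1..n}. delta x k) * indicator (cube n) x \<partial>lebesgue_prod n)
    = (\<integral>\<^sup>+ d. F d * (ennreal (1 / (\<Prod>k\<in>{1..<n}. d k)) * indicator (delta_region n) d) \<partial>lebesgue_prod n)"
  using assms
proof (induction n arbitrary: F)
  case 0
  show ?case
    by (intro nn_integral_cong) (auto simp: space_PiM open_cube_def delta_region_def restrict_def PiE_iff extensional_def split: split_indicator)
next
  case (Suc n)
  interpret product_sigma_finite "\<lambda>_::nat. lborel :: real measure" by (rule product_sigma_finite_lborel)
  have ins: "{1..Suc n} = insert (Suc n) {1..n}" by auto
  let ?Q = "Pi\<^sub>M (insert (Suc n) {1..n}) (\<lambda>_. lborel) :: (nat \<Rightarrow> real) measure"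
  let ?J = "\<lambda>m d. ennreal (1 / (\<Prod>k\<in>{1..<m}. d k)) * indicator (delta_region m) d"
  \<comment> \<open>\<open>D\<close> is delta_n in the coordinates d, with delta_0 = 1 for n = 0.
    \<open>G\<close> integrates out the last coordinate u = 1 - t D(d), where 0 < t < 1; dt = du /
    D(d) up to orientation accounts for the new Jacobian factor. The induction hypothesis is applied
    to \<open>G\<close>.\<close>
  define D where "D d = (if n = 0 then 1 else d n)" for d :: "nat \<Rightarrow> real"
  define G where "G d = (\<integral>\<^sup>+ u. F (d(Suc n := u)) * (ennreal (1 / D d) * indicator {1 - D d<..<1} u) \<partial>lborel)" for d
  have F [measurable]: "F \<in> borel_measurable ?Q"
    using Suc.prems ins by simp
  have D [measurable]: "D \<in> borel_measurable (lebesgue_prod n)"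
  proof (cases "n = 0")
    case False
    then show ?thesis using measurable_coordinate[of n "{1..n}"] by (simp add: D_def[abs_def])
  qed (simp add: D_def[abs_def])
  have upd: "(\<lambda>(d, u). d(Suc n := u)) \<in> measurable (lebesgue_prod n \<Otimes>\<^sub>M lborel) ?Q"
    by (rule measurable_add_dim)
  have [measurable]: "(\<lambda>z. F ((fst z)(Suc n := snd z))) \<in> borel_measurable (lebesgue_prod n \<Otimes>\<^sub>M lborel)"
    using measurable_compose[OF upd F] by (simp add: case_prod_beta')
  have G: "G \<in> borel_measurable (lebesgue_prod n)"
  proof -
    have "(\<lambda>z. F ((fst z)(Suc n := snd z)) * (ennreal (1 / D (fst z)) * indicator {z. 1 - D (fst z) < snd z \<and> snd z < 1} z))
        \<in> borel_measurable (lebesgue_prod n \<Otimes>\<^sub>M lborel)"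
      by measurable
    then have "(\<lambda>d. \<integral>\<^sup>+ u. (\<lambda>z. F ((fst z)(Suc n := snd z)) * (ennreal (1 / D (fst z)) * indicator {z. 1 - D (fst z) < snd z \<and> snd z < 1} z)) (d, u) \<partial>lborel)
        \<in> borel_measurable (lebesgue_prod n)"
      by (rule lborel.borel_measurable_nn_integral_fst)
    also have "(\<lambda>d. \<integral>\<^sup>+ u. (\<lambda>z. F ((fst z)(Suc n := snd z)) * (ennreal (1 / D (fst z)) * indicator {z. 1 - D (fst z) < snd z \<and> snd z < 1} z)) (d, u) \<partial>lborel) = G"
      by (auto simp: G_def fun_eq_iff indicator_def intro!: nn_integral_cong)
    finally show ?thesis .
  qed
  have T: "(\<lambda>x. \<lambda>k\<in>{1..Suc n}. delta x k) \<in> measurable (lebesgue_prod (Suc n)) (lebesgue_prod (Suc n))"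
  proof (rule measurable_restrict)
    fix k assume "k \<in> {1..Suc n}"
    then have "(\<lambda>x. delta x k) \<in> borel_measurable (lebesgue_prod (Suc n))"
      by (intro measurable_delta) auto
    then show "(\<lambda>x. delta x k) \<in> measurable (lebesgue_prod (Suc n)) lborel" by simp
  qed
  have 1: "(\<lambda>x. F (\<lambda>k\<in>{1..Suc n}. delta x k) * indicator (cube (Suc n)) x) \<in> borel_measurable ?Q"
  proof -
    have [measurable]: "(\<lambda>x. F (\<lambda>k\<in>{1..Suc n}. delta x k)) \<in> borel_measurable (lebesgue_prod (Suc n))"
      by (rule measurable_compose[OF T Suc.prems])
    show ?thesis unfolding ins[symmetric] by measurable
  qed
  have 2: "(\<lambda>d. F d * ?J (Suc n) d) \<in> borel_measurable ?Q"
  proof -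
    have [measurable]: "(\<lambda>d. \<Prod>k\<in>{1..<Suc n}. d k) \<in> borel_measurable (lebesgue_prod (Suc n))"
      by (intro borel_measurable_prod measurable_coordinate) auto
    have [measurable]: "F \<in> borel_measurable (lebesgue_prod (Suc n))" by (rule Suc.prems)
    show ?thesis unfolding ins[symmetric] by measurable
  qed
  \<comment> \<open>Integrating over the last cube coordinate t, for fixed x, gives \<open>G\<close>
    at the delta coordinates of x.\<close>
  have inner: "(\<integral>\<^sup>+ t. F (\<lambda>k\<in>{1..Suc n}. delta (x(Suc n := t)) k) * indicator (cube (Suc n)) (x(Suc n := t)) \<partial>lborel)
      = G (\<lambda>k\<in>{1..n}. delta x k) * indicator (cube n) x"
    if x: "x \<in> space (lebesgue_prod n)" for x
  proof -
    define d where "d = (\<lambda>k\<in>{1..n}. delta x k)"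
    have d: "(\<lambda>k\<in>{1..Suc n}. delta (x(Suc n := t)) k) = d(Suc n := 1 - t * delta x n)" for t
    proof -
      have "delta (x(Suc n := t)) k = delta x k" if "k \<le> n" for k
        using that by (intro delta_cong) auto
      then show ?thesis by (auto simp: d_def fun_eq_iff)
    qed
    have Dd: "D d = delta x n" by (auto simp: D_def d_def)
    have cube: "x(Suc n := t) \<in> cube (Suc n) \<longleftrightarrow> x \<in> cube n \<and> t \<in> {0<..<1}" for t
      using x unfolding open_cube_def PiE_iff ins space_PiM by (auto simp: extensional_def)
    show ?thesis
    proof (cases "x \<in> cube n")
      case True
      then have D0: "0 < delta x n" by (intro delta_pos_cube) auto
      have [measurable]: "(\<lambda>u. F (d(Suc n := u))) \<in> borel_measurable borel"
      proof -
        have "(\<lambda>u. d(Suc n := u)) \<in> measurable lborel ?Q"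
          by (rule measurable_component_update) (auto simp: d_def space_PiM)
        from measurable_compose[OF this F] show ?thesis by simp
      qed
      have "G d = \<bar>- delta x n\<bar> * (\<integral>\<^sup>+ t. F (d(Suc n := 1 + (- delta x n) * t)) *
          (ennreal (1 / delta x n) * indicator {1 - delta x n<..<1} (1 + (- delta x n) * t)) \<partial>lborel)"
        unfolding G_def Dd using D0 by (intro nn_integral_real_affine) auto
      also have "\<dots> = ennreal (delta x n) * (\<integral>\<^sup>+ t. ennreal (1 / delta x n) * (F (d(Suc n := 1 - t * delta x n)) * indicator {0<..<1} t) \<partial>lborel)"
      proof -
        have "indicator {1 - delta x n<..<1} (1 + (- delta x n) * t) = (indicator {0<..<1} t :: ennreal)" for t
          using D0 by (auto simp: indicator_def zero_less_mult_iff)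
        moreover have "1 + (- delta x n) * t = 1 - t * delta x n" for t by simp
        ultimately show ?thesis using D0 by (simp add: mult_ac)
      qed
      also have "\<dots> = ennreal (delta x n) * (ennreal (1 / delta x n) * (\<integral>\<^sup>+ t. F (d(Suc n := 1 - t * delta x n)) * indicator {0<..<1} t \<partial>lborel))"
      proof (subst nn_integral_cmult)
        have "(\<lambda>t. F (d(Suc n := 1 - t * delta x n))) \<in> borel_measurable borel"
          by (rule measurable_compose[where g="\<lambda>u. F (d(Suc n := u))" and N=borel]) auto
        then show "(\<lambda>t. F (d(Suc n := 1 - t * delta x n)) * indicator {0<..<1} t) \<in> borel_measurable lborel"
          by simp
      qed simp
      also have "\<dots> = (\<integral>\<^sup>+ t. F (d(Suc n := 1 - t * delta x n)) * indicator {0<..<1} t \<partial>lborel)"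
        using D0 by (simp add: mult.assoc[symmetric] ennreal_mult[symmetric])
      finally have Gd: "G d = (\<integral>\<^sup>+ t. F (d(Suc n := 1 - t * delta x n)) * indicator {0<..<1} t \<partial>lborel)" .
      have "indicator (cube (Suc n)) (x(Suc n := t)) = (indicator {0<..<1} t :: ennreal)" for t
        using True by (simp add: indicator_def cube del: One_nat_def)
      then show ?thesis using True unfolding d d_def[symmetric] Gd by simp
    qed (simp add: cube del: One_nat_def)
  qed
  \<comment> \<open>The same \<open>G\<close> seen from the other side: Jacobian and region for n +
    1 are those for n times the contribution of the last coordinate.\<close>
  have outer: "G d * ?J n d = (\<integral>\<^sup>+ u. F (d(Suc n := u)) * ?J (Suc n) (d(Suc n := u)) \<partial>lborel)"
    if d: "d \<in> space (lebesgue_prod n)" for d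
  proof (cases "d \<in> delta_region n")
    case True
    have [measurable]: "(\<lambda>u. F (d(Suc n := u))) \<in> borel_measurable borel"
    proof -
      have "(\<lambda>u. d(Suc n := u)) \<in> measurable lborel ?Q"
        by (rule measurable_component_update) (use d in auto)
      from measurable_compose[OF this F] show ?thesis by simp
    qed
    have pos: "0 < d k" if "k \<in> {1..n}" for k
      using True that by (auto simp: delta_region_def dest: open_cubeD)
    have Dpos: "0 < D d" using pos by (auto simp: D_def)
    have prod: "(\<Prod>k\<in>{1..<Suc n}. (d(Suc n := u)) k) = (\<Prod>k\<in>{1..<n}. d k) * D d" for u
    proof (cases "n = 0")
      case False
      then have "{1..<Suc n} = insert n {1..<n}" by auto
      with False show ?thesis by (simp add: D_def mult.commute)
    qed (simp add: D_def)
    have "0 < (\<Prod>k\<in>{1..<n}. d k)" using pos by (intro prod_pos) auto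
    then have J: "?J (Suc n) (d(Suc n := u)) = ennreal (1 / (\<Prod>k\<in>{1..<n}. d k)) * (ennreal (1 / D d) * indicator {1 - D d<..<1} u)" for u
      unfolding prod using d True Dpos
      by (auto simp: fun_upd_in_delta_region space_PiM PiE_def D_def[symmetric] ennreal_mult[symmetric] mult.assoc[symmetric] indicator_def)
    show ?thesis unfolding G_def J using True
      by (subst nn_integral_multc[symmetric]) (auto simp: mult_ac intro!: nn_integral_cong)
  next
    case False
    then have "d(Suc n := u) \<notin> delta_region (Suc n)" for u
      using d by (auto simp: fun_upd_in_delta_region space_PiM PiE_def)
    then show ?thesis using False by simp
  qed
  have "(\<integral>\<^sup>+ x. F (\<lambda>k\<in>{1..Suc n}. delta x k) * indicator (cube (Suc n)) x \<partial>lebesgue_prod (Suc n))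
      = (\<integral>\<^sup>+ x. G (\<lambda>k\<in>{1..n}. delta x k) * indicator (cube n) x \<partial>lebesgue_prod n)"
  proof -
    have "(\<integral>\<^sup>+ x. F (\<lambda>k\<in>{1..Suc n}. delta x k) * indicator (cube (Suc n)) x \<partial>lebesgue_prod (Suc n))
      = (\<integral>\<^sup>+ x. (\<integral>\<^sup>+ t. F (\<lambda>k\<in>{1..Suc n}. delta (x(Suc n := t)) k) * indicator (cube (Suc n)) (x(Suc n := t)) \<partial>lborel) \<partial>lebesgue_prod n)"
      using product_nn_integral_insert[OF _ _ 1] unfolding ins[symmetric] by simp
    also have "\<dots> = (\<integral>\<^sup>+ x. G (\<lambda>k\<in>{1..n}. delta x k) * indicator (cube n) x \<partial>lebesgue_prod n)"
      by (rule nn_integral_cong) (rule inner)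
    finally show ?thesis .
  qed
  also have "\<dots> = (\<integral>\<^sup>+ d. G d * ?J n d \<partial>lebesgue_prod n)"
    by (rule Suc.IH[OF G])
  also have "\<dots> = (\<integral>\<^sup>+ d. (\<integral>\<^sup>+ u. F (d(Suc n := u)) * ?J (Suc n) (d(Suc n := u)) \<partial>lborel) \<partial>lebesgue_prod n)"
    by (intro nn_integral_cong outer)
  also have "\<dots> = (\<integral>\<^sup>+ d. F d * ?J (Suc n) d \<partial>lebesgue_prod (Suc n))"
    using product_nn_integral_insert[OF _ _ 2] unfolding ins[symmetric] by simp
  finally show ?case .
qed

text \<open>The exponent of d_k after the change of variables. Besides b_1 or -c_k, the denominators
  of x_{k+1} = (1 - d_{k+1}) / d_k and 1 - x_{k+1} = (d_k + d_{k+1} - 1) / d_k contribute -(a_{k+1}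
  + b_{k+1}). The final -1 is the Jacobian for k < n, and the factor 1 / delta_n of the integrand
  for k = n.\<close>

definition delta_exponent :: "nat \<Rightarrow> params \<Rightarrow> nat \<Rightarrow> int" where
  "delta_exponent n p k = (if k = 1 then p (B 1) else - p (C k))
     + (if k < n then - (p (A (Suc k)) + p (B (Suc k))) else 0) + (- 1)"

definition delta_integrand :: "nat \<Rightarrow> params \<Rightarrow> (nat \<Rightarrow> real) \<Rightarrow> real" where
  "delta_integrand n p d = (\<Prod>k\<in>{1..n}. (1 - d k) powi p (A k))
     * (\<Prod>k\<in>{1..<n}. (d k + d (Suc k) - 1) powi p (B (Suc k)))
     * (\<Prod>k\<in>{1..n}. d k powi delta_exponent n p k)"

text \<open>The extra product is the inverse of the Jacobian in \<open>nn_integral_delta\<close>, so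
  that only \<open>delta_integrand\<close> survives the substitution.\<close>

lemma integrand_eq_delta_integrand:
  assumes "2 \<le> n" "x \<in> cube n"
  shows "integrand n p x = delta_integrand n p (delta x) * (\<Prod>k\<in>{1..<n}. delta x k)"
proof -
  obtain m where n: "n = Suc m" using assms(1) by (cases n) auto
  define d where "d = delta x"
  have dpos: "0 < d k" if "k \<le> n" for k using delta_pos_cube[OF assms(2) that] by (simp add: d_def)
  have d1: "d 1 = 1 - x 1" by (simp add: d_def)
  have dS: "d (Suc k) = 1 - x (Suc k) * d k" for k by (simp add: d_def)
  have first: "(\<Prod>k\<in>{1..n}. f k) = f 1 * (\<Prod>k\<in>{1..m}. f (Suc k))" for f :: "nat \<Rightarrow> real"
    unfolding n by (subst prod.atLeast_Suc_atMost) (simp_all add: prod.atLeast_Suc_atMost_Suc_shift del: prod.cl_ivl_Suc)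
  have last: "(\<Prod>k\<in>{1..n}. f k) = (\<Prod>k\<in>{1..m}. f k) * f n" for f :: "nat \<Rightarrow> real"
    unfolding n by (simp add: mult.commute)
  have two: "(\<Prod>k\<in>{2..n}. f k) = (\<Prod>k\<in>{1..m}. f (Suc k))" for f :: "nat \<Rightarrow> real"
    unfolding n numeral_2_eq_2 by (simp only: prod.atLeast_Suc_atMost_Suc_shift One_nat_def comp_def)
  have less: "{1..<n} = {1..m}" using n by auto
  have factor: "x (Suc k) powi p (A (Suc k)) * (1 - x (Suc k)) powi p (B (Suc k)) =
      (1 - d (Suc k)) powi p (A (Suc k)) * (d k + d (Suc k) - 1) powi p (B (Suc k))
      * d k powi (- (p (A (Suc k)) + p (B (Suc k))))" if "k \<in> {1..m}" for k
  proof -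
    have nz: "d k \<noteq> 0" using dpos[of k] that n by auto
    have "x (Suc k) = (1 - d (Suc k)) / d k" "1 - x (Suc k) = (d k + d (Suc k) - 1) / d k"
      using nz dS[of k] by (auto simp: field_simps)
    moreover have "d k powi (- (p (A (Suc k)) + p (B (Suc k)))) = inverse (d k powi p (A (Suc k))) * inverse (d k powi p (B (Suc k)))"
      using nz by (simp only: power_int_minus power_int_add inverse_mult_distrib simp_thms)
    ultimately show ?thesis
      by (simp only: power_int_divide_distrib) (simp add: divide_inverse mult_ac)
  qed
  have exps: "(\<Prod>k\<in>{1..n}. d k powi delta_exponent n p k) * (\<Prod>k\<in>{1..m}. d k) =
     d 1 powi p (B 1) * (\<Prod>k\<in>{1..m}. d (Suc k) powi (- p (C (Suc k))))
      * (\<Prod>k\<in>{1..m}. d k powi (- (p (A (Suc k)) + p (B (Suc k))))) * inverse (d n)"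
  proof -
    have "(\<Prod>k\<in>{1..n}. d k powi delta_exponent n p k) =
       (\<Prod>k\<in>{1..n}. d k powi (if k = 1 then p (B 1) else - p (C k)))
       * (\<Prod>k\<in>{1..n}. d k powi (if k < n then - (p (A (Suc k)) + p (B (Suc k))) else 0))
       * (\<Prod>k\<in>{1..n}. inverse (d k))"
      unfolding prod.distrib[symmetric] delta_exponent_def
    proof (rule prod.cong)
      fix k assume "k \<in> {1..n}"
      then have "d k \<noteq> 0" using dpos[of k] by auto
      then show "d k powi ((if k = 1 then p (B 1) else - p (C k)) + (if k < n then - (p (A (Suc k)) + p (B (Suc k))) else 0) + (- 1))
        = d k powi (if k = 1 then p (B 1) else - p (C k)) * d k powi (if k < n then - (p (A (Suc k)) + p (B (Suc k))) else 0) * inverse (d k)"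
        by (simp only: power_int_add power_int_minus power_int_1_right simp_thms)
    qed simp
    also have "(\<Prod>k\<in>{1..n}. d k powi (if k = 1 then p (B 1) else - p (C k)))
       = d 1 powi p (B 1) * (\<Prod>k\<in>{1..m}. d (Suc k) powi (- p (C (Suc k))))"
      unfolding first by (auto intro!: prod.cong)
    also have "(\<Prod>k\<in>{1..n}. d k powi (if k < n then - (p (A (Suc k)) + p (B (Suc k))) else 0))
       = (\<Prod>k\<in>{1..m}. d k powi (- (p (A (Suc k)) + p (B (Suc k)))))"
      unfolding last using n by (auto intro!: prod.cong)
    also have "(\<Prod>k\<in>{1..n}. inverse (d k)) = (\<Prod>k\<in>{1..m}. inverse (d k)) * inverse (d n)"
      by (rule last)
    finally have "(\<Prod>k\<in>{1..n}. d k powi delta_exponent n p k) * (\<Prod>k\<in>{1..m}. d k) =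
     d 1 powi p (B 1) * (\<Prod>k\<in>{1..m}. d (Suc k) powi (- p (C (Suc k))))
      * (\<Prod>k\<in>{1..m}. d k powi (- (p (A (Suc k)) + p (B (Suc k))))) * inverse (d n)
      * ((\<Prod>k\<in>{1..m}. inverse (d k)) * (\<Prod>k\<in>{1..m}. d k))"
      by (simp only: mult_ac)
    moreover have "(\<Prod>k\<in>{1..m}. inverse (d k)) * (\<Prod>k\<in>{1..m}. d k) = 1"
      unfolding prod.distrib[symmetric]
    proof (intro prod.neutral ballI)
      fix k assume "k \<in> {1..m}"
      then have "d k \<noteq> 0" using dpos[of k] n by auto
      then show "inverse (d k) * d k = 1" by simp
    qed
    ultimately show ?thesis by (simp only: mult_1_right)
  qed
  have "integrand n p x = x 1 powi p (A 1) * (1 - x 1) powi p (B 1)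
      * (\<Prod>k\<in>{1..m}. (1 - d (Suc k)) powi p (A (Suc k)) * (d k + d (Suc k) - 1) powi p (B (Suc k))
          * d k powi (- (p (A (Suc k)) + p (B (Suc k)))))
      / (\<Prod>k\<in>{1..m}. d (Suc k) powi p (C (Suc k))) / d n"
    unfolding integrand_def first two d_def[symmetric] by (simp only: factor cong: prod.cong)
  also have "\<dots> = (1 - d 1) powi p (A 1) * (\<Prod>k\<in>{1..m}. (1 - d (Suc k)) powi p (A (Suc k)))
      * (\<Prod>k\<in>{1..m}. (d k + d (Suc k) - 1) powi p (B (Suc k)))
      * (d 1 powi p (B 1) * (\<Prod>k\<in>{1..m}. d (Suc k) powi (- p (C (Suc k))))
      * (\<Prod>k\<in>{1..m}. d k powi (- (p (A (Suc k)) + p (B (Suc k))))) * inverse (d n))"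
    by (simp add: d1 prod.distrib power_int_minus prod_inversef[symmetric] divide_inverse mult_ac del: One_nat_def)
  also have "\<dots> = delta_integrand n p d * (\<Prod>k\<in>{1..<n}. d k)"
    unfolding exps[symmetric] delta_integrand_def first[of "\<lambda>k. (1 - d k) powi p (A k)"] less
    by (simp only: mult_ac)
  finally show ?thesis by (simp add: d_def)
qed

lemma L_eq_delta_integral:
  assumes "2 \<le> n"
  shows "L n p = (\<integral>\<^sup>+ d. ennreal (delta_integrand n p d) * indicator (delta_region n) d \<partial>lebesgue_prod n)"
proof -
  note [measurable] = measurable_coordinate[where I="{1..n}"]
  let ?P = "\<lambda>d. \<Prod>k\<in>{1..<n}. d k :: real"
  let ?F = "\<lambda>d. ennreal (delta_integrand n p d * ?P d)"
  have restr: "delta_integrand n p (\<lambda>k\<in>{1..n}. delta x k) = delta_integrand n p (delta x)"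
      "?P (\<lambda>k\<in>{1..n}. delta x k) = ?P (delta x)" for x
    unfolding delta_integrand_def by (auto intro!: arg_cong2[where f="(*)"] prod.cong)
  have "L n p = (\<integral>\<^sup>+ x. ?F (\<lambda>k\<in>{1..n}. delta x k) * indicator (cube n) x \<partial>lebesgue_prod n)"
    unfolding L_open_cube restr
    by (intro nn_integral_cong) (auto simp: integrand_eq_delta_integrand[OF assms] split: split_indicator)
  also have "\<dots> = (\<integral>\<^sup>+ d. ?F d * (ennreal (1 / ?P d) * indicator (delta_region n) d) \<partial>lebesgue_prod n)"
    by (rule nn_integral_delta) (unfold delta_integrand_def, measurable)
  also have "\<dots> = (\<integral>\<^sup>+ d. ennreal (delta_integrand n p d) * indicator (delta_region n) d \<partial>lebesgue_prod n)"
  proof (rule nn_integral_cong)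
    fix d
    show "?F d * (ennreal (1 / ?P d) * indicator (delta_region n) d) = ennreal (delta_integrand n p d) * indicator (delta_region n) d"
    proof (cases "d \<in> delta_region n")
      case True
      then have "0 < ?P d" using open_cubeD[of d "{1..n}"]
        by (intro prod_pos) (auto simp: delta_region_def)
      define P where "P = ?P d"
      have "ennreal (delta_integrand n p d * P) * ennreal (1 / P) = ennreal (delta_integrand n p d)"
        using \<open>0 < ?P d\<close> unfolding P_def[symmetric] by (simp add: ennreal_mult''[symmetric])
      then show ?thesis using True by (simp add: P_def)
    qed simp
  qed
  finally show ?thesis .
qed

text \<open>Reversing the d_k sends a_k to a_{n+1-k} and b_k to b_{n+2-k} for k \<ge> 2. The
  remaining entries of \<open>\<psi>\<close> are the ones that make the sequence
  \<open>delta_exponent\<close> reversed as well: k = 1 fixes b'_1, k = n fixes c'_n, and the other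
  k fix c'_k.\<close>

lemma L_\<psi>:
  assumes n: "2 \<le> n" and p: "p \<in> E_set n"
  shows "L n (\<psi> n p) = L n p"
proof -
  define R where "R d = (\<lambda>k\<in>{1..n}. d (Suc n - k))" for d :: "nat \<Rightarrow> real"
  note [measurable] = measurable_coordinate[where I="{1..n}"]
  have A: "\<psi> n p (A k) = p (A (Suc n - k))" if "k \<in> {1..n}" for k
    using p that by (auto simp: \<psi>_def coords_def)
  have B: "\<psi> n p (B k) = (if k = 1 then p (A (n-1)) + p (B n) - p (C n) else p (B (n+2-k)))" if "k \<in> {1..n}" for k
    using p that by (auto simp: \<psi>_def coords_def)
  have C: "\<psi> n p (C k) = (if k = n then p (A 2) + p (B 2) - p (B 1)
             else p (A (n+2-k)) + p (B (n+2-k)) + p (C (n+1-k)) - p (B (n+1-k)) - p (A (n-k)))" if "k \<in> {2..n}" for k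
    using p that by (auto simp: \<psi>_def coords_def)
  have e: "delta_exponent n (\<psi> n p) k = delta_exponent n p (Suc n - k)" if "k \<in> {1..n}" for k
  proof -
    have "k = 1 \<or> (k = n \<and> k \<noteq> 1) \<or> k \<in> {2..<n}" using that by auto
    then consider "k = 1" | "k = n" "k \<noteq> 1" | "k \<in> {2..<n}" by blast
    then show ?thesis
    proof cases
      case 1
      then show ?thesis using n A[of 2] B[of 1] B[of 2] by (auto simp: delta_exponent_def numeral_2_eq_2)
    next
      case 2
      then show ?thesis using n C[of n] by (auto simp: delta_exponent_def numeral_2_eq_2)
    next
      case 3
      then have "Suc (Suc n - k) = n + 2 - k" "n + 1 - k = Suc n - k" "n - k = Suc n - Suc k" "n + 2 - Suc k = Suc n - k" by auto
      then show ?thesis using 3 A[of "Suc k"] B[of "Suc k"] C[of k] by (auto simp: delta_exponent_def)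
    qed
  qed
  have int: "delta_integrand n (\<psi> n p) d = delta_integrand n p (R d)" for d
  proof -
    have "(\<Prod>k\<in>{1..n}. (1 - d k) powi \<psi> n p (A k)) = (\<Prod>k\<in>{1..n}. (1 - R d k) powi p (A k))"
      by (rule prod.reindex_bij_witness[where i="\<lambda>k. Suc n - k" and j="\<lambda>k. Suc n - k"]) (auto simp: R_def A)
    moreover have "(\<Prod>k\<in>{1..<n}. (d k + d (Suc k) - 1) powi \<psi> n p (B (Suc k))) =
        (\<Prod>k\<in>{1..<n}. (R d k + R d (Suc k) - 1) powi p (B (Suc k)))"
    proof (rule prod.reindex_bij_witness[where i="\<lambda>k. n - k" and j="\<lambda>k. n - k"])
      fix k assume k: "k \<in> {1..<n}"
      then have "Suc n - (n - k) = Suc k" "Suc n - Suc (n - k) = k" "n + 2 - Suc k = Suc (n - k)" by auto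
      then show "(R d (n - k) + R d (Suc (n - k)) - 1) powi p (B (Suc (n - k))) = (d k + d (Suc k) - 1) powi \<psi> n p (B (Suc k))"
        using k by (auto simp: R_def B add.commute)
    qed auto
    moreover have "(\<Prod>k\<in>{1..n}. d k powi delta_exponent n (\<psi> n p) k) = (\<Prod>k\<in>{1..n}. R d k powi delta_exponent n p k)"
      by (rule prod.reindex_bij_witness[where i="\<lambda>k. Suc n - k" and j="\<lambda>k. Suc n - k"]) (auto simp: R_def e)
    ultimately show ?thesis by (simp add: delta_integrand_def)
  qed
  have region: "R d \<in> delta_region n \<longleftrightarrow> d \<in> delta_region n" if d: "d \<in> extensional {1..n}" for d
  proof -
    have imp: "R d \<in> delta_region n" if "d \<in> delta_region n" for d
    proof -
      have "1 < R d k + R d (Suc k)" if "k \<in> {1..<n}" for k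
      proof -
        have "n - k \<in> {1..<n}" "Suc n - k = Suc (n - k)" using that by auto
        then show ?thesis using \<open>d \<in> delta_region n\<close> that by (auto simp: R_def delta_region_def add.commute)
      qed
      moreover have "R d k \<in> {0<..<1}" if "k \<in> {1..n}" for k
      proof -
        have "d \<in> cube n" "Suc n - k \<in> {1..n}"
          using \<open>d \<in> delta_region n\<close> that by (auto simp: delta_region_def)
        from open_cubeD[OF this] show ?thesis using that by (simp add: R_def)
      qed
      ultimately show ?thesis unfolding delta_region_def open_cube_def PiE_iff by (auto simp: R_def)
    qed
    have "R (R d) = d" using d by (auto simp: R_def fun_eq_iff extensional_def)
    then show ?thesis using imp[of d] imp[of "R d"] by auto
  qed
  let ?f = "\<lambda>d. ennreal (delta_integrand n p d) * indicator (delta_region n) d"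
  have "L n p = (\<integral>\<^sup>+ d. ?f (R d) \<partial>lebesgue_prod n)"
    unfolding L_eq_delta_integral[OF n] R_def
  proof (rule nn_integral_PiM_reindex[where r="\<lambda>_ t. t" and \<pi>="\<lambda>k. Suc n - k", symmetric])
    show "bij_betw (\<lambda>k. Suc n - k) {1..n} {1..n}"
      by (rule bij_betw_byWitness[where f'="\<lambda>k. Suc n - k"]) auto
    show "distr lborel borel (\<lambda>t. t) = (lborel :: real measure)"
      using distr_id2[of borel lborel] by (simp add: id_def)
    show "?f \<in> borel_measurable (lebesgue_prod n)"
      unfolding delta_integrand_def by measurable
  qed auto
  also have "\<dots> = L n (\<psi> n p)"
    unfolding L_eq_delta_integral[OF n] int
    by (intro nn_integral_cong) (auto simp: region space_PiM PiE_def simp del: One_nat_def split: split_indicator)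
  finally show ?thesis ..
qed

section \<open>Euler's integral and the map \<open>\<phi>\<close>\<close>

lemma ennreal_mult_divide_cancel:
  assumes "0 < r" shows "ennreal r * (ennreal (s / r) * X) = ennreal s * X"
proof -
  have "ennreal r * ennreal (s / r) = ennreal s"
    using assms by (subst ennreal_mult'[symmetric]) auto
  then show ?thesis by (simp only: mult.assoc[symmetric])
qed

lemma nn_integral_Beta_nat:
  "(\<integral>\<^sup>+ u. ennreal (u ^ c * (1 - u) ^ d) * indicator {0..1} u \<partial>lborel)
     = ennreal (fact c * fact d / fact (c + d + 1))"
proof -
  let ?f = "\<lambda>t::real. ennreal (t powr (real c + 1 - 1) * (1 - t) powr (real d + 1 - 1)) * indicator {0..1} t"
  have "((\<lambda>t. t powr (real c + 1 - 1) * (1 - t) powr (real d + 1 - 1)) has_integral Beta (real c + 1) (real d + 1)) {0..1}"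
    by (rule has_integral_Beta_real) auto
  then have "(\<integral>\<^sup>+ t. ?f t \<partial>lborel)
      = ennreal (Beta (real c + 1) (real d + 1))"
    by (intro nn_integral_has_integral_lebesgue') auto
  \<comment> \<open>The endpoints are removed because \<open>0 powr 0 = 0\<close>, whereas
    \<open>0 ^ 0 = 1\<close>.\<close>
  moreover have "AE t in lborel. t \<noteq> (0::real) \<and> t \<noteq> 1"
    using AE_lborel_singleton[of "0::real"] AE_lborel_singleton[of "1::real"] by eventually_elim auto
  then have "(\<integral>\<^sup>+ t. ?f t \<partial>lborel)
      = (\<integral>\<^sup>+ u. ennreal (u ^ c * (1 - u) ^ d) * indicator {0..1} u \<partial>lborel)"
  proof (intro nn_integral_cong_AE, elim AE_mp, intro AE_I2 impI)
    fix t :: real assume "t \<noteq> 0 \<and> t \<noteq> 1"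
    then show "?f t
       = ennreal (t ^ c * (1 - t) ^ d) * indicator {0..1} t"
      by (cases "0 < t \<and> t < 1") (auto simp: powr_realpow indicator_def)
  qed
  moreover have "Beta (real c + 1) (real d + 1) = fact c * fact d / fact (c + d + 1)"
  proof -
    have "Gamma (real c + 1 + (real d + 1)) = fact (c + d + 1)"
      using Gamma_fact[of "c + d + 1", where 'a=real] by (simp add: add_ac)
    then show ?thesis
      using Gamma_fact[of c, where 'a=real] Gamma_fact[of d, where 'a=real] by (simp add: Beta_def add_ac)
  qed
  ultimately show ?thesis by simp
qed

text \<open>The substitution \<open>v = (1 + w) u / (1 + w u)\<close>.\<close>

lemma nn_integral_Euler:
  assumes "0 \<le> w"
  shows "(\<integral>\<^sup>+ u. ennreal (u ^ c * (1 - u) ^ d / (1 + w * u) ^ (c + d + 2)) * indicator {0..1} u \<partial>lborel)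
     = ennreal (fact c * fact d / fact (c + d + 1) / (1 + w) ^ (c + 1))" (is "?X = _")
proof -
  define g where "g u = (1 + w) * u / (1 + w * u)" for u
  define g' where "g' u = (1 + w) / (1 + w * u) ^ 2" for u
  define f where "f v = v ^ c * (1 - v) ^ d" for v :: real
  have pos: "0 < 1 + w * u" if "u \<in> {0..1}" for u using assms that by (auto intro: add_pos_nonneg)
  have g01: "g 0 = 0" "g 1 = 1" using assms by (auto simp: g_def)
  have "(\<integral>\<^sup>+ v. ennreal (f v * indicator {g 0..g 1} v) \<partial>lborel)
      = (\<integral>\<^sup>+ u. ennreal (f (g u) * g' u * indicator {0..1} u) \<partial>lborel)"
  proof (rule nn_integral_substitution)
    show "set_borel_measurable borel {g 0..g 1} f"
      unfolding set_borel_measurable_def f_def by measurable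
    show "(g has_real_derivative g' x) (at x)" if "x \<in> {0..1}" for x
      unfolding g_def g'_def using pos[OF that]
      by (auto intro!: derivative_eq_intros simp: field_simps power2_eq_square)
    show "continuous_on {0..1} g'"
      unfolding g'_def by (intro continuous_intros) (use pos in force)
    show "0 \<le> g' x" if "x \<in> {0..1}" for x
      unfolding g'_def using assms by simp
  qed simp
  also have "(\<lambda>u. ennreal (f (g u) * g' u * indicator {0..1} u))
     = (\<lambda>u. ennreal ((1 + w) ^ (c + 1)) * (ennreal (u ^ c * (1 - u) ^ d / (1 + w * u) ^ (c + d + 2)) * indicator {0..1} u))" (is "?l = ?r")
  proof (rule ext)
    fix u
    show "?l u = ?r u"
    proof (cases "u \<in> {0..1}")
      case True
      have "1 - g u = (1 - u) / (1 + w * u)" using pos[OF True] by (simp add: g_def field_simps)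
      then have "f (g u) * g' u = (1 + w) ^ (c + 1) * (u ^ c * (1 - u) ^ d / (1 + w * u) ^ (c + d + 2))"
        using pos[OF True] by (simp add: f_def g'_def g_def power_divide power_mult_distrib power_add power2_eq_square mult_ac)
      moreover have "ennreal ((1 + w) ^ (c + 1) * (u ^ c * (1 - u) ^ d / (1 + w * u) ^ (c + d + 2)))
          = ennreal ((1 + w) ^ (c + 1)) * ennreal (u ^ c * (1 - u) ^ d / (1 + w * u) ^ (c + d + 2))"
        using assms by (intro ennreal_mult') simp
      ultimately show ?thesis using True by (simp only: indicator_simps mult_1_right)
    qed simp
  qed
  finally have "ennreal ((1 + w) ^ (c + 1)) * ?X
     = (\<integral>\<^sup>+ v. ennreal (v ^ c * (1 - v) ^ d) * indicator {0..1} v \<partial>lborel)"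
    by (subst nn_integral_cmult[symmetric]) (auto simp: g01 f_def ennreal_mult'' ennreal_indicator)
  also have "\<dots> = ennreal (fact c * fact d / fact (c + d + 1))" by (rule nn_integral_Beta_nat)
  finally have *: "ennreal ((1 + w) ^ (c + 1)) * ?X
     = ennreal (fact c * fact d / fact (c + d + 1))" (is "?W * _ = _") .
  have W: "0 < (1 + w) ^ (c + 1)" using assms by simp
  have "?X = ennreal (1 / (1 + w) ^ (c + 1)) * (?W * ?X)"
    using ennreal_mult_divide_cancel[OF W, of 1 ?X] by (simp only: mult.left_commute ennreal_1 mult_1)
  also have "\<dots> = ennreal (1 / (1 + w) ^ (c + 1) * (fact c * fact d / fact (c + d + 1)))"
    unfolding * using W by (intro ennreal_mult'[symmetric]) auto
  finally show ?thesis by (simp add: mult.commute)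
qed

text \<open>Up to the factor B(a+1, b+1) this is the hypergeometric function F(c+1, a+1; a+b+2; -z).
  For a + b = c + d, exchanging (a, b) with (c, d) exchanges its two upper parameters.\<close>

definition euler_integral :: "nat \<Rightarrow> nat \<Rightarrow> nat \<Rightarrow> real \<Rightarrow> ennreal" where
  "euler_integral a b c z = (\<integral>\<^sup>+ t. ennreal (t ^ a * (1 - t) ^ b / (1 + z * t) ^ (c + 1)) * indicator {0..1} t \<partial>lborel)"

text \<open>Both sides are the double integral of
  \<open>t^a (1 - t)^b u^c (1 - u)^d / (1 + z t u)^(a + b + 2)\<close>.\<close>

lemma euler_integral_swap:
  assumes z: "0 \<le> z" and eq: "a + b = c + d"
  shows "ennreal (fact a * fact b) * euler_integral c d a z = ennreal (fact c * fact d) * euler_integral a b c z"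
proof -
  define K where "K a b c d t u = ennreal (t ^ a * (1 - t) ^ b * (u ^ c * (1 - u) ^ d / (1 + z * t * u) ^ (c + d + 2)))
      * indicator {0..1} t * indicator {0..1} u" for a b c d and t u :: real
  \<comment> \<open>The inner integral over u is \<open>nn_integral_Euler\<close> with w = z t; its
    denominator (1 + z t)^(c+1) completes \<open>euler_integral a b c z\<close>.\<close>
  have K: "(\<integral>\<^sup>+ t. \<integral>\<^sup>+ u. K a b c d t u \<partial>lborel \<partial>lborel) = ennreal (fact c * fact d / fact (c + d + 1)) * euler_integral a b c z" for a b c d
  proof -
    have "(\<integral>\<^sup>+ u. K a b c d t u \<partial>lborel) =
      ennreal (fact c * fact d / fact (c + d + 1)) * (ennreal (t ^ a * (1 - t) ^ b / (1 + z * t) ^ (c + 1)) * indicator {0..1} t)" for t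
    proof (cases "t \<in> {0..1}")
      case True
      have nn': "0 \<le> t ^ a * (1 - t) ^ b" using True by simp
      have "(\<integral>\<^sup>+ u. K a b c d t u \<partial>lborel) = (\<integral>\<^sup>+ u. ennreal (t ^ a * (1 - t) ^ b) *
          (ennreal (u ^ c * (1 - u) ^ d / (1 + (z * t) * u) ^ (c + d + 2)) * indicator {0..1} u) \<partial>lborel)"
        using True by (intro nn_integral_cong) (simp only: K_def ennreal_mult'[OF nn'] indicator_simps mult_1_right mult.assoc[of "ennreal _"])
      also have "\<dots> = ennreal (t ^ a * (1 - t) ^ b) * ennreal (fact c * fact d / fact (c + d + 1) / (1 + z * t) ^ (c + 1))"
      proof (subst nn_integral_cmult)
        have "0 \<le> z * t" using True z by simp
        then show "ennreal (t ^ a * (1 - t) ^ b) * (\<integral>\<^sup>+ u. ennreal (u ^ c * (1 - u) ^ d / (1 + (z * t) * u) ^ (c + d + 2)) * indicator {0..1} u \<partial>lborel)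
          = ennreal (t ^ a * (1 - t) ^ b) * ennreal (fact c * fact d / fact (c + d + 1) / (1 + z * t) ^ (c + 1))"
          by (simp only: nn_integral_Euler)
      qed measurable
      also have "\<dots> = ennreal (fact c * fact d / fact (c + d + 1)) * ennreal (t ^ a * (1 - t) ^ b / (1 + z * t) ^ (c + 1))"
        by (subst (1 2) ennreal_mult'[symmetric]) (use nn' in \<open>simp_all add: mult_ac\<close>)
      finally show ?thesis using True by simp
    qed (simp add: K_def)
    then show ?thesis unfolding euler_integral_def by (simp add: nn_integral_cmult)
  qed
  have [measurable]: "(\<lambda>(t, u). K a b c d t u) \<in> borel_measurable (lborel \<Otimes>\<^sub>M lborel)"
    unfolding K_def by measurable
  \<comment> \<open>The exponent of 1 + z t u is the same on both sides because a + b = c +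
    d.\<close>
  have "K c d a b u t = K a b c d t u" for t u
    by (simp add: K_def eq mult_ac)
  then have "(\<integral>\<^sup>+ t. \<integral>\<^sup>+ u. K a b c d t u \<partial>lborel \<partial>lborel) = (\<integral>\<^sup>+ t. \<integral>\<^sup>+ u. K c d a b t u \<partial>lborel \<partial>lborel)"
    using lborel_pair.Fubini'[of "K a b c d"] by simp
  then have *: "ennreal (fact c * fact d / fact (c + d + 1)) * euler_integral a b c z
      = ennreal (fact a * fact b / fact (a + b + 1)) * euler_integral c d a z"
    unfolding K .
  have "ennreal (fact (c + d + 1)) * (ennreal (fact c * fact d / fact (c + d + 1)) * euler_integral a b c z)
      = ennreal (fact c * fact d) * euler_integral a b c z"
    by (rule ennreal_mult_divide_cancel) simp
  moreover have "ennreal (fact (a + b + 1)) * (ennreal (fact a * fact b / fact (a + b + 1)) * euler_integral c d a z)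
      = ennreal (fact a * fact b) * euler_integral c d a z"
    by (rule ennreal_mult_divide_cancel) simp
  ultimately show ?thesis using * eq by metis
qed

lemma fun_upd_in_open_cube:
  assumes "x \<in> extensional I" "j \<notin> I"
  shows "x(j := t) \<in> open_cube (insert j I) \<longleftrightarrow> x \<in> open_cube I \<and> t \<in> {0<..<1}"
  using assms unfolding open_cube_def PiE_iff by (auto simp: extensional_def)

text \<open>As a function of t = x_{n-1} the integrand is W t^a (1 - t)^b / (1 + z t)^(c+1), with W
  and z free of t. \<open>\<phi>\<close> replaces (a, b, c, d) by (c, d, a, b), where d = a + b - c,
  and preserves W because it preserves b_n - c_n. So \<open>euler_integral_swap\<close> applies for
  each value of the other variables.\<close>

lemma L_\<phi>:
  assumes n: "2 \<le> n" and p: "p \<in> E_set n"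
    and nonneg: "0 \<le> p (A (n-1))" "0 \<le> p (B (n-1))" "0 \<le> p (C n)" "0 \<le> p (A (n-1)) + p (B (n-1)) - p (C n)"
  shows "L n (\<phi> n p) * of_nat (ifact (p (A (n-1))) * ifact (p (B (n-1))))
    = L n p * of_nat (ifact (p (C n)) * ifact (p (A (n-1)) + p (B (n-1)) - p (C n)))"
proof -
  interpret product_sigma_finite "\<lambda>_::nat. lborel :: real measure" by (rule product_sigma_finite_lborel)
  obtain m where m: "n = Suc (Suc m)" using n by (metis Suc_le_D numeral_2_eq_2 Suc_le_mono)
  define j where "j = Suc m"
  have j: "n - 1 = j" "j \<noteq> n" by (auto simp: m j_def)
  define I where "I = {1..n} - {j}"
  have I: "{1..n} = insert j I" "finite I" "j \<notin> I" "n \<in> I" by (auto simp: I_def j_def m)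
  obtain a b c d where abcd: "p (A j) = int a" "p (B j) = int b" "p (C n) = int c" "int a + int b - int c = int d"
    using nonneg unfolding j by (metis nonneg_int_cases)
  have eq: "a + b = c + d" using abcd(4) by linarith
  \<comment> \<open>This is the z for which delta_n = (1 - x_n) (1 + z x_{n-1});
    \<open>delta x m\<close> is delta_{n-2}.\<close>
  define z where "z x = x n * delta x m / (1 - x n)" for x
  define W where "W q x = (\<Prod>k\<in>I. x k powi q (A k)) * (\<Prod>k\<in>I-{n}. (1 - x k) powi q (B k)) * (1 - x n) powi (q (B n) - q (C n) - 1)" for q :: params and x :: "nat \<Rightarrow> real"
  have split: "integrand n q (x(j := t)) = W q x * (t powi q (A j) * (1 - t) powi q (B j) * (1 + z x * t) powi (- q (C n) - 1))"
    if x: "x \<in> open_cube I" and t: "t \<in> {0<..<1}" and q: "\<forall>k\<in>{2..n-1}. q (C k) = 0" for q x t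
  proof -
    have xn: "0 < x n" "x n < 1" using open_cubeD[OF x I(4)] by auto
    have dm: "delta (x(j := t)) m = delta x m" by (intro delta_cong) (auto simp: j_def)
    have "0 \<le> delta x m" by (intro delta_bounds) (use open_cubeD[OF x] in \<open>force simp: I_def j_def m\<close>)
    then have z: "0 \<le> z x" using xn by (simp add: z_def)
    then have zt: "0 < 1 + z x * t" using t by (auto intro: add_pos_nonneg)
    have "delta (x(j := t)) n = 1 - x n * (1 - t * delta x m)"
      using dm by (simp add: m j_def)
    also have "\<dots> = (1 - x n) * (1 + z x * t)" using xn by (simp add: z_def field_simps)
    finally have dn: "delta (x(j := t)) n = (1 - x n) * (1 + z x * t)" .
    \<comment> \<open>t also occurs in delta_{n-1}; since c_2, ..., c_{n-1} vanish, the denominator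
      depends on t through delta_n only.\<close>
    have "(\<Prod>k=2..n. delta (x(j := t)) k powi q (C k)) = delta (x(j := t)) n powi q (C n)"
    proof -
      have "{2..n} = insert n {2..n-1}" using n by auto
      moreover have "(\<Prod>k\<in>{2..n-1}. delta (x(j := t)) k powi q (C k)) = 1"
        using q by (intro prod.neutral) auto
      ultimately show ?thesis using n by simp
    qed
    moreover have "1 / (u powi q (C n)) / u = u powi (- q (C n) - 1)" if "0 < u" for u :: real
      using that by (simp add: power_int_diff power_int_minus divide_inverse)
    ultimately have "1 / (\<Prod>k=2..n. delta (x(j := t)) k powi q (C k)) / delta (x(j := t)) n
       = ((1 - x n) * (1 + z x * t)) powi (- q (C n) - 1)"
      using xn zt by (simp add: dn)
    also have "\<dots> = (1 - x n) powi (- q (C n) - 1) * (1 + z x * t) powi (- q (C n) - 1)"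
      by (rule power_int_mult_distrib)
    finally have den: "1 / (\<Prod>k=2..n. delta (x(j := t)) k powi q (C k)) / delta (x(j := t)) n = \<dots>" .
    have "(\<Prod>k=1..n. (x(j := t)) k powi q (A k) * (1 - (x(j := t)) k) powi q (B k))
      = t powi q (A j) * (1 - t) powi q (B j) * (\<Prod>k\<in>I. x k powi q (A k) * (1 - x k) powi q (B k))"
    proof -
      have "(\<Prod>k\<in>I. (x(j := t)) k powi q (A k) * (1 - (x(j := t)) k) powi q (B k))
          = (\<Prod>k\<in>I. x k powi q (A k) * (1 - x k) powi q (B k))"
        by (rule prod.cong) (use I(3) in auto)
      then show ?thesis unfolding I(1) using I(2,3) by simp
    qed
    also have "(\<Prod>k\<in>I. x k powi q (A k) * (1 - x k) powi q (B k))
      = (\<Prod>k\<in>I. x k powi q (A k)) * ((1 - x n) powi q (B n) * (\<Prod>k\<in>I-{n}. (1 - x k) powi q (B k)))"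
      unfolding prod.distrib using I by (subst prod.remove[of I n "\<lambda>k. (1 - x k) powi q (B k)"]) auto
    finally have num: "(\<Prod>k=1..n. (x(j := t)) k powi q (A k) * (1 - (x(j := t)) k) powi q (B k)) =
       t powi q (A j) * (1 - t) powi q (B j) * \<dots>" .
    have "(1 - x n) powi (q (B n) - q (C n) - 1) = (1 - x n) powi q (B n) * (1 - x n) powi (- q (C n) - 1)"
      using xn by (simp add: power_int_add[symmetric] algebra_simps)
    moreover have "integrand n q (x(j := t)) = (\<Prod>k=1..n. (x(j := t)) k powi q (A k) * (1 - (x(j := t)) k) powi q (B k))
        * (1 / (\<Prod>k=2..n. delta (x(j := t)) k powi q (C k)) / delta (x(j := t)) n)"
      by (simp add: integrand_def)
    ultimately show ?thesis unfolding num den W_def by (simp add: mult_ac)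
  qed
  have W0: "0 \<le> W q x" if "x \<in> open_cube I" for q x
    unfolding W_def using open_cubeD[OF that] I(4)
    by (intro mult_nonneg_nonneg prod_nonneg zero_le_power_int ballI) (auto simp: less_imp_le)
  have inner: "(\<integral>\<^sup>+ t. ennreal (integrand n q (x(j := t))) * indicator (open_cube (insert j I)) (x(j := t)) * ennreal r \<partial>lborel)
      = ennreal (W q x) * (ennreal r * euler_integral a b c (z x)) * indicator (open_cube I) x"
    if x: "x \<in> space (\<Pi>\<^sub>M k\<in>I. lborel)" and q: "\<forall>k\<in>{2..n-1}. q (C k) = 0"
      "q (A j) = int a" "q (B j) = int b" "q (C n) = int c" for q x a b c and r :: real
  proof (cases "x \<in> open_cube I")
    case True
    have cube: "x(j := t) \<in> open_cube (insert j I) \<longleftrightarrow> t \<in> {0<..<1}" for t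
      using x True I(3) by (subst fun_upd_in_open_cube) (auto simp: space_PiM PiE_def)
    have "(\<integral>\<^sup>+ t. ennreal (integrand n q (x(j := t))) * indicator (open_cube (insert j I)) (x(j := t)) * ennreal r \<partial>lborel)
       = (\<integral>\<^sup>+ t. ennreal (W q x) * ennreal r * (ennreal (t ^ a * (1 - t) ^ b / (1 + z x * t) ^ (c + 1)) * indicator {0..1} t) \<partial>lborel)"
    proof (rule nn_integral_cong_AE)
      have "AE t in lborel. t \<noteq> (0::real) \<and> t \<noteq> 1"
        using AE_lborel_singleton[of "0::real"] AE_lborel_singleton[of "1::real"] by eventually_elim auto
      then show "AE t in lborel. ennreal (integrand n q (x(j := t))) * indicator (open_cube (insert j I)) (x(j := t)) * ennreal r
         = ennreal (W q x) * ennreal r * (ennreal (t ^ a * (1 - t) ^ b / (1 + z x * t) ^ (c + 1)) * indicator {0..1} t)"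
        (is "AE t in lborel. ?l t = ?r t")
      proof eventually_elim
        fix t :: real assume t: "t \<noteq> 0 \<and> t \<noteq> 1"
        show "?l t = ?r t"
        proof (cases "t \<in> {0<..<1}")
          case t01: True
          have "- int c - 1 = - int (c + 1)" by simp
          then have "integrand n q (x(j := t)) = W q x * (t ^ a * (1 - t) ^ b / (1 + z x * t) ^ (c + 1))"
            using split[OF True t01 q(1)] unfolding q
            by (simp only: power_int_minus power_int_of_nat divide_inverse)
          moreover have "ennreal (W q x * (t ^ a * (1 - t) ^ b / (1 + z x * t) ^ (c + 1))) =
             ennreal (W q x) * ennreal (t ^ a * (1 - t) ^ b / (1 + z x * t) ^ (c + 1))"
            by (rule ennreal_mult') (rule W0[OF True])
          ultimately show ?thesis using t01 by (simp add: cube mult_ac)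
        next
          case False
          then have "indicator {0..1} t = (0::ennreal)" using t by (auto simp: indicator_def)
          then show ?thesis using False cube by simp
        qed
      qed
    qed
    also have "\<dots> = ennreal (W q x) * ennreal r * euler_integral a b c (z x)"
      unfolding euler_integral_def by (rule nn_integral_cmult) measurable
    finally show ?thesis using True by (simp add: mult_ac)
  next
    case False
    then have "x(j := t) \<notin> open_cube (insert j I)" for t
      using x I(3) by (subst fun_upd_in_open_cube) (auto simp: space_PiM PiE_def)
    then show ?thesis using False by simp
  qed
  have outer: "L n q * ennreal r = (\<integral>\<^sup>+ x. ennreal (W q x) * (ennreal r * euler_integral a b c (z x)) * indicator (open_cube I) x \<partial>(\<Pi>\<^sub>M k\<in>I. lborel))"
    if q: "\<forall>k\<in>{2..n-1}. q (C k) = 0" "q (A j) = int a" "q (B j) = int b" "q (C n) = int c" for q a b c and r :: real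
  proof -
    let ?f = "\<lambda>x. ennreal (integrand n q x) * indicator (cube n) x * ennreal r"
    have "L n q * ennreal r = (\<integral>\<^sup>+ x. ?f x \<partial>lebesgue_prod n)"
      unfolding L_open_cube by (rule nn_integral_multc[symmetric]) measurable
    also have "\<dots> = (\<integral>\<^sup>+ x. \<integral>\<^sup>+ t. ?f (x(j := t)) \<partial>lborel \<partial>(\<Pi>\<^sub>M k\<in>I. lborel))"
    proof -
      have "?f \<in> borel_measurable (lebesgue_prod n)" by measurable
      then show ?thesis using product_nn_integral_insert[OF I(2,3), of ?f] unfolding I(1) by blast
    qed
    also have "\<dots> = (\<integral>\<^sup>+ x. ennreal (W q x) * (ennreal r * euler_integral a b c (z x)) * indicator (open_cube I) x \<partial>(\<Pi>\<^sub>M k\<in>I. lborel))"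
      unfolding I(1) by (rule nn_integral_cong) (rule inner[OF _ q])
    finally show ?thesis .
  qed
  have C0: "\<forall>k\<in>{2..n-1}. p (C k) = 0" using p by (auto simp: E_set_def)
  note pA = \<phi>_simps(1)[OF p] and pB = \<phi>_simps(2)[OF p] and pC = \<phi>_simps(3)[OF p]
  have jn: "1 \<le> j" "j \<le> n" "1 \<le> n" "2 \<le> n" using m by (auto simp: j_def)
  have q: "\<forall>k\<in>{2..n-1}. \<phi> n p (C k) = 0" "\<phi> n p (A j) = int c" "\<phi> n p (B j) = int d" "\<phi> n p (C n) = int a"
    using C0 pA[OF jn(1,2)] pB[OF jn(1,2)] pC[OF jn(4) order.refl] pC abcd j by auto
  have W: "W (\<phi> n p) x = W p x" for x
  proof -
    have "\<phi> n p (B n) - \<phi> n p (C n) - 1 = p (B n) - p (C n) - 1" using pB[OF jn(3) order.refl] pC[OF jn(4) order.refl] j by auto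
    moreover have "(\<Prod>k\<in>I. x k powi \<phi> n p (A k)) = (\<Prod>k\<in>I. x k powi p (A k))"
      by (rule prod.cong) (auto simp: I_def pA j simp del: One_nat_def)
    moreover have "(\<Prod>k\<in>I-{n}. (1 - x k) powi \<phi> n p (B k)) = (\<Prod>k\<in>I-{n}. (1 - x k) powi p (B k))"
      by (rule prod.cong) (auto simp: I_def pB j simp del: One_nat_def)
    ultimately show ?thesis by (simp only: W_def)
  qed
  have "L n (\<phi> n p) * ennreal (fact a * fact b) = L n p * ennreal (fact c * fact d)"
    unfolding outer[OF q] outer[OF C0 abcd(1-3)] W
  proof (rule nn_integral_cong)
    fix x :: "nat \<Rightarrow> real"
    show "ennreal (W p x) * (ennreal (fact a * fact b) * euler_integral c d a (z x)) * indicator (open_cube I) x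
      = ennreal (W p x) * (ennreal (fact c * fact d) * euler_integral a b c (z x)) * indicator (open_cube I) x"
    proof (cases "x \<in> open_cube I")
      case True
      have "0 \<le> delta x m" by (intro delta_bounds) (use open_cubeD[OF True] in \<open>force simp: I_def j_def m\<close>)
      then have "0 \<le> z x" using open_cubeD[OF True I(4)] by (simp add: z_def)
      then show ?thesis by (simp only: euler_integral_swap[OF _ eq])
    qed simp
  qed
  then show ?thesis
    unfolding j abcd by (simp add: ifact_def ennreal_of_nat_eq_real_of_nat)
qed

section \<open>Convergence and translation\<close>

lemma integrand_pos:
  assumes "x \<in> cube n" shows "0 < integrand n p x"
proof -
  have "0 < x k" "x k < 1" if "k \<in> {1..n}" for k using open_cubeD[OF assms that] by auto
  then show ?thesis
    unfolding integrand_def using delta_pos_cube[OF assms]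
    by (intro divide_pos_pos prod_pos mult_pos_pos zero_less_power_int ballI) auto
qed

lemma L_nonzero: "L n p \<noteq> 0"
proof
  interpret product_sigma_finite "\<lambda>_::nat. lborel :: real measure" by (rule product_sigma_finite_lborel)
  have meas: "(\<lambda>x. ennreal (integrand n p x) * indicator (cube n) x) \<in> borel_measurable (lebesgue_prod n)"
    by measurable
  assume "L n p = 0"
  then have "AE x in lebesgue_prod n. ennreal (integrand n p x) * indicator (cube n) x = 0"
    unfolding L_open_cube using nn_integral_0_iff_AE[OF meas] by simp
  then have "AE x in lebesgue_prod n. x \<notin> cube n"
  proof eventually_elim
    fix x assume "ennreal (integrand n p x) * indicator (cube n) x = 0"
    then show "x \<notin> cube n" using integrand_pos[of x n p] by auto
  qed
  then have "cube n \<in> null_sets (lebesgue_prod n)"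
    by (subst AE_iff_null_sets) auto
  moreover have "emeasure (lebesgue_prod n) (cube n) = 1"
    unfolding open_cube_def by (subst emeasure_PiM) auto
  ultimately show False by auto
qed

text \<open>On (0, 1/2] the integrand is at least c / t, where c > 0 is the minimum of f, and c / t
  has a logarithmically divergent integral.\<close>

lemma nn_integral_pole_eq_infinity:
  fixes f :: "real \<Rightarrow> real"
  assumes cont: "continuous_on {0..1/2} f" and pos: "\<And>t. t \<in> {0..1/2} \<Longrightarrow> 0 < f t" and m: "m < 0"
  shows "(\<integral>\<^sup>+ t. ennreal (f t * t powi m) * indicator {0<..1/2} t \<partial>lborel) = \<infinity>"
proof (rule ccontr)
  let ?I = "\<integral>\<^sup>+ t. ennreal (f t * t powi m) * indicator {0<..1/2} t \<partial>lborel"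
  assume "?I \<noteq> \<infinity>"
  then obtain r where r: "?I = ennreal r" "0 \<le> r" by (cases ?I) auto
  obtain t0 where t0: "t0 \<in> {0..1/2}" "\<And>t. t \<in> {0..1/2} \<Longrightarrow> f t0 \<le> f t"
    using continuous_attains_inf[OF compact_Icc _ cont] by auto
  define c where "c = f t0"
  have c: "0 < c" "\<And>t. t \<in> {0..1/2} \<Longrightarrow> c \<le> f t" using t0 pos by (auto simp: c_def)
  \<comment> \<open>K makes c K = r + 1 exceed the supposed value r, and \<epsilon> is chosen so
    that ln(1/2) - ln \<epsilon> = K.\<close>
  define K where "K = (r + 1) / c"
  have K: "0 < K" using c r by (simp add: K_def)
  define \<epsilon> where "\<epsilon> = exp (- K) / 2"
  have \<epsilon>: "0 < \<epsilon>" "\<epsilon> \<le> 1/2" using K by (auto simp: \<epsilon>_def)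
  have "ennreal (c * K) = ennreal ((\<lambda>t. c * ln t) (1/2) - (\<lambda>t. c * ln t) \<epsilon>)"
    by (simp add: \<epsilon>_def ln_div algebra_simps)
  also have "\<dots> = (\<integral>\<^sup>+ t. ennreal (c / t) * indicator {\<epsilon>..1/2} t \<partial>lborel)"
    using \<epsilon> c by (intro nn_integral_FTC_Icc[symmetric]) (auto intro!: derivative_eq_intros)
  also have "\<dots> \<le> ?I"
  proof (rule nn_integral_mono)
    fix t :: real
    show "ennreal (c / t) * indicator {\<epsilon>..1/2} t \<le> ennreal (f t * t powi m) * indicator {0<..1/2} t"
    proof (cases "t \<in> {\<epsilon>..1/2}")
      case True
      then have t: "0 < t" "t \<le> 1/2" using \<epsilon> by auto
      have "t powi (-1) \<le> t powi m" using t m by (intro power_int_decreasing) auto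
      then have 1: "1 / t \<le> t powi m" by (simp add: power_int_minus divide_inverse)
      have "c * (1 / t) \<le> f t * t powi m"
        by (rule mult_mono[OF c(2) 1]) (use t c(1) c(2)[of t] in auto)
      then show ?thesis using True t by (simp add: ennreal_leI)
    qed simp
  qed
  finally have "c * K \<le> r" using r by (simp add: ennreal_le_iff)
  then show False using c by (simp add: K_def)
qed

text \<open>Translation along a vector that is fixed by \<open>\<sigma>\<close>, \<open>\<psi>\<close> and \<open>\<phi>\<close>.\<close>

definition shift :: "nat \<Rightarrow> params \<Rightarrow> nat \<Rightarrow> params" where
  "shift n p m = (\<lambda>i\<in>coords n. p i + int m * (case i of A k \<Rightarrow> 1 | B k \<Rightarrow> 1 | C k \<Rightarrow> if k = n then 1 else 0))"

text \<open>The monomial with exponent vector q: one unit of translation multiplies the integrand by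
  it.\<close>

definition weight :: "nat \<Rightarrow> (nat \<Rightarrow> real) \<Rightarrow> real" where
  "weight n x = (\<Prod>k=1..n. x k * (1 - x k)) / delta x n"

lemma shift_simps:
  "k \<in> {1..n} \<Longrightarrow> shift n p m (A k) = p (A k) + int m"
  "k \<in> {1..n} \<Longrightarrow> shift n p m (B k) = p (B k) + int m"
  "k \<in> {2..n} \<Longrightarrow> shift n p m (C k) = p (C k) + (if k = n then int m else 0)"
  by (auto simp: shift_def coords_def)

lemma shift_0: "p \<in> extensional (coords n) \<Longrightarrow> shift n p 0 = p"
  by (auto simp: shift_def fun_eq_iff extensional_def)

text \<open>The denominator is absorbed by the last factor: x_n (1 - x_n) \<le> 1 - x_n \<le> 1 -
  x_n delta_{n-1} = delta_n. The bound by 1 is what places the moments on (0, 1].\<close>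

lemma weight_bounds:
  assumes n: "1 \<le> n" and x: "x \<in> cube n"
  shows "0 < weight n x" "weight n x \<le> 1"
proof -
  have x01: "0 < x k" "x k < 1" if "k \<in> {1..n}" for k using open_cubeD[OF x that] by auto
  have d: "0 < delta x n" by (rule delta_pos_cube[OF x]) simp
  show "0 < weight n x" unfolding weight_def using d x01
    by (intro divide_pos_pos prod_pos mult_pos_pos ballI) auto
  obtain m where m: "n = Suc m" using n by (cases n) auto
  have P: "0 \<le> (\<Prod>k=1..m. x k * (1 - x k))" "(\<Prod>k=1..m. x k * (1 - x k)) \<le> 1"
  proof -
    have "0 \<le> x k * (1 - x k) \<and> x k * (1 - x k) \<le> 1" if "k \<in> {1..m}" for k
      using x01[of k] that m by (auto intro: mult_le_one)
    then show "0 \<le> (\<Prod>k=1..m. x k * (1 - x k))" "(\<Prod>k=1..m. x k * (1 - x k)) \<le> 1"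
      by (auto intro: prod_nonneg prod_le_1)
  qed
  have "delta x m \<le> 1" using m by (intro delta_le_1_cube[OF x]) auto
  then have "1 - x n \<le> delta x n" using x01[of n] n by (simp add: m)
  moreover have "x n * (1 - x n) \<le> 1 - x n" using x01[of n] n by (simp add: mult_left_le_one_le)
  moreover have "(\<Prod>k=1..n. x k * (1 - x k)) = (\<Prod>k=1..m. x k * (1 - x k)) * (x n * (1 - x n))"
    unfolding m by simp
  moreover have "\<dots> \<le> x n * (1 - x n)" using P x01[of n] n by (intro mult_left_le_one_le) auto
  ultimately have "(\<Prod>k=1..n. x k * (1 - x k)) \<le> delta x n" by linarith
  then show "weight n x \<le> 1" using d by (simp add: weight_def)
qed

lemma integrand_shift:
  assumes n: "2 \<le> n" and x: "x \<in> cube n"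
  shows "integrand n (shift n p m) x = integrand n p x * weight n x ^ m"
proof -
  have d: "0 < delta x n" by (rule delta_pos_cube[OF x]) simp
  have "(\<Prod>k=1..n. x k powi shift n p m (A k) * (1 - x k) powi shift n p m (B k))
      = (\<Prod>k=1..n. x k powi p (A k) * (1 - x k) powi p (B k)) * (\<Prod>k=1..n. x k * (1 - x k)) ^ m"
    unfolding prod_power_distrib prod.distrib[symmetric]
  proof (rule prod.cong)
    fix k assume k: "k \<in> {1..n}"
    then have "x k \<noteq> 0" "1 - x k \<noteq> 0" using open_cubeD[OF x k] by auto
    then show "x k powi shift n p m (A k) * (1 - x k) powi shift n p m (B k)
       = x k powi p (A k) * (1 - x k) powi p (B k) * (x k * (1 - x k)) ^ m"
      using k by (simp add: shift_simps power_int_add power_mult_distrib)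
  qed simp
  moreover have "(\<Prod>k=2..n. delta x k powi shift n p m (C k)) = (\<Prod>k=2..n. delta x k powi p (C k)) * delta x n ^ m"
  proof -
    have *: "{2..n} = insert n {2..n-1}" using n by auto
    have "(\<Prod>k=2..n-1. delta x k powi shift n p m (C k)) = (\<Prod>k=2..n-1. delta x k powi p (C k))"
      by (rule prod.cong) (auto simp: shift_simps)
    then show ?thesis unfolding * using n d by (simp add: shift_simps power_int_add)
  qed
  ultimately show ?thesis unfolding integrand_def weight_def by (simp add: power_divide)
qed

text \<open>With the integrand of p as density on the open cube, L(p + m q) is the integral of
  \<open>weight\<close> to the power m. The measure is finite because its mass is L(p).\<close>

lemma
  assumes n: "2 \<le> n" and fin: "L n p < \<infinity>"
  shows L_shift_finite: "L n (shift n p m) < \<infinity>"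
    and moment_sequence_L_shift: "moment_sequence (\<lambda>m. enn2real (L n (shift n p m)))"
proof -
  let ?R = "restrict_space (lebesgue_prod n) (cube n)"
  let ?M = "density ?R (\<lambda>x. ennreal (integrand n p x))"
  have [measurable]: "(\<lambda>x. delta x n) \<in> borel_measurable (lebesgue_prod n)"
    by (intro measurable_delta) auto
  note [measurable] = measurable_coordinate[where I="{1..n}"]
  have w: "weight n \<in> borel_measurable ?R"
    by (rule measurable_restrict_space1) (unfold weight_def, measurable)
  have i: "integrand n p \<in> borel_measurable ?R"
    by (rule measurable_restrict_space1) measurable
  have space: "space ?M = cube n"
    by (auto simp: space_restrict_space space_PiM open_cube_def PiE_iff)
  have L: "L n (shift n p m) = (\<integral>\<^sup>+ x. ennreal (weight n x ^ m) \<partial>?M)" for m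
  proof -
    have "(\<integral>\<^sup>+ x. ennreal (weight n x ^ m) \<partial>?M) = (\<integral>\<^sup>+ x. ennreal (integrand n p x) * ennreal (weight n x ^ m) \<partial>?R)"
      using w i by (intro nn_integral_density) auto
    also have "\<dots> = (\<integral>\<^sup>+ x. ennreal (integrand n (shift n p m) x) \<partial>?R)"
      using integrand_pos[of _ n p] n
      by (intro nn_integral_cong) (auto simp: space_restrict_space integrand_shift ennreal_mult'[symmetric] less_imp_le simp del: One_nat_def)
    also have "\<dots> = L n (shift n p m)"
      unfolding L_open_cube by (rule nn_integral_restrict_space) auto
    finally show ?thesis ..
  qed
  have L0: "(\<integral>\<^sup>+ x. 1 \<partial>?M) < \<infinity>"
  proof -
    have "(\<integral>\<^sup>+ x. 1 \<partial>?M) = (\<integral>\<^sup>+ x. ennreal (integrand n p x) * 1 \<partial>?R)"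
      using i by (intro nn_integral_density) auto
    also have "\<dots> = L n p"
      unfolding L_open_cube mult_1_right by (rule nn_integral_restrict_space) auto
    finally show ?thesis using fin by simp
  qed
  have "L n (shift n p m) \<le> (\<integral>\<^sup>+ x. 1 \<partial>?M)" for m
    unfolding L
  proof (rule nn_integral_mono)
    fix x assume "x \<in> space ?M"
    then have "0 < weight n x" "weight n x \<le> 1" using weight_bounds[of n x] n unfolding space by auto
    then show "ennreal (weight n x ^ m) \<le> 1" by (simp add: power_le_one)
  qed
  then show f: "L n (shift n p m) < \<infinity>" for m using L0 by (meson le_less_trans)
  show "moment_sequence (\<lambda>m. enn2real (L n (shift n p m)))"
  proof (rule moment_sequenceI[where M="?M" and w="weight n"])
    show "finite_measure ?M"
      using L0 by (intro finite_measureI) (simp add: less_top)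
    show "weight n \<in> borel_measurable ?M" using w by simp
    show "0 < weight n x \<and> weight n x \<le> 1" if "x \<in> space ?M" for x
      using that weight_bounds[of n x] n unfolding space by auto
    show "ennreal (enn2real (L n (shift n p m))) = (\<integral>\<^sup>+ x. ennreal (weight n x ^ m) \<partial>?M)" for m
      using f[of m] unfolding L[symmetric] by simp
  qed simp
qed

text \<open>The quotient is the product of the sequences 1 / (m + j) for j = 1, ..., e.\<close>

lemma moment_sequence_fact_quotient: "moment_sequence (\<lambda>m. fact m / fact (e + m))"
proof (induction e)
  case 0
  show ?case using moment_sequence_const[of 1] by simp
next
  case (Suc e)
  have "(\<lambda>m. fact m / fact (Suc e + m)) = (\<lambda>m. fact m / fact (e + m) * (1 / (real m + real (Suc e))))"
    by (auto simp: fun_eq_iff algebra_simps)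
  then show ?case using moment_sequence_mult[OF Suc moment_sequence_inverse_linear[of "Suc e"]] by simp
qed

text \<open>The entries of \<open>ds\<close> are the forms under the factorials of a denominator;
  the assumption on \<open>shift\<close> says that each of them grows by 1 along q.\<close>

lemma L_quotient_unique:
  assumes n: "2 \<le> n" and ext: "p \<in> extensional (coords n)" "q \<in> extensional (coords n)"
    and fin: "L n p < \<infinity>" "L n q < \<infinity>"
    and ds: "\<And>d m. d \<in> set ds \<Longrightarrow> d (shift n p m) = d p + int m" "\<And>d m. d \<in> set ds \<Longrightarrow> d (shift n q m) = d q + int m"
    and nonneg: "\<And>d. d \<in> set ds \<Longrightarrow> 0 \<le> d p" "\<And>d. d \<in> set ds \<Longrightarrow> 0 \<le> d q"
    and eq: "\<And>m. m \<ge> N \<Longrightarrow> L n (shift n p m) / of_nat (\<Prod>d\<leftarrow>ds. ifact (d (shift n p m)))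
                  = L n (shift n q m) / of_nat (\<Prod>d\<leftarrow>ds. ifact (d (shift n q m)))"
  shows "L n p / of_nat (\<Prod>d\<leftarrow>ds. ifact (d p)) = L n q / of_nat (\<Prod>d\<leftarrow>ds. ifact (d q))"
proof -
  \<comment> \<open>\<open>f p m\<close> is the quotient at p + m q, multiplied by
    \<open>fact m ^ length ds\<close>. This factor depends on m only, and it turns each 1 / (d + m)!
    into a moment sequence.\<close>
  define f where "f p m = enn2real (L n (shift n p m)) * (\<Prod>d\<leftarrow>ds. fact m / fact (nat (d p) + m))" for p m
  have quot: "L n (shift n p m) / of_nat (\<Prod>d\<leftarrow>ds. ifact (d (shift n p m))) = ennreal (f p m / fact m ^ length ds)"
    if finp: "L n p < \<infinity>" and dp: "\<And>d m. d \<in> set ds \<Longrightarrow> d (shift n p m) = d p + int m"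
      and d0: "\<And>d. d \<in> set ds \<Longrightarrow> 0 \<le> d p" for p m
  proof -
    obtain r where r: "L n (shift n p m) = ennreal r" "0 \<le> r"
      using L_shift_finite[OF n finp, of m] by (cases "L n (shift n p m)") auto
    have pos: "0 < (\<Prod>d\<leftarrow>ds'. ifact (d (shift n p m)))" for ds'
      by (induction ds') (auto simp: ifact_def)
    have "L n (shift n p m) / of_nat (\<Prod>d\<leftarrow>ds. ifact (d (shift n p m))) = ennreal (r / real (\<Prod>d\<leftarrow>ds. ifact (d (shift n p m))))"
      using pos[of ds] r by (simp add: ennreal_of_nat_eq_real_of_nat divide_ennreal)
    also have "r / real (\<Prod>d\<leftarrow>ds. ifact (d (shift n p m))) = f p m / fact m ^ length ds"
    proof -
      have "1 / real (\<Prod>d\<leftarrow>ds'. ifact (d (shift n p m))) * fact m ^ length ds' = (\<Prod>d\<leftarrow>ds'. fact m / fact (nat (d p) + m))"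
        if "set ds' \<subseteq> set ds" for ds'
        using that
      proof (induction ds')
        case (Cons d ds')
        have "ifact (d (shift n p m)) = fact (nat (d p) + m)"
          using Cons.prems dp[of d] d0[of d]
          by (simp add: ifact_def nat_add_distrib)
        moreover have "1 / real (a * b) * (u * v) = u / real a * (1 / real b * v)" for a b :: nat and u v :: real
          by simp
        moreover have "1 / real (\<Prod>d\<leftarrow>ds'. ifact (d (shift n p m))) * fact m ^ length ds' = (\<Prod>d\<leftarrow>ds'. fact m / fact (nat (d p) + m))"
          using Cons by simp
        ultimately show ?case by (simp only: list.map prod_list.Cons length_Cons power_Suc of_nat_fact)
      qed simp
      from this[of ds, symmetric] show ?thesis by (simp add: f_def r)
    qed
    finally show ?thesis .
  qed
  have mom: "moment_sequence (f p)" if "L n p < \<infinity>" for p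
  proof -
    have "moment_sequence (\<lambda>m. \<Prod>d\<leftarrow>ds'. fact m / fact (nat (d p) + m))" for ds'
    proof (induction ds')
      case (Cons d ds')
      then show ?case using moment_sequence_mult[OF moment_sequence_fact_quotient[of "nat (d p)"]] by simp
    qed (simp add: moment_sequence_const)
    then show ?thesis unfolding f_def
      by (rule moment_sequence_mult[OF moment_sequence_L_shift[OF n that]])
  qed
  have nn: "0 \<le> f p m" for p m unfolding f_def
    by (intro mult_nonneg_nonneg prod_list_nonneg) auto
  have qp: "L n (shift n p m) / of_nat (\<Prod>d\<leftarrow>ds. ifact (d (shift n p m))) = ennreal (f p m / fact m ^ length ds)"
    and qq: "L n (shift n q m) / of_nat (\<Prod>d\<leftarrow>ds. ifact (d (shift n q m))) = ennreal (f q m / fact m ^ length ds)" for m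
    by (intro quot fin ds nonneg; assumption)+
  have fpq: "f p m = f q m" if "m \<ge> N" for m
    using eq[OF that] nn[of p m] nn[of q m] unfolding qp qq by simp
  from moment_sequence_unique[OF mom[OF fin(1)] mom[OF fin(2)] fpq] have "f p 0 = f q 0" .
  then show ?thesis
    using qp[of 0] qq[of 0]
    by (simp add: shift_0 ext)
qed

text \<open>A negative exponent of x_k or 1 - x_k is a nonintegrable pole in that variable whenever
  the others lie in [1/4, 1/2]. These form a box of positive measure, so the full integral
  diverges.\<close>

lemma L_finite_imp_nonneg:
  assumes n: "2 \<le> n" and fin: "L n p < \<infinity>" and k: "k \<in> {1..n}"
  shows "0 \<le> p (A k)" "0 \<le> p (B k)"
proof -
  interpret product_sigma_finite "\<lambda>_::nat. lborel :: real measure" by (rule product_sigma_finite_lborel)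
  define I where "I = {1..n} - {k}"
  have I: "{1..n} = insert k I" "finite I" "k \<notin> I" using k by (auto simp: I_def)
  have "0 \<le> (if refl then p (B k) else p (A k))" for refl
  proof (rule ccontr)
    \<comment> \<open>Both poles are handled at once: s is the distance to the pole, at x_k = 1 if
      \<open>refl\<close> holds and at x_k = 0 otherwise. m is the exponent of s and m' that of 1 -
      s.\<close>
    define \<tau> :: "real \<Rightarrow> real" where "\<tau> s = (if refl then 1 - s else s)" for s
    define m where "m = (if refl then p (B k) else p (A k))"
    define m' where "m' = (if refl then p (A k) else p (B k))"
    assume "\<not> 0 \<le> (if refl then p (B k) else p (A k))"
    then have m: "m < 0" by (simp add: m_def)
    let ?B = "\<Pi>\<^sub>E j\<in>I. {1/4..1/2::real}"
    let ?f = "\<lambda>x. ennreal (integrand n p x) * indicator (cube n) x"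
    have inner: "(\<integral>\<^sup>+ t. ?f (x(k := t)) \<partial>lborel) = \<infinity>" if x: "x \<in> ?B" for x
    proof -
      define W where "W = (\<Prod>j\<in>I. x j powi p (A j) * (1 - x j) powi p (B j))"
      have xI: "0 < x j" "x j < 1" if "j \<in> I" for j
      proof -
        have "x j \<in> {1/4..1/2}" using x that by (auto simp: PiE_iff)
        then show "0 < x j" "x j < 1" by auto
      qed
      have W: "0 < W" unfolding W_def using xI by (intro prod_pos mult_pos_pos zero_less_power_int ballI) auto
      \<comment> \<open>\<open>g\<close> collects everything except the pole s^m, and has to be
        continuous and positive up to s = 0.\<close>
      define g where "g s = W * (1 - s) powi m' / (\<Prod>j=2..n. delta (x(k := \<tau> s)) j powi p (C j)) / delta (x(k := \<tau> s)) n" for s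
      have \<tau>: "\<tau> s \<in> {0..1}" if "s \<in> {0..1/2}" for s using that by (auto simp: \<tau>_def)
      \<comment> \<open>At s = 0 the coordinate x_k may equal 1. Then delta_k = 1 - delta_{k-1},
        which is positive because delta_{k-1} < 1 for k \<ge> 2. For k = 1 the form delta_1 may
        vanish, but only indices j \<ge> 2 occur in the denominator.\<close>
      have dpos: "0 < delta (x(k := \<tau> s)) j" if s: "s \<in> {0..1/2}" and j: "2 \<le> j" "j \<le> n" for s j
      proof -
        have y: "0 \<le> (x(k := \<tau> s)) i \<and> (x(k := \<tau> s)) i \<le> 1" if "i \<in> {1..j}" for i
          using \<tau>[OF s] xI[of i] that j by (auto simp: I_def less_imp_le)
        show ?thesis
        proof (cases "j = k")
          case False
          have "(x(k := \<tau> s)) j < 1" using False j xI[of j] by (auto simp: I_def)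
          then show ?thesis using y by (intro delta_pos) auto
        next
          case True
          obtain i where i: "j = Suc i" using j by (cases j) auto
          have "delta (x(k := \<tau> s)) i < 1"
            using i j True xI by (intro delta_less_1) (auto simp: I_def)
          moreover have "0 \<le> delta (x(k := \<tau> s)) i"
            using y i by (intro delta_bounds) auto
          moreover have "0 \<le> (x(k := \<tau> s)) j" "(x(k := \<tau> s)) j \<le> 1" using y[of j] j by auto
          ultimately show ?thesis unfolding i
            using mult_less_one[of "delta (x(k := \<tau> s)) i" "(x(k := \<tau> s)) (Suc i)"] by (simp add: mult.commute)
        qed
      qed
      have contd: "continuous_on S (\<lambda>s. delta (x(k := \<tau> s)) j)" for S j
      proof (induction j)
        case (Suc j)
        have "continuous_on S (\<lambda>s. (x(k := \<tau> s)) (Suc j))"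
          by (cases "Suc j = k"; cases refl) (auto simp: \<tau>_def[abs_def] intro!: continuous_intros)
        then show ?case using Suc by (auto intro!: continuous_intros)
      qed simp
      have inf: "(\<integral>\<^sup>+ s. ennreal (g s * s powi m) * indicator {0<..1/2} s \<partial>lborel) = \<infinity>"
      proof (rule nn_integral_pole_eq_infinity[OF _ _ m])
        have nz: "delta (x(k := \<tau> s)) j \<noteq> 0" if "s \<in> {0..1/2}" "2 \<le> j" "j \<le> n" for s j
          using dpos[OF that] by simp
        show "continuous_on {0..1/2} g"
          unfolding g_def using n nz by (intro continuous_intros contd) (auto simp: prod_zero_iff)
        show "0 < g s" if "s \<in> {0..1/2}" for s
          unfolding g_def using n W that dpos[OF that]
          by (intro divide_pos_pos mult_pos_pos prod_pos zero_less_power_int ballI) auto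
      qed
      have meas: "(\<lambda>t. ?f (x(k := t))) \<in> borel_measurable borel"
      proof -
        have "?f \<in> borel_measurable (lebesgue_prod n)" by measurable
        then have "?f \<in> borel_measurable (Pi\<^sub>M (insert k I) (\<lambda>_. lborel))" unfolding I(1) .
        moreover have "(\<lambda>t. x(k := t)) \<in> measurable lborel (Pi\<^sub>M (insert k I) (\<lambda>_. lborel))"
          by (rule measurable_component_update) (use x I(3) in \<open>auto simp: space_PiM PiE_iff\<close>)
        ultimately show ?thesis using measurable_compose[of "\<lambda>t. x(k := t)" lborel _ ?f borel] by simp
      qed
      have "(\<integral>\<^sup>+ t. ?f (x(k := t)) \<partial>lborel) = (\<integral>\<^sup>+ s. ?f (x(k := \<tau> s)) \<partial>lborel)"
      proof (cases refl)
        case True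
        then show ?thesis using nn_integral_real_affine[OF meas, of "-1" 1] by (simp add: \<tau>_def del: One_nat_def)
      qed (simp add: \<tau>_def)
      also have "\<dots> \<ge> (\<integral>\<^sup>+ s. ennreal (g s * s powi m) * indicator {0<..1/2} s \<partial>lborel)"
      proof (rule nn_integral_mono)
        fix s :: real
        show "ennreal (g s * s powi m) * indicator {0<..1/2} s \<le> ?f (x(k := \<tau> s))"
        proof (cases "s \<in> {0<..1/2}")
          case True
          then have "\<tau> s \<in> {0<..<1}" by (auto simp: \<tau>_def)
          then have cube: "x(k := \<tau> s) \<in> cube n"
            unfolding I(1) using I(3) x xI
            by (subst fun_upd_in_open_cube) (auto simp: PiE_iff open_cube_def)
          have "(\<Prod>j\<in>I. (x(k := \<tau> s)) j powi p (A j) * (1 - (x(k := \<tau> s)) j) powi p (B j)) = W"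
            unfolding W_def by (rule prod.cong) (use I(3) in auto)
          then have "(\<Prod>j=1..n. (x(k := \<tau> s)) j powi p (A j) * (1 - (x(k := \<tau> s)) j) powi p (B j))
              = \<tau> s powi p (A k) * (1 - \<tau> s) powi p (B k) * W"
            unfolding I(1) using I(2,3) by simp
          also have "\<tau> s powi p (A k) * (1 - \<tau> s) powi p (B k) = s powi m * (1 - s) powi m'"
            by (simp add: \<tau>_def m_def m'_def)
          finally have "integrand n p (x(k := \<tau> s)) = g s * s powi m"
            unfolding integrand_def g_def by (simp add: mult_ac)
          then show ?thesis using cube True by simp
        qed simp
      qed
      finally show ?thesis unfolding inf by (simp add: top_unique)
    qed
    \<comment> \<open>The inner integral is infinite on the whole box, and the box has positive
      measure.\<close>
    have B: "?B \<in> sets (\<Pi>\<^sub>M j\<in>I. lborel)" using I(2) by (intro sets_PiM_I_finite) auto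
    have "emeasure (\<Pi>\<^sub>M j\<in>I. lborel) ?B = (\<Prod>j\<in>I. ennreal (1/4))"
      using I(2) by (subst emeasure_PiM) auto
    then have B0: "emeasure (\<Pi>\<^sub>M j\<in>I. lborel) ?B \<noteq> 0" by simp
    have "\<infinity> = \<infinity> * emeasure (\<Pi>\<^sub>M j\<in>I. lborel) ?B" using B0 by (simp add: ennreal_top_mult)
    also have "\<dots> = (\<integral>\<^sup>+ x. \<infinity> * indicator ?B x \<partial>(\<Pi>\<^sub>M j\<in>I. lborel))"
      using B by (subst nn_integral_cmult_indicator) auto
    also have "\<dots> \<le> (\<integral>\<^sup>+ x. \<integral>\<^sup>+ t. ?f (x(k := t)) \<partial>lborel \<partial>(\<Pi>\<^sub>M j\<in>I. lborel))"
    proof (rule nn_integral_mono)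
      fix x
      show "\<infinity> * indicator ?B x \<le> (\<integral>\<^sup>+ t. ?f (x(k := t)) \<partial>lborel)"
      proof (cases "x \<in> ?B")
        case True
        then show ?thesis by (simp only: inner indicator_simps mult_1_right order.refl)
      next
        case False
        then show ?thesis by (simp only: indicator_simps mult_zero_right zero_le simp_thms)
      qed
    qed
    also have "\<dots> = L n p"
    proof -
      have "?f \<in> borel_measurable (lebesgue_prod n)" by measurable
      then show ?thesis unfolding L_open_cube using product_nn_integral_insert[OF I(2,3), of ?f] unfolding I(1) by simp
    qed
    finally show False using fin by simp
  qed
  from this[of False] this[of True] show "0 \<le> p (A k)" "0 \<le> p (B k)" by auto
qed

section \<open>The automorphism group\<close>

lemma \<sigma>_closed:
  assumes n: "2 \<le> n" and p: "p \<in> E_set n" shows "\<sigma> n p \<in> E_set n"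
proof -
  note s = \<sigma>_simps[OF p]
  have rel: "\<sigma> n p (A k) + \<sigma> n p (B (k+1)) = \<sigma> n p (A (k+2)) + \<sigma> n p (B (k+2))" if "4 \<le> n" "k \<in> {1..n-2}" for k
  proof -
    have r: "p (A j) + p (B (j+1)) = p (A (j+2)) + p (B (j+2))" if "j \<in> {1..n-2}" for j
      using p \<open>4 \<le> n\<close> that by (auto simp: E_set_iff)
    have a: "p (A 2) = p (B 1)" using p \<open>4 \<le> n\<close> by (auto simp: E_set_iff)
    have b: "k \<le> n" "k + 1 \<le> n" "k + 2 \<le> n" using that by auto
    \<comment> \<open>Coordinates moved by \<open>\<sigma>\<close> occur only in the relations with
      k = 1, where its left side is a symmetric sum, and k = 2, where a_2 = b_1 is used.\<close>
    have "k = 1 \<or> k = 2 \<or> 2 < k" using that by auto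
    then show ?thesis
    proof (elim disjE)
      assume k: "k = 1"
      show ?thesis using r[OF that(2)] b s(1)[of 1] s(1)[of 3] s(2)[of 2] s(2)[of 3] unfolding k by (simp add: numeral_eq_Suc)
    next
      assume k: "k = 2"
      show ?thesis using r[OF that(2)] a b s(1)[of 2] s(1)[of 4] s(2)[of 3] s(2)[of 4] unfolding k by (simp add: numeral_eq_Suc)
    next
      assume "2 < k"
      then show ?thesis using r[OF that(2)] b by (simp add: s)
    qed
  qed
  have "\<forall>k\<in>{2..n-1}. \<sigma> n p (C k) = 0" using p by (auto simp: s E_set_iff)
  moreover have "\<sigma> n p (A 1) + \<sigma> n p (B 2) = \<sigma> n p (A 3) + \<sigma> n p (B 3)" if "n = 3"
    using that p s(1)[of 1] s(1)[of 3] s(2)[of 2] s(2)[of 3] by (simp add: E_set_iff)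
  moreover have "\<sigma> n p (A 2) = \<sigma> n p (B 1) \<and> \<sigma> n p (B n) = \<sigma> n p (C n)" if "4 \<le> n"
    using that p by (auto simp: s E_set_iff)
  ultimately show ?thesis using rel s(4) by (simp add: E_set_iff)
qed

lemma \<psi>_closed:
  assumes n: "2 \<le> n" and p: "p \<in> E_set n" shows "\<psi> n p \<in> E_set n"
proof -
  note s = \<psi>_simps[OF p]
  have rel: "\<psi> n p (A k) + \<psi> n p (B (k+1)) = \<psi> n p (A (k+2)) + \<psi> n p (B (k+2))" if "4 \<le> n" "k \<in> {1..n-2}" for k
  proof -
    \<comment> \<open>The relation with index k for the image is the relation with index n - 1 - k
      for p, with its two sides exchanged.\<close>
    define j where "j = n - 1 - k"
    have j: "j \<in> {1..n-2}" "n + 1 - k = j + 2" "n + 2 - (k + 1) = j + 2" "n + 1 - (k + 2) = j" "n + 2 - (k + 2) = j + 1"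
      using that by (auto simp: j_def)
    have "p (A j) + p (B (j+1)) = p (A (j+2)) + p (B (j+2))"
      using p that j by (auto simp: E_set_iff)
    moreover have "k + 2 \<le> n" "1 \<le> k" using that by auto
    ultimately show ?thesis using s(1)[of k] s(1)[of "k+2"] s(2)[of "k+1"] s(2)[of "k+2"] j(2-5) by simp
  qed
  have "\<psi> n p (C k) = 0" if "k \<in> {2..n-1}" for k
  proof -
    have "2 \<le> k" "k \<le> n" "k \<noteq> n" using that by auto
    then show ?thesis by (simp add: s)
  qed
  moreover have "\<psi> n p (A 1) + \<psi> n p (B 2) = \<psi> n p (A 3) + \<psi> n p (B 3)" if "n = 3"
    using that p s(1)[of 1] s(1)[of 3] s(2)[of 2] s(2)[of 3] by (simp add: E_set_iff)
  moreover have "\<psi> n p (A 2) = \<psi> n p (B 1) \<and> \<psi> n p (B n) = \<psi> n p (C n)" if "4 \<le> n"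
    using that p by (simp add: s E_set_iff)
  ultimately show ?thesis using rel s(4) by (simp add: E_set_iff)
qed

lemma \<phi>_closed:
  assumes n: "2 \<le> n" and p: "p \<in> E_set n" shows "\<phi> n p \<in> E_set n"
proof -
  note s = \<phi>_simps[OF p]
  have rel: "\<phi> n p (A k) + \<phi> n p (B (k+1)) = \<phi> n p (A (k+2)) + \<phi> n p (B (k+2))" if "4 \<le> n" "k \<in> {1..n-2}" for k
  proof -
    have r: "p (A k) + p (B (k+1)) = p (A (k+2)) + p (B (k+2))"
      using p that by (auto simp: E_set_iff)
    have b: "k \<le> n" "k + 1 \<le> n" "k + 2 \<le> n" "1 \<le> k" using that by auto
    \<comment> \<open>For k = n - 2 both sides change by a_{n-1} - c_n. For k = n - 3 the sum
      a_{n-1} + b_{n-1} is preserved. The other relations involve unmoved coordinates only.\<close>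
    have "k = n - 2 \<or> k = n - 3 \<or> k < n - 3" using that by auto
    then show ?thesis
    proof (elim disjE)
      assume "k = n - 2"
      then have "n = k + 2" using that by auto
      then show ?thesis using r b s(1)[of k] s(1)[of "k+2"] s(2)[of "k+1"] s(2)[of "k+2"] by simp
    next
      assume "k = n - 3"
      then have "n = k + 3" using that by auto
      then show ?thesis using r b s(1)[of k] s(1)[of "k+2"] s(2)[of "k+1"] s(2)[of "k+2"] by simp
    next
      assume "k < n - 3"
      then have "k \<noteq> n - 1" "k + 2 \<noteq> n - 1" "k + 1 \<noteq> n - 1" "k + 1 \<noteq> n" "k + 2 \<noteq> n" by auto
      then show ?thesis using r b s(1)[of k] s(1)[of "k+2"] s(2)[of "k+1"] s(2)[of "k+2"] by simp
    qed
  qed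
  have "\<forall>k\<in>{2..n-1}. \<phi> n p (C k) = 0" using n p by (auto simp: s E_set_iff)
  moreover have "\<phi> n p (A 1) + \<phi> n p (B 2) = \<phi> n p (A 3) + \<phi> n p (B 3)" if "n = 3"
    using that p s(1)[of 1] s(1)[of 3] s(2)[of 2] s(2)[of 3] by (simp add: E_set_iff)
  moreover have "\<phi> n p (A 2) = \<phi> n p (B 1) \<and> \<phi> n p (B n) = \<phi> n p (C n)" if "4 \<le> n"
    using that p by (auto simp: s E_set_iff)
  ultimately show ?thesis using rel s(4) by (simp add: E_set_iff)
qed

lemma E_set_extensional: "p \<in> E_set n \<Longrightarrow> p \<in> extensional (coords n)"
  by (simp add: E_set_iff)

lemma \<sigma>_involution:
  assumes n: "2 \<le> n" and p: "p \<in> E_set n" shows "\<sigma> n (\<sigma> n p) = p"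
  by (rule params_eqI[OF \<sigma>_simps(4)[OF \<sigma>_closed[OF n p]] E_set_extensional[OF p]])
    (use n in \<open>auto simp: \<sigma>_simps[OF \<sigma>_closed[OF n p]] \<sigma>_simps[OF p]\<close>)

lemma \<psi>_involution:
  assumes n: "2 \<le> n" and p: "p \<in> E_set n" shows "\<psi> n (\<psi> n p) = p"
proof (rule params_eqI[OF \<psi>_simps(4)[OF \<psi>_closed[OF n p]] E_set_extensional[OF p]])
  note s = \<psi>_simps[OF \<psi>_closed[OF n p]] \<psi>_simps[OF p]
  show "\<psi> n (\<psi> n p) (A k) = p (A k)" if "1 \<le> k" "k \<le> n" for k
    using that by (simp add: s)
  have 2: "n + 1 - (n - 1) = 2" "n + 2 - n = 2" using n by auto
  have "\<psi> n (\<psi> n p) (B 1) = p (B 1)"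
    using n 2 by (simp add: s)
  moreover have "\<psi> n (\<psi> n p) (B k) = p (B k)" if "2 \<le> k" "k \<le> n" for k
  proof -
    have "n + 2 - (n + 2 - k) = k" "n + 2 - k \<noteq> 1" "1 \<le> n + 2 - k" "n + 2 - k \<le> n" using that by auto
    then show ?thesis using that by (simp add: s)
  qed
  ultimately show "\<psi> n (\<psi> n p) (B k) = p (B k)" if "1 \<le> k" "k \<le> n" for k
    using that by (cases "k = 1") auto
  show "\<psi> n (\<psi> n p) (C k) = p (C k)" if "2 \<le> k" "k \<le> n" for k
  proof (cases "k = n")
    case True
    then show ?thesis using n that by (simp add: s)
  next
    case False
    then show ?thesis using n p that by (simp add: s E_set_iff)
  qed
qed

lemma \<phi>_involution:
  assumes n: "2 \<le> n" and p: "p \<in> E_set n" shows "\<phi> n (\<phi> n p) = p"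
  by (rule params_eqI[OF \<phi>_simps(4)[OF \<phi>_closed[OF n p]] E_set_extensional[OF p]])
    (use n in \<open>auto simp: \<phi>_simps[OF \<phi>_closed[OF n p]] \<phi>_simps[OF p]\<close>)

lemma shift_extensional: "shift n p m \<in> extensional (coords n)"
  by (simp add: shift_def)

lemma shift_in_E_set:
  assumes n: "2 \<le> n" and p: "p \<in> E_set n" shows "shift n p m \<in> E_set n"
  using n p unfolding E_set_iff by (auto simp: shift_simps shift_extensional)

lemma
  assumes n: "2 \<le> n" and p: "p \<in> E_set n"
  shows \<sigma>_shift: "\<sigma> n (shift n p m) = shift n (\<sigma> n p) m"
    and \<psi>_shift: "\<psi> n (shift n p m) = shift n (\<psi> n p) m"
    and \<phi>_shift: "\<phi> n (shift n p m) = shift n (\<phi> n p) m"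
proof -
  note q = shift_in_E_set[OF n p]
  show "\<sigma> n (shift n p m) = shift n (\<sigma> n p) m"
    by (rule params_eqI[OF \<sigma>_simps(4)[OF q] shift_extensional])
      (use n in \<open>auto simp: \<sigma>_simps[OF q] \<sigma>_simps[OF p] shift_simps\<close>)
  show "\<psi> n (shift n p m) = shift n (\<psi> n p) m"
  proof (rule params_eqI[OF \<psi>_simps(4)[OF q] shift_extensional])
    fix k
    show "\<psi> n (shift n p m) (A k) = shift n (\<psi> n p) m (A k)" if "1 \<le> k" "k \<le> n"
    proof -
      have "n + 1 - k \<in> {1..n}" "k \<in> {1..n}" using that by auto
      then show ?thesis using that by (simp only: \<psi>_simps[OF q] \<psi>_simps[OF p] shift_simps)
    qed
    show "\<psi> n (shift n p m) (B k) = shift n (\<psi> n p) m (B k)" if "1 \<le> k" "k \<le> n"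
    proof (cases "k = 1")
      case False
      then have "n + 2 - k \<in> {1..n}" "k \<in> {1..n}" using that by auto
      then show ?thesis using that False by (simp only: \<psi>_simps[OF q] \<psi>_simps[OF p] shift_simps if_False)
    qed (use n in \<open>simp add: \<psi>_simps[OF q] \<psi>_simps[OF p] shift_simps\<close>)
    show "\<psi> n (shift n p m) (C k) = shift n (\<psi> n p) m (C k)" if "2 \<le> k" "k \<le> n"
      using that by (simp add: \<psi>_simps[OF q] \<psi>_simps[OF p] shift_simps)
  qed
  show "\<phi> n (shift n p m) = shift n (\<phi> n p) m"
    by (rule params_eqI[OF \<phi>_simps(4)[OF q] shift_extensional])
      (use n in \<open>auto simp: \<phi>_simps[OF q] \<phi>_simps[OF p] shift_simps\<close>)
qed

lemma E_module_simps:
  "carrier (E_module n) = E_set n" "p \<otimes>\<^bsub>E_module n\<^esub> q = (\<lambda>i\<in>coords n. p i + q i)"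
  by (simp_all add: E_module_def integer_group_def)

lemma group_E_module: "group (E_module n)"
proof -
  let ?P = "product_group (coords n) (\<lambda>_. integer_group)"
  interpret P: group ?P by (rule product_group) (rule group_integer_group)
  have "subgroup (E_set n) ?P"
  proof (rule P.subgroupI)
    show "E_set n \<subseteq> carrier ?P" by (auto simp: E_set_def)
    have "(\<lambda>i\<in>coords n. 0) \<in> E_set n" by (auto simp: E_set_iff)
    then show "E_set n \<noteq> {}" by blast
    show "inv\<^bsub>?P\<^esub> p \<in> E_set n" if "p \<in> E_set n" for p
    proof -
      have "p \<in> carrier ?P" using that by (auto simp: E_set_def)
      then have "inv\<^bsub>?P\<^esub> p = (\<lambda>i\<in>coords n. - p i)"
        by (subst inv_product_group) (auto simp: group_integer_group)
      then show ?thesis using that by (auto simp: E_set_iff)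
    qed
    show "p \<otimes>\<^bsub>?P\<^esub> q \<in> E_set n" if "p \<in> E_set n" "q \<in> E_set n" for p q
    proof -
      define r where "r = (\<lambda>i\<in>coords n. p i + q i)"
      have "r (A k) + r (B (k+1)) = r (A (k+2)) + r (B (k+2))" if "4 \<le> n" "k \<in> {1..n-2}" for k
      proof -
        have "p (A k) + p (B (k+1)) = p (A (k+2)) + p (B (k+2))" "q (A k) + q (B (k+1)) = q (A (k+2)) + q (B (k+2))"
          using \<open>p \<in> E_set n\<close> \<open>q \<in> E_set n\<close> that by (auto simp: E_set_iff)
        moreover have "1 \<le> k" "k + 2 \<le> n" using that by auto
        ultimately show ?thesis by (simp add: r_def)
      qed
      moreover have "r (A 1) + r (B 2) = r (A 3) + r (B 3)" if "n = 3"
        using \<open>p \<in> E_set n\<close> \<open>q \<in> E_set n\<close> that by (simp add: E_set_iff r_def)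
      moreover have "r (A 2) = r (B 1)" "r (B n) = r (C n)" if "4 \<le> n"
        using \<open>p \<in> E_set n\<close> \<open>q \<in> E_set n\<close> that by (simp_all add: E_set_iff r_def)
      moreover have "r (C k) = 0" if "k \<in> {2..n-1}" for k
      proof -
        have "k \<le> n" "2 \<le> k" using that by auto
        then show ?thesis using \<open>p \<in> E_set n\<close> \<open>q \<in> E_set n\<close> that by (simp add: E_set_iff r_def)
      qed
      moreover have "r \<in> extensional (coords n)" by (simp add: r_def)
      ultimately have "r \<in> E_set n" by (simp add: E_set_iff)
      then show ?thesis by (simp add: r_def integer_group_def)
    qed
  qed
  then show ?thesis unfolding E_module_def by (rule P.subgroup_imp_group)
qed

abbreviation Aut :: "nat \<Rightarrow> (params \<Rightarrow> params) set" where
  "Aut n \<equiv> carrier (AutoGroup (E_module n))"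

lemma in_AutoGroup:
  assumes "s \<in> extensional (E_set n)" "\<And>p. p \<in> E_set n \<Longrightarrow> s p \<in> E_set n"
    "\<And>p. p \<in> E_set n \<Longrightarrow> s (s p) = p"
    "\<And>p q. p \<in> E_set n \<Longrightarrow> q \<in> E_set n \<Longrightarrow> s (\<lambda>i\<in>coords n. p i + q i) = (\<lambda>i\<in>coords n. s p i + s q i)"
  shows "s \<in> Aut n"
proof -
  have "bij_betw s (E_set n) (E_set n)"
    by (rule bij_betw_byWitness[where f'=s]) (use assms in auto)
  then show ?thesis using assms
    by (auto simp: AutoGroup_def auto_def Bij_def hom_def E_module_simps)
qed

lemma generators_in_AutoGroup:
  assumes n: "2 \<le> n"
  shows "{\<sigma> n, \<psi> n, \<phi> n} \<subseteq> Aut n"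
proof -
  have add: "(\<lambda>i\<in>coords n. p i + q i) \<in> E_set n" if "p \<in> E_set n" "q \<in> E_set n" for p q
    using group.is_monoid[OF group_E_module, THEN monoid.m_closed, of p n q] that by (simp add: E_module_simps)
  have "\<sigma> n \<in> Aut n"
  proof (rule in_AutoGroup)
    fix p q assume p: "p \<in> E_set n" and q: "q \<in> E_set n"
    show "\<sigma> n (\<lambda>i\<in>coords n. p i + q i) = (\<lambda>i\<in>coords n. \<sigma> n p i + \<sigma> n q i)"
      by (rule params_eqI[OF \<sigma>_simps(4)[OF add[OF p q]]])
        (use n in \<open>auto simp: \<sigma>_simps[OF add[OF p q]] \<sigma>_simps[OF p] \<sigma>_simps[OF q]\<close>)
  qed (use \<sigma>_closed[OF n] \<sigma>_involution[OF n] in \<open>auto simp: \<sigma>_def\<close>)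
  moreover have "\<psi> n \<in> Aut n"
  proof (rule in_AutoGroup)
    fix p q assume p: "p \<in> E_set n" and q: "q \<in> E_set n"
    show "\<psi> n (\<lambda>i\<in>coords n. p i + q i) = (\<lambda>i\<in>coords n. \<psi> n p i + \<psi> n q i)"
      by (rule params_eqI[OF \<psi>_simps(4)[OF add[OF p q]]])
        (use n in \<open>auto simp: \<psi>_simps[OF add[OF p q]] \<psi>_simps[OF p] \<psi>_simps[OF q]\<close>)
  qed (use \<psi>_closed[OF n] \<psi>_involution[OF n] in \<open>auto simp: \<psi>_def\<close>)
  moreover have "\<phi> n \<in> Aut n"
  proof (rule in_AutoGroup)
    fix p q assume p: "p \<in> E_set n" and q: "q \<in> E_set n"
    show "\<phi> n (\<lambda>i\<in>coords n. p i + q i) = (\<lambda>i\<in>coords n. \<phi> n p i + \<phi> n q i)"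
      by (rule params_eqI[OF \<phi>_simps(4)[OF add[OF p q]]])
        (use n in \<open>auto simp: \<phi>_simps[OF add[OF p q]] \<phi>_simps[OF p] \<phi>_simps[OF q]\<close>)
  qed (use \<phi>_closed[OF n] \<phi>_involution[OF n] in \<open>auto simp: \<phi>_def\<close>)
  ultimately show ?thesis by simp
qed

lemma Aut_E_simps:
  assumes "g \<in> Aut n"
  shows "g \<in> extensional (E_set n)" "g \<in> Bij (E_set n)" "p \<in> E_set n \<Longrightarrow> g p \<in> E_set n"
  using assms Bij_imp_funcset[of g "E_set n"]
  by (auto simp: AutoGroup_def auto_def E_module_simps Bij_def)

lemma Aut_E_mult:
  assumes "g \<in> Aut n" "h \<in> Aut n"
  shows "g \<otimes>\<^bsub>AutoGroup (E_module n)\<^esub> h = compose (E_set n) g h"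
  using Aut_E_simps(2)[OF assms(1)] Aut_E_simps(2)[OF assms(2)]
  by (simp add: AutoGroup_def BijGroup_def E_module_simps)

lemma Aut_E_one: "\<one>\<^bsub>AutoGroup (E_module n)\<^esub> = (\<lambda>p\<in>E_set n. p)"
  by (simp add: AutoGroup_def BijGroup_def E_module_simps)

lemma subgroup_G: "subgroup (carrier (G n)) (AutoGroup (E_module n))"
  unfolding G_def by (rule group.subgroup_subgroup_generated[OF group.AutoGroup[OF group_E_module]])

lemma G_subset: "g \<in> carrier (G n) \<Longrightarrow> g \<in> Aut n"
  using subgroup.subset[OF subgroup_G] by blast

lemma G_mult:
  assumes "g \<in> carrier (G n)" "h \<in> carrier (G n)"
  shows "g \<otimes>\<^bsub>G n\<^esub> h = compose (E_set n) g h"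
proof -
  have "g \<otimes>\<^bsub>G n\<^esub> h = g \<otimes>\<^bsub>AutoGroup (E_module n)\<^esub> h" by (simp add: G_def subgroup_generated_def)
  then show ?thesis using Aut_E_mult G_subset assms by metis
qed

lemma G_closed:
  assumes "g \<in> carrier (G n)" "h \<in> carrier (G n)"
  shows "compose (E_set n) g h \<in> carrier (G n)"
  using subgroup.m_closed[OF subgroup_G assms] Aut_E_mult G_subset assms by metis

lemma G_one: "(\<lambda>p\<in>E_set n. p) \<in> carrier (G n)"
  using subgroup.one_closed[OF subgroup_G] by (simp add: Aut_E_one)

lemma carrier_G:
  assumes "2 \<le> n"
  shows "carrier (G n) = generate (AutoGroup (E_module n)) {\<sigma> n, \<psi> n, \<phi> n}"
  using generators_in_AutoGroup[OF assms] unfolding G_def carrier_subgroup_generated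
  by (simp add: Int_absorb1)

lemma generators_in_G:
  assumes "2 \<le> n" shows "\<sigma> n \<in> carrier (G n)" "\<psi> n \<in> carrier (G n)" "\<phi> n \<in> carrier (G n)"
  unfolding carrier_G[OF assms] by (auto intro: generate.incl)

text \<open>The generators are involutions, so the inverse of a generator falls under the case of
  that generator.\<close>

lemma G_induct [consumes 2, case_names one \<sigma> \<psi> \<phi> compose]:
  assumes n: "2 \<le> n" and g: "g \<in> carrier (G n)"
    and one: "P (\<lambda>p\<in>E_set n. p)" and gens: "P (\<sigma> n)" "P (\<psi> n)" "P (\<phi> n)"
    and compose: "\<And>g h. g \<in> carrier (G n) \<Longrightarrow> h \<in> carrier (G n) \<Longrightarrow> P g \<Longrightarrow> P h \<Longrightarrow> P (compose (E_set n) g h)"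
  shows "P g"
proof -
  let ?A = "AutoGroup (E_module n)"
  interpret A: group ?A by (rule group.AutoGroup[OF group_E_module])
  have inv: "inv\<^bsub>?A\<^esub> s = s" if s: "s \<in> {\<sigma> n, \<psi> n, \<phi> n}" for s
  proof (rule A.inv_equality)
    show sA: "s \<in> carrier ?A" "s \<in> carrier ?A" using s generators_in_AutoGroup[OF n] by auto
    have "s (s p) = p" if "p \<in> E_set n" for p
      using s \<sigma>_involution[OF n that] \<psi>_involution[OF n that] \<phi>_involution[OF n that] by auto
    then show "s \<otimes>\<^bsub>?A\<^esub> s = \<one>\<^bsub>?A\<^esub>"
      by (auto simp: Aut_E_mult[OF sA] Aut_E_one compose_def fun_eq_iff)
  qed
  have "g \<in> generate ?A {\<sigma> n, \<psi> n, \<phi> n}" using g carrier_G[OF n] by simp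
  then show ?thesis
  proof (induction rule: generate.induct)
    case one
    show ?case using assms(3) by (simp only: Aut_E_one)
  next
    case (incl h)
    then show ?case using gens by auto
  next
    case (inv h)
    then show ?case using gens \<open>\<And>s. s \<in> {\<sigma> n, \<psi> n, \<phi> n} \<Longrightarrow> inv\<^bsub>?A\<^esub> s = s\<close> by auto
  next
    case (eng h1 h2)
    then have "h1 \<in> carrier (G n)" "h2 \<in> carrier (G n)" using carrier_G[OF n] by auto
    then show ?case using compose eng.IH Aut_E_mult[OF G_subset G_subset] by auto
  qed
qed

section \<open>Invariance of the quotients L / D\<close>

lemma ennreal_quotient_cong:
  assumes "x * of_nat k = y * of_nat l" "d' * k = d * l" "0 < k" "0 < l" "0 < d" "0 < d'"
  shows "x / of_nat d' = y / (of_nat d :: ennreal)"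
proof -
  have cancel: "(x * of_nat k) / of_nat (d * k) = x / (of_nat d :: ennreal)" if "0 < k" "0 < d" for x :: ennreal and d k :: nat
  proof (cases x)
    case (real r)
    then show ?thesis using that
      by (simp add: ennreal_of_nat_eq_real_of_nat ennreal_mult'[symmetric] divide_ennreal)
  next
    \<comment> \<open>Infinite values do occur: \<open>L_\<phi>\<close> assumes nonnegative
      exponents, not convergence.\<close>
    case top
    then show ?thesis using that by (simp add: ennreal_top_mult ennreal_top_divide ennreal_of_nat_eq_real_of_nat)
  qed
  show ?thesis using cancel[of k d' x] cancel[of l d y] assms by simp
qed

lemma L_\<phi>_quotient:
  assumes n: "2 \<le> n" and p: "p \<in> E_set n"
    and nonneg: "0 \<le> p (A (n-1))" "0 \<le> p (B (n-1))" "0 \<le> p (C n)" "0 \<le> p (A (n-1)) + p (B (n-1)) - p (C n)"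
    and D: "D (\<phi> n p) * (ifact (p (A (n-1))) * ifact (p (B (n-1))))
        = D p * (ifact (p (C n)) * ifact (p (A (n-1)) + p (B (n-1)) - p (C n)))"
    and "0 < D p" "0 < D (\<phi> n p)"
  shows "L n (\<phi> n p) / of_nat (D (\<phi> n p)) = L n p / of_nat (D p)"
  by (rule ennreal_quotient_cong[OF L_\<phi>[OF n p nonneg] D]) (use assms in \<open>auto simp: ifact_def\<close>)

text \<open>Each use of \<open>\<phi>\<close> in a word imposes four inequalities at the point
  reached so far. The four forms take the value 1 at q, so the inequalities hold after a large
  translation. The first conjunct carries the translation through the word, so that the thresholds
  of two factors combine to their maximum.\<close>

lemma G_eventually_invariant:
  fixes F :: "params \<Rightarrow> ennreal"
  assumes n: "2 \<le> n" and g: "g \<in> carrier (G n)" and p: "p \<in> E_set n"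
    and F: "\<And>p. p \<in> E_set n \<Longrightarrow> F (\<sigma> n p) = F p" "\<And>p. p \<in> E_set n \<Longrightarrow> F (\<psi> n p) = F p"
      "\<And>p. p \<in> E_set n \<Longrightarrow> 0 \<le> p (A (n-1)) \<Longrightarrow> 0 \<le> p (B (n-1)) \<Longrightarrow> 0 \<le> p (C n) \<Longrightarrow>
          0 \<le> p (A (n-1)) + p (B (n-1)) - p (C n) \<Longrightarrow> F (\<phi> n p) = F p"
  shows "(\<forall>m. g (shift n p m) = shift n (g p) m) \<and> (\<exists>N. \<forall>m\<ge>N. F (g (shift n p m)) = F (shift n p m))"
  using n g p
proof (induction arbitrary: p rule: G_induct)
  case one
  then show ?case using shift_in_E_set[OF n] by auto
next
  case \<sigma>
  then show ?case using \<sigma>_shift[OF n] F(1)[OF shift_in_E_set[OF n]] by auto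
next
  case \<psi>
  then show ?case using \<psi>_shift[OF n] F(2)[OF shift_in_E_set[OF n]] by auto
next
  case \<phi>
  \<comment> \<open>A common bound for the absolute values of all four forms at p.\<close>
  define N where "N = nat (\<bar>p (A (n-1))\<bar> + \<bar>p (B (n-1))\<bar> + \<bar>p (C n)\<bar>)"
  have "F (\<phi> n (shift n p m)) = F (shift n p m)" if "m \<ge> N" for m
  proof (rule F(3)[OF shift_in_E_set[OF n \<phi>]])
    have m: "\<bar>p (A (n-1))\<bar> + \<bar>p (B (n-1))\<bar> + \<bar>p (C n)\<bar> \<le> int m" using that unfolding N_def by linarith
    have s: "shift n p m (A (n-1)) = p (A (n-1)) + int m" "shift n p m (B (n-1)) = p (B (n-1)) + int m"
      "shift n p m (C n) = p (C n) + int m"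
      using n by (auto simp: shift_simps)
    show "0 \<le> shift n p m (A (n-1))" "0 \<le> shift n p m (B (n-1))" "0 \<le> shift n p m (C n)"
      "0 \<le> shift n p m (A (n-1)) + shift n p m (B (n-1)) - shift n p m (C n)"
      unfolding s using m by linarith+
  qed
  then show ?case using \<phi>_shift[OF n \<phi>] by blast
next
  case (compose g h)
  have hp: "h p \<in> E_set n" using Aut_E_simps(3)[OF G_subset] compose by blast
  have p: "shift n p m \<in> E_set n" for m using shift_in_E_set[OF n compose.prems] .
  obtain N1 where N1: "\<And>m. m \<ge> N1 \<Longrightarrow> F (h (shift n p m)) = F (shift n p m)" using compose.IH(2)[OF compose.prems] by blast
  obtain N2 where N2: "\<And>m. m \<ge> N2 \<Longrightarrow> F (g (shift n (h p) m)) = F (shift n (h p) m)" using compose.IH(1)[OF hp] by blast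
  have h: "h (shift n p m) = shift n (h p) m" for m using compose.IH(2)[OF compose.prems] by auto
  have g: "g (shift n (h p) m) = shift n (g (h p)) m" for m using compose.IH(1)[OF hp] by auto
  have "F (g (h (shift n p m))) = F (shift n p m)" if "m \<ge> max N1 N2" for m
    using N1[of m] N2[of m] that by (simp add: h)
  then have "\<exists>N. \<forall>m\<ge>N. F (g (h (shift n p m))) = F (shift n p m)" by blast
  then show ?case using compose.prems p by (simp add: compose_eq h g)
qed

text \<open>The condition on D and \<open>\<phi>\<close> cancels the factorials in
  \<open>L_\<phi>\<close>, which makes L / D invariant under every legitimate step. Rationality
  follows because L(g p) / L(p) = D(g p) / D(p) whenever both integrals are finite.\<close>

lemma L_invariant:
  assumes n: "2 \<le> n" and Dds: "\<And>p. D p = (\<Prod>d\<leftarrow>ds. ifact (d p))"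
    and shift: "\<And>d p m. d \<in> set ds \<Longrightarrow> d (shift n p m) = d p + int m"
    and nonneg: "\<And>d p. d \<in> set ds \<Longrightarrow> p \<in> E_set n \<Longrightarrow> L n p < \<infinity> \<Longrightarrow> 0 \<le> d p"
    and D\<sigma>: "\<And>p. p \<in> E_set n \<Longrightarrow> D (\<sigma> n p) = D p" and D\<psi>: "\<And>p. p \<in> E_set n \<Longrightarrow> D (\<psi> n p) = D p"
    and D\<phi>: "\<And>p. p \<in> E_set n \<Longrightarrow> D (\<phi> n p) * (ifact (p (A (n-1))) * ifact (p (B (n-1))))
        = D p * (ifact (p (C n)) * ifact (p (A (n-1)) + p (B (n-1)) - p (C n)))"
  shows "leaves_invariant (carrier (G n)) (E_module n) (L n) D \<and>
    rhin_viola_group (carrier (G n)) (E_module n) (L n)"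
proof
  have Dpos: "0 < D p" for p
  proof -
    have "0 < (\<Prod>d\<leftarrow>ds'. ifact (d p))" for ds' by (induction ds') (auto simp: ifact_def)
    then show ?thesis by (simp add: Dds)
  qed
  have inv: "L n (g p) / of_nat (D (g p)) = L n p / of_nat (D p)"
    if g: "g \<in> carrier (G n)" and p: "p \<in> E_set n" and fin: "L n (g p) < \<infinity>" "L n p < \<infinity>" for g p
  proof -
    have gp: "g p \<in> E_set n" using Aut_E_simps(3)[OF G_subset[OF g] p] .
    have "(\<forall>m. g (shift n p m) = shift n (g p) m) \<and>
      (\<exists>N. \<forall>m\<ge>N. L n (g (shift n p m)) / of_nat (D (g (shift n p m))) = L n (shift n p m) / of_nat (D (shift n p m)))"
      using n g p
    proof (rule G_eventually_invariant)
      show "L n (\<phi> n p) / of_nat (D (\<phi> n p)) = L n p / of_nat (D p)"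
        if "p \<in> E_set n" "0 \<le> p (A (n-1))" "0 \<le> p (B (n-1))" "0 \<le> p (C n)"
          "0 \<le> p (A (n-1)) + p (B (n-1)) - p (C n)" for p
        using L_\<phi>_quotient[where D=D, OF n that D\<phi>[OF that(1)] Dpos Dpos] .
    qed (simp_all add: L_\<sigma>[OF n] L_\<psi>[OF n] D\<sigma> D\<psi>)
    then obtain N where eq: "\<And>m. g (shift n p m) = shift n (g p) m"
      and N: "\<And>m. m \<ge> N \<Longrightarrow> L n (g (shift n p m)) / of_nat (D (g (shift n p m))) = L n (shift n p m) / of_nat (D (shift n p m))"
      by blast
    note N = N[unfolded eq]
    show ?thesis unfolding Dds
      by (rule L_quotient_unique[OF n E_set_extensional[OF gp] E_set_extensional[OF p] fin, where N=N])
        (use shift nonneg[OF _ gp fin(1)] nonneg[OF _ p fin(2)] N in \<open>auto simp: Dds\<close>)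
  qed
  show "leaves_invariant (carrier (G n)) (E_module n) (L n) D"
    unfolding leaves_invariant_def E_module_simps
  proof (intro ballI impI)
    fix g p assume gp: "g \<in> carrier (G n)" "p \<in> E_set n" and iff: "L n (g p) = \<infinity> \<longleftrightarrow> L n p = \<infinity>"
    show "L n (g p) / of_nat (D (g p)) = L n p / of_nat (D p)"
    proof (cases "L n p = \<infinity>")
      case True
      then show ?thesis using iff by (simp add: ennreal_top_divide ennreal_of_nat_eq_real_of_nat)
    next
      case False
      then have "L n (g p) < \<infinity>" "L n p < \<infinity>" using iff by (auto simp: less_top)
      then show ?thesis by (rule inv[OF gp])
    qed
  qed
  show "rhin_viola_group (carrier (G n)) (E_module n) (L n)"
    unfolding rhin_viola_group_def E_module_simps
  proof (intro conjI ballI impI)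
    show "subgroup (carrier (G n)) (AutoGroup (E_module n))" by (rule subgroup_G)
    fix g p assume gp: "g \<in> carrier (G n)" "p \<in> E_set n" and iff: "L n (g p) = \<infinity> \<longleftrightarrow> L n p = \<infinity>"
    show "nonzero_rational_quotient (L n (g p)) (L n p)"
    proof (cases "L n p = \<infinity>")
      case True
      then show ?thesis using iff by (simp add: nonzero_rational_quotient_def)
    next
      case False
      then have fin: "L n (g p) < \<infinity>" "L n p < \<infinity>" using iff by (auto simp: less_top)
      then obtain r s where r: "L n (g p) = ennreal r" "0 \<le> r" and s: "L n p = ennreal s" "0 \<le> s"
        by (cases "L n (g p)"; cases "L n p") auto
      have rs: "0 < r" "0 < s" using r s L_nonzero[of n p] L_nonzero[of n "g p"] by (auto simp: less_le)
      have "r / real (D (g p)) = s / real (D p)"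
        using inv[OF gp fin] r s Dpos[of p] Dpos[of "g p"]
        by (simp add: ennreal_of_nat_eq_real_of_nat divide_ennreal)
      then have "r / s = real (D (g p)) / real (D p)"
        using rs Dpos[of p] Dpos[of "g p"] by (simp add: field_simps)
      then have "r / s \<in> \<rat>" by simp
      then show ?thesis using fin rs by (simp add: nonzero_rational_quotient_def r s)
    qed
  qed
qed

section \<open>The four denominators\<close>

lemma denom2_invariant:
  "leaves_invariant (carrier (G 2)) (E_module 2) (L 2) denom2 \<and>
   rhin_viola_group (carrier (G 2)) (E_module 2) (L 2)"
proof -
  let ?ds = "[\<lambda>p. p (A 1), \<lambda>p. p (A 2), \<lambda>p. p (B 1), \<lambda>p. p (B 2), \<lambda>p. p (A 1) + p (B 2) - p (C 2)]"
  have 1: "denom2 p = (\<Prod>d\<leftarrow>?ds. ifact (d p))" for p by (simp add: denom2_def)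
  have 2: "d (shift 2 p m) = d p + int m" if "d \<in> set ?ds" for d p m
    using that by (auto simp: shift_simps)
  have 3: "0 \<le> d p" if d: "d \<in> set ?ds" and p: "p \<in> E_set 2" and fin: "L 2 p < \<infinity>" for d p
  proof -
    \<comment> \<open>a_1 + b_2 - c_2 is the coordinate b_1 of \<open>\<psi> 2 p\<close>, whose
      integral is finite as well.\<close>
    have "L 2 (\<psi> 2 p) < \<infinity>" using fin L_\<psi>[OF order.refl p] by simp
    then have "0 \<le> \<psi> 2 p (B 1)" by (intro L_finite_imp_nonneg[of 2]) auto
    then show ?thesis using d L_finite_imp_nonneg[of 2 p, OF order.refl fin]
      by (auto simp: \<psi>_simps[OF p])
  qed
  have 4: "denom2 (\<sigma> 2 p) = denom2 p" "denom2 (\<psi> 2 p) = denom2 p"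
      "denom2 (\<phi> 2 p) * (ifact (p (A (2-1))) * ifact (p (B (2-1))))
        = denom2 p * (ifact (p (C 2)) * ifact (p (A (2-1)) + p (B (2-1)) - p (C 2)))"
    if p: "p \<in> E_set 2" for p
    by (simp_all add: denom2_def \<sigma>_simps[OF p] \<psi>_simps[OF p] \<phi>_simps[OF p] mult_ac add.commute numeral_2_eq_2[symmetric])
  show ?thesis
    by (rule L_invariant[where D=denom2 and ds="?ds"]; intro order.refl 1 2 3 4; assumption)
qed

lemma denom3_invariant:
  "leaves_invariant (carrier (G 3)) (E_module 3) (L 3) denom3 \<and>
   rhin_viola_group (carrier (G 3)) (E_module 3) (L 3)"
proof -
  let ?ds = "[\<lambda>p. p (A 1), \<lambda>p. p (A 2), \<lambda>p. p (A 3), \<lambda>p. p (B 1), \<lambda>p. p (B 2), \<lambda>p. p (B 3),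
    \<lambda>p. p (A 2) + p (B 3) - p (C 3), \<lambda>p. p (B 1) + p (B 3) - p (C 3)]"
  have n: "2 \<le> (3::nat)" by simp
  have 1: "denom3 p = (\<Prod>d\<leftarrow>?ds. ifact (d p))" for p by (simp add: denom3_def)
  have 2: "d (shift 3 p m) = d p + int m" if "d \<in> set ?ds" for d p m
    using that by (auto simp: shift_simps)
  have 3: "0 \<le> d p" if d: "d \<in> set ?ds" and p: "p \<in> E_set 3" and fin: "L 3 p < \<infinity>" for d p
  proof -
    have \<sigma>p: "\<sigma> 3 p \<in> E_set 3" by (rule \<sigma>_closed[OF n p])
    \<comment> \<open>a_2 + b_3 - c_3 and b_1 + b_3 - c_3 are the coordinates b_1 of
      \<open>\<psi> 3 p\<close> and of \<open>\<psi> 3 (\<sigma> 3 p)\<close>.\<close>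
    have "L 3 (\<psi> 3 p) < \<infinity>" "L 3 (\<psi> 3 (\<sigma> 3 p)) < \<infinity>"
      using fin L_\<psi>[OF n p] L_\<psi>[OF n \<sigma>p] L_\<sigma>[OF n p] by simp_all
    then have "0 \<le> \<psi> 3 p (B 1)" "0 \<le> \<psi> 3 (\<sigma> 3 p) (B 1)" by (auto intro!: L_finite_imp_nonneg[of 3])
    then show ?thesis using d L_finite_imp_nonneg[OF n fin]
      by (auto simp: \<psi>_simps[OF p] \<psi>_simps[OF \<sigma>p] \<sigma>_simps[OF p])
  qed
  have 4: "denom3 (\<sigma> 3 p) = denom3 p" "denom3 (\<psi> 3 p) = denom3 p"
      "denom3 (\<phi> 3 p) * (ifact (p (A (3-1))) * ifact (p (B (3-1))))
        = denom3 p * (ifact (p (C 3)) * ifact (p (A (3-1)) + p (B (3-1)) - p (C 3)))"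
    if p: "p \<in> E_set 3" for p
  proof -
    show "denom3 (\<sigma> 3 p) = denom3 p"
      by (simp add: denom3_def \<sigma>_simps[OF p] mult_ac)
    show "denom3 (\<psi> 3 p) = denom3 p"
    proof -
      \<comment> \<open>\<open>\<psi>\<close> exchanges b_1 with a_2 + b_3 - c_3 and fixes b_1 + b_3
        - c_3.\<close>
      have "\<psi> 3 p (B 1) + \<psi> 3 p (B 3) - \<psi> 3 p (C 3) = p (B 1) + p (B 3) - p (C 3)"
        "\<psi> 3 p (A 2) + \<psi> 3 p (B 3) - \<psi> 3 p (C 3) = p (B 1)"
        by (simp_all add: \<psi>_simps[OF p])
      note e = this
      show ?thesis unfolding denom3_def e by (simp add: \<psi>_simps[OF p] mult_ac)
    qed
    show "denom3 (\<phi> 3 p) * (ifact (p (A (3-1))) * ifact (p (B (3-1))))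
        = denom3 p * (ifact (p (C 3)) * ifact (p (A (3-1)) + p (B (3-1)) - p (C 3)))"
    proof -
      \<comment> \<open>\<open>\<phi>\<close> exchanges b_3 with a_2 + b_3 - c_3, so among the eight
        forms only a_2 and b_2 are replaced by new ones.\<close>
      have "\<phi> 3 p (B 1) + \<phi> 3 p (B 3) - \<phi> 3 p (C 3) = p (B 1) + p (B 3) - p (C 3)"
        "\<phi> 3 p (A 2) + \<phi> 3 p (B 3) - \<phi> 3 p (C 3) = p (B 3)"
        by (simp_all add: \<phi>_simps[OF p])
      note e = this
      show ?thesis unfolding denom3_def e by (simp add: \<phi>_simps[OF p] mult_ac)
    qed
  qed
  show ?thesis
    by (rule L_invariant[where D=denom3 and ds="?ds"]; intro n 1 2 3 4; assumption)
qed

text \<open>For n = 4 the indices n - 1 and 3 coincide and \<open>\<psi>\<close> fixes b_3, whereas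
  for n \<ge> 5 it exchanges b_{n-1} and b_3. This is why there is one factor fewer here.\<close>

lemma denom4_invariant:
  "leaves_invariant (carrier (G 4)) (E_module 4) (L 4) denom4 \<and>
   rhin_viola_group (carrier (G 4)) (E_module 4) (L 4)"
proof -
  let ?ds = "[\<lambda>p. p (A 3), \<lambda>p. p (B 3), \<lambda>p. p (A 2)]"
  have n: "2 \<le> (4::nat)" by simp
  have 1: "denom4 p = (\<Prod>d\<leftarrow>?ds. ifact (d p))" for p by (simp add: denom4_def)
  have 2: "d (shift 4 p m) = d p + int m" if "d \<in> set ?ds" for d p m
    using that by (auto simp: shift_simps)
  have 3: "0 \<le> d p" if d: "d \<in> set ?ds" and p: "p \<in> E_set 4" and fin: "L 4 p < \<infinity>" for d p
    using d L_finite_imp_nonneg[OF n fin] by auto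
  have 4: "denom4 (\<sigma> 4 p) = denom4 p" "denom4 (\<psi> 4 p) = denom4 p"
      "denom4 (\<phi> 4 p) * (ifact (p (A (4-1))) * ifact (p (B (4-1))))
        = denom4 p * (ifact (p (C 4)) * ifact (p (A (4-1)) + p (B (4-1)) - p (C 4)))"
    if p: "p \<in> E_set 4" for p
  proof -
    have "p (B 1) = p (A 2)" using p by (auto simp: E_set_iff)
    then show "denom4 (\<sigma> 4 p) = denom4 p" "denom4 (\<psi> 4 p) = denom4 p"
      "denom4 (\<phi> 4 p) * (ifact (p (A (4-1))) * ifact (p (B (4-1))))
        = denom4 p * (ifact (p (C 4)) * ifact (p (A (4-1)) + p (B (4-1)) - p (C 4)))"
      by (simp_all add: denom4_def \<sigma>_simps[OF p] \<psi>_simps[OF p] \<phi>_simps[OF p] mult_ac)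
  qed
  show ?thesis
    by (rule L_invariant[where D=denom4 and ds="?ds"]; intro n 1 2 3 4; assumption)
qed

lemma denom_ge5_invariant:
  assumes n5: "5 \<le> n"
  shows "leaves_invariant (carrier (G n)) (E_module n) (L n) (denom_ge5 n) \<and>
    rhin_viola_group (carrier (G n)) (E_module n) (L n)"
proof -
  let ?ds = "[\<lambda>p. p (A (n-1)), \<lambda>p. p (B (n-1)), \<lambda>p. p (A 2), \<lambda>p. p (B 3)]"
  have n: "2 \<le> n" using n5 by simp
  have 1: "denom_ge5 n p = (\<Prod>d\<leftarrow>?ds. ifact (d p))" for p by (simp add: denom_ge5_def)
  have 2: "d (shift n p m) = d p + int m" if "d \<in> set ?ds" for d p m
    using that n5 by (auto simp: shift_simps)
  have 3: "0 \<le> d p" if d: "d \<in> set ?ds" and p: "p \<in> E_set n" and fin: "L n p < \<infinity>" for d p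
    using d n5 L_finite_imp_nonneg[OF n fin] by auto
  have 4: "denom_ge5 n (\<sigma> n p) = denom_ge5 n p" "denom_ge5 n (\<psi> n p) = denom_ge5 n p"
      "denom_ge5 n (\<phi> n p) * (ifact (p (A (n-1))) * ifact (p (B (n-1))))
        = denom_ge5 n p * (ifact (p (C n)) * ifact (p (A (n-1)) + p (B (n-1)) - p (C n)))"
    if p: "p \<in> E_set n" for p
  proof -
    have b: "p (B 1) = p (A 2)" using p n5 by (auto simp: E_set_iff)
    have "\<sigma> n p (A (n-1)) = p (A (n-1))" "\<sigma> n p (B (n-1)) = p (B (n-1))" "\<sigma> n p (A 2) = p (A 2)" "\<sigma> n p (B 3) = p (B 3)"
      using \<sigma>_simps(1,2)[OF p, of "n-1"] \<sigma>_simps(1)[OF p, of 2] \<sigma>_simps(2)[OF p, of 3] b n5 by auto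
    then show "denom_ge5 n (\<sigma> n p) = denom_ge5 n p" by (simp add: denom_ge5_def)
    have i: "n + 1 - (n - 1) = 2" "n + 2 - (n - 1) = 3" "n + 1 - 2 = n - 1" "n + 2 - 3 = n - 1" using n5 by auto
    have "\<psi> n p (A (n-1)) = p (A 2)" "\<psi> n p (B (n-1)) = p (B 3)" "\<psi> n p (A 2) = p (A (n-1))" "\<psi> n p (B 3) = p (B (n-1))"
      using \<psi>_simps(1,2)[OF p, of "n-1", unfolded i] \<psi>_simps(1)[OF p, of 2, unfolded i] \<psi>_simps(2)[OF p, of 3, unfolded i] n5 by auto
    then show "denom_ge5 n (\<psi> n p) = denom_ge5 n p" by (simp add: denom_ge5_def)
    have "\<phi> n p (A (n-1)) = p (C n)" "\<phi> n p (B (n-1)) = p (A (n-1)) + p (B (n-1)) - p (C n)" "\<phi> n p (A 2) = p (A 2)" "\<phi> n p (B 3) = p (B 3)"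
      using \<phi>_simps(1,2)[OF p, of "n-1"] \<phi>_simps(1)[OF p, of 2] \<phi>_simps(2)[OF p, of 3] n5 by auto
    then show "denom_ge5 n (\<phi> n p) * (ifact (p (A (n-1))) * ifact (p (B (n-1))))
        = denom_ge5 n p * (ifact (p (C n)) * ifact (p (A (n-1)) + p (B (n-1)) - p (C n)))"
      unfolding denom_ge5_def by (simp only: mult_ac)
  qed
  show ?thesis
    by (rule L_invariant[where D="denom_ge5 n" and ds="?ds"]; intro n 1 2 3 4; assumption)
qed

section \<open>Isomorphism types\<close>

text \<open>A group is identified by its faithful action on a set into which \<open>E\<close> embeds equivariantly.\<close>

lemma G_iso:
  fixes act :: "'k \<Rightarrow> 'v \<Rightarrow> 'v" and \<Phi> :: "params \<Rightarrow> 'v"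
  assumes n: "2 \<le> n" and inj: "inj_on \<Phi> (E_set n)"
    and one: "\<one>\<^bsub>K\<^esub> \<in> carrier K" "\<And>v. act \<one>\<^bsub>K\<^esub> v = v"
    and mult: "\<And>k l. k \<in> carrier K \<Longrightarrow> l \<in> carrier K \<Longrightarrow> k \<otimes>\<^bsub>K\<^esub> l \<in> carrier K"
      "\<And>k l v. k \<in> carrier K \<Longrightarrow> l \<in> carrier K \<Longrightarrow> act (k \<otimes>\<^bsub>K\<^esub> l) v = act k (act l v)"
    and faithful: "\<And>k l. k \<in> carrier K \<Longrightarrow> l \<in> carrier K \<Longrightarrow> (\<And>p. p \<in> E_set n \<Longrightarrow> act k (\<Phi> p) = act l (\<Phi> p)) \<Longrightarrow> k = l"
    and ks: "ks \<in> carrier K" "kp \<in> carrier K" "kf \<in> carrier K"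
    and act: "\<And>p. p \<in> E_set n \<Longrightarrow> \<Phi> (\<sigma> n p) = act ks (\<Phi> p)" "\<And>p. p \<in> E_set n \<Longrightarrow> \<Phi> (\<psi> n p) = act kp (\<Phi> p)"
      "\<And>p. p \<in> E_set n \<Longrightarrow> \<Phi> (\<phi> n p) = act kf (\<Phi> p)"
    and gen: "\<And>R. R \<subseteq> carrier K \<Longrightarrow> \<one>\<^bsub>K\<^esub> \<in> R \<Longrightarrow> ks \<in> R \<Longrightarrow> kp \<in> R \<Longrightarrow> kf \<in> R \<Longrightarrow>
      (\<And>k l. k \<in> R \<Longrightarrow> l \<in> R \<Longrightarrow> k \<otimes>\<^bsub>K\<^esub> l \<in> R) \<Longrightarrow> carrier K \<subseteq> R"
  shows "G n \<cong> K"
proof -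
  have closed: "g p \<in> E_set n" if "g \<in> carrier (G n)" "p \<in> E_set n" for g p
    using Aut_E_simps(3)[OF G_subset] that by blast
  \<comment> \<open>\<open>rel g k\<close> says that k acts on the image of \<Phi> as g acts on E.
    Faithfulness makes it single-valued, and it is the graph of the isomorphism \<tau>.\<close>
  define rel where "rel g k \<longleftrightarrow> k \<in> carrier K \<and> (\<forall>p\<in>E_set n. \<Phi> (g p) = act k (\<Phi> p))" for g k
  have rel_compose: "rel (compose (E_set n) g h) (k \<otimes>\<^bsub>K\<^esub> l)"
    if "g \<in> carrier (G n)" "h \<in> carrier (G n)" "rel g k" "rel h l" for g h k l
    using that mult closed by (auto simp: rel_def compose_eq)
  have rel_unique: "k = l" if "rel g k" "rel g l" for g k l
    using that by (intro faithful) (auto simp: rel_def)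
  have ex: "\<exists>k. rel g k" if "g \<in> carrier (G n)" for g
    using n that
  proof (induction rule: G_induct)
    case one
    then show ?case using \<open>\<one>\<^bsub>K\<^esub> \<in> carrier K\<close> \<open>\<And>v. act \<one>\<^bsub>K\<^esub> v = v\<close> by (auto simp: rel_def)
  next
    case (compose g h)
    then show ?case using rel_compose by blast
  qed (use ks act in \<open>auto simp: rel_def\<close>)
  define \<tau> where "\<tau> g = (THE k. rel g k)" for g
  have \<tau>: "rel g (\<tau> g)" if "g \<in> carrier (G n)" for g
    unfolding \<tau>_def using ex[OF that] rel_unique by (metis theI)
  have \<tau>_eq: "\<tau> g = k" if "g \<in> carrier (G n)" "rel g k" for g k
    using rel_unique[OF \<tau>[OF that(1)] that(2)] .
  have "\<tau> \<in> hom (G n) K"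
    unfolding hom_def
  proof (intro CollectI conjI funcsetI ballI)
    show "\<tau> g \<in> carrier K" if "g \<in> carrier (G n)" for g using \<tau>[OF that] by (simp add: rel_def)
    show "\<tau> (g \<otimes>\<^bsub>G n\<^esub> h) = \<tau> g \<otimes>\<^bsub>K\<^esub> \<tau> h" if "g \<in> carrier (G n)" "h \<in> carrier (G n)" for g h
      unfolding G_mult[OF that] by (rule \<tau>_eq[OF G_closed[OF that] rel_compose[OF that \<tau>[OF that(1)] \<tau>[OF that(2)]]])
  qed
  moreover have "inj_on \<tau> (carrier (G n))"
  proof (rule inj_onI)
    fix g h assume gh: "g \<in> carrier (G n)" "h \<in> carrier (G n)" and eq: "\<tau> g = \<tau> h"
    show "g = h"
    proof (rule extensionalityI[OF Aut_E_simps(1)[OF G_subset[OF gh(1)]] Aut_E_simps(1)[OF G_subset[OF gh(2)]]])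
      fix p assume p: "p \<in> E_set n"
      have "\<Phi> (g p) = \<Phi> (h p)" using \<tau>[OF gh(1)] \<tau>[OF gh(2)] eq p by (simp add: rel_def)
      then show "g p = h p" using inj closed[OF gh(1) p] closed[OF gh(2) p] by (auto dest: inj_onD)
    qed
  qed
  \<comment> \<open>The image of \<tau> contains the images of the generators and is closed under
    multiplication, so \<open>gen\<close> applies.\<close>
  moreover have "carrier K \<subseteq> \<tau> ` carrier (G n)"
  proof (rule gen)
    show "\<tau> ` carrier (G n) \<subseteq> carrier K" using \<tau> by (auto simp: rel_def)
    have "rel (\<lambda>p\<in>E_set n. p) \<one>\<^bsub>K\<^esub>" using one by (auto simp: rel_def)
    then show "\<one>\<^bsub>K\<^esub> \<in> \<tau> ` carrier (G n)" using \<tau>_eq G_one by (metis imageI)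
    have "rel (\<sigma> n) ks" "rel (\<psi> n) kp" "rel (\<phi> n) kf" using ks act by (auto simp: rel_def)
    then show "ks \<in> \<tau> ` carrier (G n)" "kp \<in> \<tau> ` carrier (G n)" "kf \<in> \<tau> ` carrier (G n)"
      using \<tau>_eq generators_in_G[OF n] by (metis imageI)+
    show "k \<otimes>\<^bsub>K\<^esub> l \<in> \<tau> ` carrier (G n)" if kl: "k \<in> \<tau> ` carrier (G n)" "l \<in> \<tau> ` carrier (G n)" for k l
    proof -
      obtain g h where gh: "g \<in> carrier (G n)" "h \<in> carrier (G n)" "k = \<tau> g" "l = \<tau> h" using kl by auto
      then have "\<tau> (compose (E_set n) g h) = k \<otimes>\<^bsub>K\<^esub> l"
        using \<tau>_eq[OF G_closed rel_compose[OF _ _ \<tau> \<tau>]] by auto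
      then show ?thesis using G_closed[OF gh(1,2)] by (metis imageI)
    qed
  qed
  ultimately have "\<tau> \<in> iso (G n) K"
    unfolding iso_iff by (auto simp: hom_def)
  then show ?thesis by (rule is_isoI)
qed

section \<open>Generating and distinguishing permutations\<close>

abbreviation tr :: "nat \<Rightarrow> nat \<Rightarrow> nat \<Rightarrow> nat" where
  "tr \<equiv> Transposition.transpose"

lemmas tr_def = Transposition.transpose_def

abbreviation pinv :: "(nat \<Rightarrow> nat) \<Rightarrow> nat \<Rightarrow> nat" where
  "pinv \<equiv> inv_into UNIV"

text \<open>The star of transpositions at c generates, because (a b) = (c a)(c b)(c a).\<close>

lemma permutes_in_closed_set:
  assumes S: "finite S" "c \<in> S" and R: "id \<in> R" "\<And>p q. p \<in> R \<Longrightarrow> q \<in> R \<Longrightarrow> p \<circ> q \<in> R"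
    and t: "\<And>x. x \<in> S \<Longrightarrow> x \<noteq> c \<Longrightarrow> tr c x \<in> R" and \<pi>: "\<pi> permutes S"
  shows "\<pi> \<in> R"
  using \<pi> S(1)
proof (induction rule: permutes_induct)
  case id
  show ?case by (rule R(1))
next
  case (swap a b p)
  have "tr a b \<in> R"
  proof (cases "a = c \<or> b = c")
    case True
    then show ?thesis using t[of a] t[of b] swap by (auto simp: transpose_commute)
  next
    case False
    then have "tr a b = tr c a \<circ> tr c b \<circ> tr c a" using swap by (auto simp: fun_eq_iff tr_def)
    then show ?thesis using t[of a] t[of b] swap False R(2) by metis
  qed
  then show ?case using R(2) swap by blast
qed

text \<open>A permutation is determined by how it moves one injective labelling. Faithfulness of
  each action below is thereby tested on a single parameter vector.\<close>

lemma permutes_eq_of_inj_on: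
  assumes "\<pi> permutes S" "\<rho> permutes S" "inj_on v S" "\<And>i. i \<in> S \<Longrightarrow> v (pinv \<pi> i) = v (pinv \<rho> i)"
  shows "\<pi> = \<rho>"
proof -
  have "pinv \<pi> i = pinv \<rho> i" for i
  proof (cases "i \<in> S")
    case True
    then have "pinv \<pi> i \<in> S" "pinv \<rho> i \<in> S"
      using assms(1,2) permutes_in_image[OF permutes_inv] by metis+
    then show ?thesis using assms(3,4) True by (meson inj_onD)
  next
    case False
    then show ?thesis using assms(1,2) permutes_not_in[OF permutes_inv] by metis
  qed
  then have "pinv \<pi> = pinv \<rho>" by auto
  then show ?thesis using assms(1,2) by (metis permutes_inv_inv)
qed

lemma inv_tr_tr:
  assumes "{a, b} \<inter> {c, d} = {}" shows "pinv (tr a b \<circ> tr c d) = tr a b \<circ> tr c d"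
  by (rule inv_unique_comp) (use assms in \<open>auto simp: fun_eq_iff tr_def\<close>)

lemma permutes_tr: "a \<in> S \<Longrightarrow> b \<in> S \<Longrightarrow> tr a b permutes S"
  by (rule permutes_swap_id)

lemma permutes_tr_tr: "a \<in> S \<Longrightarrow> b \<in> S \<Longrightarrow> c \<in> S \<Longrightarrow> d \<in> S \<Longrightarrow> tr a b \<circ> tr c d permutes S"
  by (intro permutes_compose permutes_tr)

lemma inv_comp_permutes:
  assumes "\<pi> permutes S" "\<rho> permutes S" shows "pinv (\<pi> \<circ> \<rho>) = pinv \<rho> \<circ> pinv \<pi>"
  using assms permutes_bij by (intro o_inv_distrib) auto

section \<open>The case n = 2: the symmetric group on five letters\<close>

text \<open>With \<open>m = a\<^sub>1 + b\<^sub>2 - c\<^sub>2\<close>, the cycle \<open>(h\<^sub>0, \<dots>, h\<^sub>4) = (b\<^sub>2, m, a\<^sub>1, a\<^sub>2, b\<^sub>1)\<close> is written as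
  \<open>h\<^sub>i = (X\<^sub>i + X\<^sub>i\<^sub>+\<^sub>1) / 2\<close>; the three generators permute the \<open>X\<^sub>i\<close>.\<close>

definition coords2 :: "params \<Rightarrow> nat \<Rightarrow> int" where
  "coords2 p = (let a1 = p (A 1); a2 = p (A 2); b1 = p (B 1); b2 = p (B 2); m = a1 + b2 - p (C 2) in
     (\<lambda>_. 0)(1 := b2 - m + a1 - a2 + b1, 2 := m - a1 + a2 - b1 + b2, 3 := a1 - a2 + b1 - b2 + m,
       4 := a2 - b1 + b2 - m + a1, 5 := b1 - b2 + m - a1 + a2))"

lemma E_set_2: "p \<in> E_set 2 \<longleftrightarrow> p \<in> extensional (coords 2)"
  by (auto simp: E_set_iff)

lemma G2_iso: "G 2 \<cong> sym_group 5"
proof (rule G_iso[where \<Phi>=coords2 and act="\<lambda>\<pi> v. v \<circ> pinv \<pi>" and ks="tr 1 4 \<circ> tr 2 3" and kp="tr 1 2 \<circ> tr 3 5" and kf="tr 1 3"])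
  show "inj_on coords2 (E_set 2)"
  proof (rule inj_onI)
    fix p q assume p: "p \<in> E_set 2" and q: "q \<in> E_set 2" and eq: "coords2 p = coords2 q"
    have "coords2 p i = coords2 q i" for i by (simp add: eq)
    from this[of 1] this[of 2] this[of 3] this[of 4] this[of 5]
    have e: "p (A 1) = q (A 1)" "p (A 2) = q (A 2)" "p (B 1) = q (B 1)" "p (B 2) = q (B 2)" "p (C 2) = q (C 2)"
      by (auto simp: coords2_def Let_def)
    have "k = 1 \<or> k = 2" if "1 \<le> k" "k \<le> 2" for k :: nat using that by auto
    then show "p = q"
      using e by (intro params_eqI[OF E_set_extensional[OF p] E_set_extensional[OF q]]) (blast, blast, force)
  qed
  show "k \<otimes>\<^bsub>sym_group 5\<^esub> l \<in> carrier (sym_group 5)" if "k \<in> carrier (sym_group 5)" "l \<in> carrier (sym_group 5)" for k l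
    using that by (auto simp: sym_group_def intro: permutes_compose)
  show "v \<circ> pinv (k \<otimes>\<^bsub>sym_group 5\<^esub> l) = v \<circ> pinv l \<circ> pinv k" if "k \<in> carrier (sym_group 5)" "l \<in> carrier (sym_group 5)" for k l and v :: "nat \<Rightarrow> int"
    using that by (auto simp: sym_group_def inv_comp_permutes o_assoc)
  show "k = l" if k: "k \<in> carrier (sym_group 5)" and l: "l \<in> carrier (sym_group 5)"
    and eq: "\<And>p. p \<in> E_set 2 \<Longrightarrow> coords2 p \<circ> pinv k = coords2 p \<circ> pinv l" for k l
  proof -
    \<comment> \<open>The vector with X_i = 2 i: here (b_2, m, a_1, a_2, b_1) = (3, 5, 7, 9,
      6).\<close>
    define p :: params where "p = (\<lambda>i\<in>coords 2. case i of A k \<Rightarrow> if k = 1 then 7 else 9 | B k \<Rightarrow> if k = 1 then 6 else 3 | C k \<Rightarrow> 5)"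
    have "p \<in> E_set 2" by (simp add: E_set_2 p_def)
    from eq[OF this] have e: "coords2 p (pinv k i) = coords2 p (pinv l i)" for i by (auto simp: fun_eq_iff)
    have "coords2 p i = 2 * int i" if "i \<in> {1..5}" for i
    proof -
      have "i = 1 \<or> i = 2 \<or> i = 3 \<or> i = 4 \<or> i = 5" using that by auto
      then show ?thesis by (auto simp: coords2_def p_def Let_def)
    qed
    then have "inj_on (coords2 p) {1..5}" by (auto simp: inj_on_def)
    then show ?thesis using k l e by (intro permutes_eq_of_inj_on[of k "{1..5}" l "coords2 p"]) (auto simp: sym_group_def)
  qed
  show "tr 1 4 \<circ> tr 2 3 \<in> carrier (sym_group 5)" "tr 1 2 \<circ> tr 3 5 \<in> carrier (sym_group 5)"
    unfolding sym_group_def by (auto intro!: permutes_tr_tr)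
  show "tr 1 3 \<in> carrier (sym_group 5)"
    unfolding sym_group_def by (auto intro!: permutes_tr)
  fix p assume p: "p \<in> E_set 2"
  have i1: "pinv (tr 1 4 \<circ> tr 2 3) = tr 1 4 \<circ> tr 2 3" "pinv (tr 1 2 \<circ> tr 3 5) = tr 1 2 \<circ> tr 3 5"
    by (rule inv_tr_tr; simp)+
  show "coords2 (\<sigma> 2 p) = coords2 p \<circ> pinv (tr 1 4 \<circ> tr 2 3)"
    unfolding i1 by (auto simp: fun_eq_iff coords2_def Let_def \<sigma>_simps[OF p] tr_def)
  show "coords2 (\<psi> 2 p) = coords2 p \<circ> pinv (tr 1 2 \<circ> tr 3 5)"
    unfolding i1 by (auto simp: fun_eq_iff coords2_def Let_def \<psi>_simps[OF p] tr_def)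
  show "coords2 (\<phi> 2 p) = coords2 p \<circ> pinv (tr 1 3)"
    by (auto simp: fun_eq_iff coords2_def Let_def \<phi>_simps[OF p] tr_def)
next
  fix R
  assume id: "\<one>\<^bsub>sym_group 5\<^esub> \<in> R" and s: "tr 1 4 \<circ> tr 2 3 \<in> R" and p: "tr 1 2 \<circ> tr 3 5 \<in> R" and f: "tr 1 3 \<in> R"
    and "\<And>k l. k \<in> R \<Longrightarrow> l \<in> R \<Longrightarrow> k \<otimes>\<^bsub>sym_group 5\<^esub> l \<in> R"
  then have R: "k \<circ> l \<in> R" if "k \<in> R" "l \<in> R" for k l using that by (simp add: sym_group_def)
  \<comment> \<open>Conjugating (1 3) by the other two generators, and then the resulting
    transpositions among themselves, completes the star at 1.\<close>
  have "tr 2 4 = (tr 1 4 \<circ> tr 2 3) \<circ> tr 1 3 \<circ> (tr 1 4 \<circ> tr 2 3)" by (auto simp: fun_eq_iff tr_def)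
  then have t24: "tr 2 4 \<in> R" using R s f by metis
  have "tr 2 5 = (tr 1 2 \<circ> tr 3 5) \<circ> tr 1 3 \<circ> (tr 1 2 \<circ> tr 3 5)" by (auto simp: fun_eq_iff tr_def)
  then have t25: "tr 2 5 \<in> R" using R p f by metis
  have "tr 1 4 = (tr 1 2 \<circ> tr 3 5) \<circ> tr 2 4 \<circ> (tr 1 2 \<circ> tr 3 5)" by (auto simp: fun_eq_iff tr_def)
  then have t14: "tr 1 4 \<in> R" using R p t24 by metis
  have "tr 1 2 = tr 1 4 \<circ> tr 2 4 \<circ> tr 1 4" by (auto simp: fun_eq_iff tr_def)
  then have t12: "tr 1 2 \<in> R" using R t14 t24 by metis
  have "tr 1 5 = tr 1 2 \<circ> tr 2 5 \<circ> tr 1 2" by (auto simp: fun_eq_iff tr_def)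
  then have t15: "tr 1 5 \<in> R" using R t12 t25 by metis
  show "carrier (sym_group 5) \<subseteq> R"
  proof
    fix \<pi> assume "\<pi> \<in> carrier (sym_group 5)"
    then have \<pi>: "\<pi> permutes {1..5}" by (simp add: sym_group_def)
    show "\<pi> \<in> R"
    proof (rule permutes_in_closed_set[OF _ _ _ _ _ \<pi>])
      show "id \<in> R" using id by (simp add: sym_group_def)
      show "tr 1 x \<in> R" if "x \<in> {1..5}" "x \<noteq> 1" for x
      proof -
        have "x = 2 \<or> x = 3 \<or> x = 4 \<or> x = 5" using that by auto
        then show ?thesis using t12 f t14 t15 by auto
      qed
    qed (use R in auto)
  qed
qed (auto simp: sym_group_def permutes_id)

section \<open>The case n = 3: signed permutations of five letters\<close>

text \<open>With \<open>m = a\<^sub>2 + b\<^sub>3 - c\<^sub>3\<close>, \<open>r = b\<^sub>1 + b\<^sub>3 - c\<^sub>3\<close>, the eight forms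
  \<open>(h\<^sub>0, \<dots>, h\<^sub>7) = (b\<^sub>1, a\<^sub>3, a\<^sub>2, a\<^sub>1, m, b\<^sub>3, r, b\<^sub>2)\<close> are written as
  \<open>4 h\<^sub>i = t + y\<^sub>i + y\<^sub>i\<^sub>+\<^sub>1 + y\<^sub>i\<^sub>+\<^sub>2 + y\<^sub>i\<^sub>+\<^sub>3 + (-1)\<^sup>i z\<close>, where \<open>y\<^sub>i\<^sub>+\<^sub>4 = - y\<^sub>i\<close>. The generators fix \<open>t\<close> and
  act on \<open>(y\<^sub>0, - y\<^sub>1, - y\<^sub>2, - y\<^sub>3, z)\<close> by permutations with an even number of sign changes.\<close>

definition coords3 :: "params \<Rightarrow> nat \<Rightarrow> int" where
  "coords3 p = (let a1 = p (A 1); a2 = p (A 2); a3 = p (A 3); b1 = p (B 1); b2 = p (B 2); b3 = p (B 3);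
       m = a2 + b3 - p (C 3); r = b1 + b3 - p (C 3) in
     (\<lambda>_. 0)(0 := b1 + m + a3 + b3, 1 := b1 - a3 - m + b3, 2 := - (a3 - a2 - b3 + r),
       3 := - (a2 - a1 - r + b2), 4 := - (a1 - m - b2 + b1), 5 := b1 - a3 + m - b3))"

definition sign5 :: "(nat \<Rightarrow> int) \<Rightarrow> nat \<Rightarrow> int" where
  "sign5 \<epsilon> i = (if i \<in> {1..5} \<and> \<epsilon> i = 1 then - 1 else 1)"

text \<open>Position 0, where \<open>coords3\<close> stores t, is fixed: permutations of {1..5} do
  not move it, and \<open>sign5\<close> is 1 there.\<close>

definition act3 :: "(nat \<Rightarrow> int) \<times> (nat \<Rightarrow> nat) \<Rightarrow> (nat \<Rightarrow> int) \<Rightarrow> nat \<Rightarrow> int" where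
  "act3 = (\<lambda>(\<epsilon>, \<pi>) v i. sign5 \<epsilon> i * v (pinv \<pi> i))"

definition ind5 :: "nat set \<Rightarrow> nat \<Rightarrow> int" where
  "ind5 S = (\<lambda>i\<in>{1..5}. if i \<in> S then 1 else 0)"

lemma in_carrier_H_S5:
  "(\<epsilon>, \<pi>) \<in> carrier H_S5 \<longleftrightarrow> \<epsilon> \<in> extensional {1..5} \<and> (\<forall>i\<in>{1..5}. \<epsilon> i = 0 \<or> \<epsilon> i = 1) \<and>
     (\<Sum>i=1..5. \<epsilon> i) mod 2 = 0 \<and> \<pi> permutes {1..5}"
proof -
  have "\<epsilon> i \<in> {0..<2} \<longleftrightarrow> \<epsilon> i = 0 \<or> \<epsilon> i = 1" for i by auto
  then show ?thesis
    by (auto simp: H_S5_def semidirect_product_def H_hyperplane_def sym_group_def carrier_product_group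
      carrier_integer_mod_group PiE_iff)
qed

lemma mult_H_S5:
  "(x, h) \<otimes>\<^bsub>H_S5\<^esub> (y, k) = (\<lambda>i\<in>{1..5}. (x i + y (pinv h i)) mod 2, h \<circ> k)"
  by (auto simp: H_S5_def semidirect_product_def H_hyperplane_def sym_group_def perm_action_def fun_eq_iff)

lemma one_H_S5: "\<one>\<^bsub>H_S5\<^esub> = (ind5 {}, id)"
  by (auto simp: H_S5_def semidirect_product_def H_hyperplane_def sym_group_def ind5_def)

lemma cases5: "i \<in> {1..5::nat} \<longleftrightarrow> i = 1 \<or> i = 2 \<or> i = 3 \<or> i = 4 \<or> i = 5"
  by auto

lemma sum5: "(\<Sum>i=1..5. f i) = f 1 + f 2 + f 3 + f 4 + f (5::nat)" for f :: "nat \<Rightarrow> int"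
  by (simp add: numeral_eq_Suc)

lemma nat_fun_eqI5:
  fixes f g :: "nat \<Rightarrow> int"
  assumes "f 0 = g 0" "f 1 = g 1" "f 2 = g 2" "f 3 = g 3" "f 4 = g 4" "f 5 = g 5" "\<And>i. 5 < i \<Longrightarrow> f i = g i"
  shows "f = g"
proof (rule ext)
  fix i :: nat
  have "i = 0 \<or> i = 1 \<or> i = 2 \<or> i = 3 \<or> i = 4 \<or> i = 5 \<or> 5 < i" by auto
  then show "f i = g i" using assms by blast
qed

lemma coords3_inj: "inj_on coords3 (E_set 3)"
proof (rule inj_onI)
  fix p q assume p: "p \<in> E_set 3" and q: "q \<in> E_set 3" and eq: "coords3 p = coords3 q"
  have e: "coords3 p i = coords3 q i" for i by (simp add: eq)
  have rel: "r (A 1) + r (B 2) = r (A 3) + r (B 3)" "r (C 2) = 0" if "r \<in> E_set 3" for r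
    using that by (auto simp: E_set_iff)
  note es = e[of 0, simplified coords3_def Let_def, simplified] e[of 1, simplified coords3_def Let_def, simplified]
    e[of 2, simplified coords3_def Let_def, simplified] e[of 3, simplified coords3_def Let_def, simplified]
    e[of 4, simplified coords3_def Let_def, simplified] e[of 5, simplified coords3_def Let_def, simplified]
    rel[OF p, simplified] rel[OF q, simplified]
  have "p (A (Suc 0)) = q (A (Suc 0))" "p (A 2) = q (A 2)" "p (A 3) = q (A 3)"
    "p (B (Suc 0)) = q (B (Suc 0))" "p (B 2) = q (B 2)" "p (B 3) = q (B 3)" "p (C 3) = q (C 3)" "p (C 2) = q (C 2)"
    using es by linarith+
  note eqs = this
  have c: "k = 1 \<or> k = 2 \<or> k = 3" if "1 \<le> k" "k \<le> 3" for k :: nat using that by auto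
  show "p = q"
  proof (rule params_eqI[OF E_set_extensional[OF p] E_set_extensional[OF q]])
    show "p (A k) = q (A k)" "p (B k) = q (B k)" if "1 \<le> k" "k \<le> 3" for k
      using c[OF that] eqs by auto
    show "p (C k) = q (C k)" if "2 \<le> k" "k \<le> 3" for k
      using c[of k] that eqs by auto
  qed
qed

lemma act3_mult:
  assumes "k \<in> carrier H_S5" "l \<in> carrier H_S5"
  shows "k \<otimes>\<^bsub>H_S5\<^esub> l \<in> carrier H_S5" "act3 (k \<otimes>\<^bsub>H_S5\<^esub> l) v = act3 k (act3 l v)"
proof -
  obtain x h y g where kl: "k = (x, h)" "l = (y, g)" by (cases k; cases l) auto
  have x: "\<forall>i\<in>{1..5}. x i = 0 \<or> x i = 1" "(\<Sum>i=1..5. x i) mod 2 = 0" "h permutes {1..5}"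
    using assms(1) by (auto simp: kl in_carrier_H_S5)
  have y: "\<forall>i\<in>{1..5}. y i = 0 \<or> y i = 1" "(\<Sum>i=1..5. y i) mod 2 = 0" "g permutes {1..5}"
    using assms(2) by (auto simp: kl in_carrier_H_S5)
  have hi: "pinv h i \<in> {1..5} \<longleftrightarrow> i \<in> {1..5}" for i
    by (rule permutes_in_image[OF permutes_inv[OF x(3)]])
  \<comment> \<open>Evenness of the number of sign changes survives, since permuting the positions
    of y does not change its sum.\<close>
  have "(\<Sum>i=1..5. (\<lambda>i\<in>{1..5}. (x i + y (pinv h i)) mod 2) i) mod 2 = (\<Sum>i=1..5. (x i + y (pinv h i)) mod 2) mod 2"
    by simp
  also have "\<dots> = ((\<Sum>i=1..5. x i) + (\<Sum>i=1..5. y (pinv h i))) mod 2"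
    by (simp add: mod_sum_eq sum.distrib)
  also have "(\<Sum>i=1..5. y (pinv h i)) = (\<Sum>i=1..5. y i)"
    using sum.permute[OF permutes_inv[OF x(3)], of y] by (simp add: comp_def)
  also have "((\<Sum>i=1..5. x i) + (\<Sum>i=1..5. y i)) mod 2 = 0"
    using x(2) y(2) by presburger
  finally have sum: "(\<Sum>i=1..5. (\<lambda>i\<in>{1..5}. (x i + y (pinv h i)) mod 2) i) mod 2 = 0" .
  have "(x i + y (pinv h i)) mod 2 = 0 \<or> (x i + y (pinv h i)) mod 2 = 1" for i by presburger
  then show "k \<otimes>\<^bsub>H_S5\<^esub> l \<in> carrier H_S5"
    unfolding kl mult_H_S5 in_carrier_H_S5 using sum permutes_compose[OF y(3) x(3)] by simp
  have sign: "sign5 (\<lambda>i\<in>{1..5}. (x i + y (pinv h i)) mod 2) i = sign5 x i * sign5 y (pinv h i)" for i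
  proof (cases "i \<in> {1..5}")
    case True
    then have "x i = 0 \<or> x i = 1" "y (pinv h i) = 0 \<or> y (pinv h i) = 1" using x(1) y(1) hi[of i] by auto
    then show ?thesis using True hi[of i] by (auto simp: sign5_def simp del: atLeastAtMost_iff One_nat_def)
  qed (use hi[of i] in \<open>auto simp: sign5_def simp del: atLeastAtMost_iff\<close>)
  show "act3 (k \<otimes>\<^bsub>H_S5\<^esub> l) v = act3 k (act3 l v)"
    unfolding kl mult_H_S5 act3_def
    by (rule ext) (simp add: sign inv_comp_permutes[OF x(3) y(3)] del: atLeastAtMost_iff restrict_apply One_nat_def)
qed

lemma act3_faithful:
  assumes k: "k \<in> carrier H_S5" and l: "l \<in> carrier H_S5"
    and eq: "\<And>p. p \<in> E_set 3 \<Longrightarrow> act3 k (coords3 p) = act3 l (coords3 p)"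
  shows "k = l"
proof -
  obtain x h y g where kl: "k = (x, h)" "l = (y, g)" by (cases k; cases l) auto
  have x: "x \<in> extensional {1..5}" "\<And>i. i \<in> {1..5} \<Longrightarrow> x i = 0 \<or> x i = 1" "h permutes {1..5}"
    using k by (auto simp: kl in_carrier_H_S5)
  have y: "y \<in> extensional {1..5}" "\<And>i. i \<in> {1..5} \<Longrightarrow> y i = 0 \<or> y i = 1" "g permutes {1..5}"
    using l by (auto simp: kl in_carrier_H_S5)
  \<comment> \<open>Here (y_0, -y_1, -y_2, -y_3, z) = (1, -3, -5, -7, 9). The distinct absolute
    values reveal the permutation; as the values are nonzero, the signs then reveal x.\<close>
  define p :: params where "p = (\<lambda>i\<in>coords 3. case i of A k \<Rightarrow> if k = 1 then - 2 else if k = 2 then 5 else 2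
      | B k \<Rightarrow> if k = 1 then 7 else if k = 2 then - 1 else - 5 | C k \<Rightarrow> if k = 3 then 1 else 0)"
  have p: "p \<in> E_set 3" by (auto simp: E_set_iff p_def)
  define v where "v = coords3 p"
  have v: "v 1 = 1" "v 2 = - 3" "v 3 = - 5" "v 4 = - 7" "v 5 = 9"
    by (auto simp: v_def coords3_def Let_def p_def)
  have inj: "inj_on (\<lambda>i. \<bar>v i\<bar>) {1..5}"
  proof (rule inj_onI)
    fix i j assume "i \<in> {1..5}" "j \<in> {1..5}" "\<bar>v i\<bar> = \<bar>v j\<bar>"
    then show "i = j" unfolding cases5 by (elim disjE) (simp_all add: v del: One_nat_def)
  qed
  have nz: "v i \<noteq> 0" if "i \<in> {1..5}" for i
    using that unfolding cases5 by (elim disjE) (simp_all add: v del: One_nat_def)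
  have e: "sign5 x i * v (pinv h i) = sign5 y i * v (pinv g i)" for i
    using fun_cong[OF eq[OF p], of i] by (simp add: act3_def kl v_def)
  have abs: "\<bar>sign5 z i * w\<bar> = \<bar>w\<bar>" for z i w by (simp add: sign5_def)
  have hg: "h = g"
  proof (rule permutes_eq_of_inj_on[OF x(3) y(3) inj])
    show "\<bar>v (pinv h i)\<bar> = \<bar>v (pinv g i)\<bar>" for i using e[of i] abs by metis
  qed
  have "x i = y i" if i: "i \<in> {1..5}" for i
  proof -
    have "pinv g i \<in> {1..5}" using permutes_in_image[OF permutes_inv[OF y(3)]] i by blast
    then have "sign5 x i = sign5 y i" using e[of i] nz unfolding hg by simp
    then show ?thesis using x(2)[OF i] y(2)[OF i] i by (auto simp: sign5_def split: if_splits)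
  qed
  then have "x = y" by (rule extensionalityI[OF x(1) y(1)])
  then show ?thesis using hg kl by simp
qed

text \<open>Pure permutations are produced first. They split the signed generator into a permutation
  and the sign vector with support {2, 3}; conjugates of that vector span H.\<close>

lemma H_S5_generated:
  assumes one: "(ind5 {}, id) \<in> R" and s: "(ind5 {}, tr 1 2 \<circ> tr 3 4) \<in> R"
    and p: "(ind5 {2, 3}, tr 1 4 \<circ> tr 2 3) \<in> R" and f: "(ind5 {}, tr 1 5) \<in> R"
    and closed: "\<And>x h y k. (x, h) \<in> R \<Longrightarrow> (y, k) \<in> R \<Longrightarrow> (\<lambda>i\<in>{1..5}. (x i + y (pinv h i)) mod 2, h \<circ> k) \<in> R"
  shows "carrier H_S5 \<subseteq> R"
proof -
  have tt: "pinv (tr 1 4 \<circ> tr 2 3) = tr 1 4 \<circ> tr 2 3" by (rule inv_tr_tr) simp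
  have closed0: "(ind5 {}, h \<circ> k) \<in> R" if h: "(ind5 {}, h) \<in> R" "h permutes {1..5}" and k: "(ind5 {}, k) \<in> R" for h k
  proof -
    have "pinv h i \<in> {1..5} \<longleftrightarrow> i \<in> {1..5}" for i
      by (rule permutes_in_image[OF permutes_inv[OF h(2)]])
    then have "(\<lambda>i\<in>{1..5}. (ind5 {} i + ind5 {} (pinv h i)) mod 2) = ind5 {}"
      by (auto simp: ind5_def fun_eq_iff simp del: atLeastAtMost_iff One_nat_def)
    then show ?thesis using closed[OF h(1) k] by simp
  qed
  define P where "P = {h. h permutes {1..5} \<and> (ind5 {}, h) \<in> R}"
  have Pc: "h \<circ> k \<in> P" if "h \<in> P" "k \<in> P" for h k
    using that closed0 by (auto simp: P_def intro: permutes_compose)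
  have sP: "tr 1 2 \<circ> tr 3 4 \<in> P" using s permutes_tr_tr[of 1 "{1..5}" 2 3 4] by (auto simp: P_def)
  have t15: "tr 1 5 \<in> P" using f permutes_tr[of 1 "{1..5}" 5] by (auto simp: P_def)
  \<comment> \<open>This is (1 5) conjugated by the signed generator. Its signs at 2 and 3 cancel,
    because (1 5) fixes 2 and 3 and (1 4)(2 3) maps {2, 3} to itself.\<close>
  have t45: "tr 4 5 \<in> P"
  proof -
    have 1: "(ind5 {2, 3}, (tr 1 4 \<circ> tr 2 3) \<circ> tr 1 5) \<in> R"
    proof -
      have "(\<lambda>i\<in>{1..5}. (ind5 {2, 3} i + ind5 {} (pinv (tr 1 4 \<circ> tr 2 3) i)) mod 2) = ind5 {2, 3}"
        unfolding tt by (auto simp: ind5_def fun_eq_iff tr_def)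
      then show ?thesis using closed[OF p f] by simp
    qed
    have 2: "pinv ((tr 1 4 \<circ> tr 2 3) \<circ> tr 1 5) = tr 1 5 \<circ> (tr 1 4 \<circ> tr 2 3)"
      using inv_comp_permutes[OF permutes_tr_tr[of 1 "{1..5}" 4 2 3] permutes_tr[of 1 "{1..5}" 5]]
      unfolding tt inv_transpose_eq by simp
    have 3: "(\<lambda>i\<in>{1..5}. (ind5 {2, 3} i + ind5 {2, 3} (pinv ((tr 1 4 \<circ> tr 2 3) \<circ> tr 1 5) i)) mod 2) = ind5 {}"
      unfolding 2 by (auto simp: ind5_def fun_eq_iff tr_def)
    have "((tr 1 4 \<circ> tr 2 3) \<circ> tr 1 5) \<circ> (tr 1 4 \<circ> tr 2 3) = tr 4 5"
      by (auto simp: fun_eq_iff tr_def)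
    then have "(ind5 {}, tr 4 5) \<in> R" using closed[OF 1 p] unfolding 3 by simp
    then show ?thesis using permutes_tr[of 4 "{1..5}" 5] by (auto simp: P_def)
  qed
  have "tr 2 5 = (tr 1 2 \<circ> tr 3 4) \<circ> tr 1 5 \<circ> (tr 1 2 \<circ> tr 3 4)" by (auto simp: fun_eq_iff tr_def)
  then have t25: "tr 2 5 \<in> P" using Pc sP t15 by metis
  have "tr 3 5 = (tr 1 2 \<circ> tr 3 4) \<circ> tr 4 5 \<circ> (tr 1 2 \<circ> tr 3 4)" by (auto simp: fun_eq_iff tr_def)
  then have t35: "tr 3 5 \<in> P" using Pc sP t45 by metis
  have P: "\<pi> \<in> P" if "\<pi> permutes {1..5}" for \<pi>
  proof (rule permutes_in_closed_set[OF _ _ _ Pc _ that, of 5])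
    show "id \<in> P" using one by (auto simp: P_def permutes_id)
    show "tr 5 x \<in> P" if "x \<in> {1..5}" "x \<noteq> 5" for x
      using that t15 t25 t35 t45 unfolding cases5 by (auto simp: transpose_commute)
  qed auto
  have e23: "(ind5 {2, 3}, id) \<in> R"
  proof -
    have "(ind5 {}, tr 1 4 \<circ> tr 2 3) \<in> R" using P[OF permutes_tr_tr[of 1 "{1..5}" 4 2 3]] by (auto simp: P_def)
    from closed[OF p this] have "(\<lambda>i\<in>{1..5}. (ind5 {2, 3} i + ind5 {} (pinv (tr 1 4 \<circ> tr 2 3) i)) mod 2,
        (tr 1 4 \<circ> tr 2 3) \<circ> (tr 1 4 \<circ> tr 2 3)) \<in> R" .
    moreover have "(\<lambda>i\<in>{1..5}. (ind5 {2, 3} i + ind5 {} (pinv (tr 1 4 \<circ> tr 2 3) i)) mod 2) = ind5 {2, 3}"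
      unfolding tt by (auto simp: ind5_def fun_eq_iff tr_def)
    moreover have "(tr 1 4 \<circ> tr 2 3) \<circ> (tr 1 4 \<circ> tr 2 3) = id"
      by (auto simp: fun_eq_iff tr_def)
    ultimately show ?thesis by simp
  qed
  \<comment> \<open>Conjugation by \<pi> moves the support {2, 3} to {\<pi> 2, \<pi> 3}.\<close>
  have conj: "(ind5 {\<pi> 2, \<pi> 3}, id) \<in> R" if \<pi>: "\<pi> permutes {1..5}" for \<pi>
  proof -
    have in5: "pinv \<pi> i \<in> {1..5} \<longleftrightarrow> i \<in> {1..5}" for i
      by (rule permutes_in_image[OF permutes_inv[OF \<pi>]])
    have iff: "pinv \<pi> i = j \<longleftrightarrow> i = \<pi> j" for i j
      using permutes_inverses[OF \<pi>] by auto
    have "(ind5 {}, \<pi>) \<in> R" using P[OF \<pi>] by (simp add: P_def)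
    from closed[OF this e23]
    have "(\<lambda>i\<in>{1..5}. (ind5 {} i + ind5 {2, 3} (pinv \<pi> i)) mod 2, \<pi>) \<in> R" by simp
    moreover have "(\<lambda>i\<in>{1..5}. (ind5 {} i + ind5 {2, 3} (pinv \<pi> i)) mod 2) = ind5 {\<pi> 2, \<pi> 3}"
      by (auto simp: ind5_def fun_eq_iff in5 iff simp del: atLeastAtMost_iff One_nat_def)
    ultimately have 1: "(ind5 {\<pi> 2, \<pi> 3}, \<pi>) \<in> R" by simp
    have "(ind5 {}, pinv \<pi>) \<in> R" using P[OF permutes_inv[OF \<pi>]] by (simp add: P_def)
    from closed[OF 1 this]
    have "(\<lambda>i\<in>{1..5}. (ind5 {\<pi> 2, \<pi> 3} i + ind5 {} (pinv \<pi> i)) mod 2, id) \<in> R"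
      using permutes_inv_o(1)[OF \<pi>] by simp
    moreover have "(\<lambda>i\<in>{1..5}. (ind5 {\<pi> 2, \<pi> 3} i + ind5 {} (pinv \<pi> i)) mod 2) = ind5 {\<pi> 2, \<pi> 3}"
      by (auto simp: ind5_def fun_eq_iff in5 simp del: atLeastAtMost_iff One_nat_def)
    ultimately show ?thesis by simp
  qed
  have e: "(ind5 {j, 5}, id) \<in> R" if "j \<in> {1..4}" for j
  proof -
    have "j = 1 \<or> j = 2 \<or> j = 3 \<or> j = 4" using that by auto
    moreover have "(ind5 {1, 5}, id) \<in> R"
      using conj[OF permutes_tr_tr[of 1 "{1..5}" 2 3 5]] by (simp add: tr_def)
    moreover have "(ind5 {2, 5}, id) \<in> R"
      using conj[OF permutes_tr[of 3 "{1..5}" 5]] by (simp add: tr_def)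
    moreover have "(ind5 {3, 5}, id) \<in> R"
      using conj[OF permutes_tr[of 2 "{1..5}" 5]] by (simp add: tr_def insert_commute)
    moreover have "(ind5 {4, 5}, id) \<in> R"
      using conj[OF permutes_tr_tr[of 4 "{1..5}" 2 3 5]] by (simp add: tr_def)
    ultimately show ?thesis by auto
  qed
  have add: "(\<lambda>i\<in>{1..5}. (x i + y i) mod 2, id) \<in> R" if "(x, id) \<in> R" "(y, id) \<in> R" for x y
    using closed[OF that] by simp
  show "carrier H_S5 \<subseteq> R"
  proof
    fix k assume k: "k \<in> carrier H_S5"
    obtain x h where xh: "k = (x, h)" by (cases k) auto
    have x: "x \<in> extensional {1..5}" "\<And>i. i \<in> {1..5} \<Longrightarrow> x i = 0 \<or> x i = 1" "(x 1 + x 2 + x 3 + x 4 + x 5) mod 2 = 0"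
      and h: "h permutes {1..5}"
      using k unfolding xh in_carrier_H_S5 sum5 by blast+
    \<comment> \<open>x is the sum of x_j times the vector with support {j, 5}, for j = 1, ..., 4.
      The coordinate 5 comes out right because the sum of x is even.\<close>
    define u where "u j = (if x j = 1 then ind5 {j, 5} else ind5 {})" for j
    have u: "(u j, id) \<in> R" if "j \<in> {1..4}" for j using e[OF that] one by (simp add: u_def)
    let ?w = "\<lambda>i\<in>{1..5}. ((\<lambda>i\<in>{1..5}. ((\<lambda>i\<in>{1..5}. (u 1 i + u 2 i) mod 2) i + u 3 i) mod 2) i + u 4 i) mod 2"
    have "(?w, id) \<in> R"
      by (intro add u) auto
    moreover have "?w = x"
    proof (rule extensionalityI[OF _ x(1)])
      fix i :: nat assume i: "i \<in> {1..5}"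
      have uj: "u j i = (if i = j \<or> i = 5 then x j else 0)" if "j \<in> {1..4}" for j
        using i that x(2)[of j] by (auto simp: u_def ind5_def)
      have "(((u 1 i + u 2 i) mod 2 + u 3 i) mod 2 + u 4 i) mod 2 = x i"
      proof (cases "i = 5")
        case True
        have "x 5 = 0 \<or> x 5 = 1" using x(2) by auto
        then have "(((x 1 + x 2) mod 2 + x 3) mod 2 + x 4) mod 2 = x 5" using x(3) by presburger
        then show ?thesis using uj[of 1] uj[of 2] uj[of 3] uj[of 4] True by (simp del: One_nat_def)
      next
        case False
        have "x i mod 2 = x i" using x(2)[OF i] by auto
        then show ?thesis using i False uj[of 1] uj[of 2] uj[of 3] uj[of 4] unfolding cases5
          by (elim disjE) (simp_all del: One_nat_def)
      qed
      then show "?w i = x i"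
        using i by (simp del: One_nat_def)
    qed simp
    ultimately have 1: "(x, id) \<in> R" by simp
    have "(ind5 {}, h) \<in> R" using P[OF h] by (simp add: P_def)
    from closed[OF 1 this] have "(\<lambda>i\<in>{1..5}. (x i + ind5 {} i) mod 2, h) \<in> R" by simp
    moreover have "(\<lambda>i\<in>{1..5}. (x i + ind5 {} i) mod 2) = x"
    proof (rule extensionalityI[OF _ x(1)])
      fix i :: nat assume i: "i \<in> {1..5}"
      then show "(\<lambda>i\<in>{1..5}. (x i + ind5 {} i) mod 2) i = x i" using x(2)[OF i] by (auto simp: ind5_def)
    qed simp
    ultimately show "k \<in> R" by (simp add: xh)
  qed
qed

lemma G3_iso: "G 3 \<cong> H_S5"
proof (rule G_iso[where \<Phi>=coords3 and act=act3 and ks="(ind5 {}, tr 1 2 \<circ> tr 3 4)"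
      and kp="(ind5 {2, 3}, tr 1 4 \<circ> tr 2 3)" and kf="(ind5 {}, tr 1 5)"])
  show "inj_on coords3 (E_set 3)" by (rule coords3_inj)
  show "\<one>\<^bsub>H_S5\<^esub> \<in> carrier H_S5"
    by (auto simp: one_H_S5 in_carrier_H_S5 sum5 permutes_id) (auto simp: ind5_def)
  show "act3 \<one>\<^bsub>H_S5\<^esub> v = v" for v
    by (auto simp: one_H_S5 act3_def sign5_def ind5_def fun_eq_iff)
  show "(ind5 {}, tr 1 2 \<circ> tr 3 4) \<in> carrier H_S5" "(ind5 {2, 3}, tr 1 4 \<circ> tr 2 3) \<in> carrier H_S5" "(ind5 {}, tr 1 5) \<in> carrier H_S5"
    using permutes_tr_tr[of 1 "{1..5}" 2 3 4] permutes_tr_tr[of 1 "{1..5}" 4 2 3] permutes_tr[of 1 "{1..5}" 5]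
    unfolding in_carrier_H_S5 sum5 by (auto simp: ind5_def)
  fix p assume p: "p \<in> E_set 3"
  have i: "pinv (tr 1 2 \<circ> tr 3 4) = tr 1 2 \<circ> tr 3 4" "pinv (tr 1 4 \<circ> tr 2 3) = tr 1 4 \<circ> tr 2 3"
    by (rule inv_tr_tr; simp)+
  show "coords3 (\<sigma> 3 p) = act3 (ind5 {}, tr 1 2 \<circ> tr 3 4) (coords3 p)"
    unfolding act3_def prod.case i by (rule nat_fun_eqI5) (simp_all add: sign5_def ind5_def coords3_def Let_def \<sigma>_simps[OF p] tr_def)
  have rel: "p (A (Suc 0)) = p (A 3) + p (B 3) - p (B 2)" using p by (auto simp: E_set_iff)
  show "coords3 (\<psi> 3 p) = act3 (ind5 {2, 3}, tr 1 4 \<circ> tr 2 3) (coords3 p)"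
    unfolding act3_def prod.case i by (rule nat_fun_eqI5) (simp_all add: sign5_def ind5_def coords3_def Let_def rel \<psi>_simps[OF p] tr_def)
  show "coords3 (\<phi> 3 p) = act3 (ind5 {}, tr 1 5) (coords3 p)"
    unfolding act3_def prod.case by (rule nat_fun_eqI5) (simp_all add: sign5_def ind5_def coords3_def Let_def \<phi>_simps[OF p] tr_def)
next
  fix R :: "((nat \<Rightarrow> int) \<times> (nat \<Rightarrow> nat)) set"
  assume "\<one>\<^bsub>H_S5\<^esub> \<in> R" and s: "(ind5 {}, tr 1 2 \<circ> tr 3 4) \<in> R" and p: "(ind5 {2, 3}, tr 1 4 \<circ> tr 2 3) \<in> R"
    and f: "(ind5 {}, tr 1 5) \<in> R" and closed: "\<And>k l. k \<in> R \<Longrightarrow> l \<in> R \<Longrightarrow> k \<otimes>\<^bsub>H_S5\<^esub> l \<in> R"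
  then have one: "(ind5 {}, id) \<in> R" by (simp add: one_H_S5)
  show "carrier H_S5 \<subseteq> R"
    by (rule H_S5_generated[OF one s p f]) (use closed mult_H_S5 in metis)
qed (use act3_mult act3_faithful in auto)

section \<open>The case n \<ge> 4: two triples and their exchange\<close>

text \<open>For \<open>n \<ge> 4\<close> the sum \<open>T = a\<^sub>k + a\<^sub>k\<^sub>+\<^sub>1 + b\<^sub>k\<^sub>+\<^sub>1\<close> does not depend on \<open>k\<close>. The triples
  \<open>(a\<^sub>2, a\<^sub>1, b\<^sub>2)\<close> and \<open>(a\<^sub>n\<^sub>-\<^sub>1, a\<^sub>n, b\<^sub>n)\<close> of sum \<open>T\<close> are permuted and exchanged, and
  \<open>a\<^sub>3, \<dots>, a\<^sub>n\<^sub>-\<^sub>2\<close> is reversed when they are exchanged.\<close>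

definition triple :: "int \<Rightarrow> int \<Rightarrow> int \<Rightarrow> nat \<Rightarrow> int" where
  "triple a b c = (\<lambda>_. 0)(1 := a, 2 := b, 3 := c)"

definition coords4 :: "nat \<Rightarrow> params \<Rightarrow> (nat \<Rightarrow> int) \<times> (nat \<Rightarrow> int) \<times> (nat \<Rightarrow> int)" where
  "coords4 n p = (triple (p (A 2)) (p (A 1)) (p (B 2)), triple (p (A (n-1))) (p (A n)) (p (B n)),
     \<lambda>i. if i \<in> {3..n-2} then p (A i) else 0)"

text \<open>Truncated subtraction would send every i > n + 1 to 0; the second branch makes the map
  an involution on all natural numbers.\<close>

definition reversal :: "nat \<Rightarrow> nat \<Rightarrow> nat" where
  "reversal n i = (if i \<le> n + 1 then n + 1 - i else i)"

text \<open>For t = 1 the triples are exchanged before they are permuted, since ((\<pi>, \<rho>), 1)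
  is the product of ((\<pi>, \<rho>), 0) with the swap on its right.\<close>

definition act4 :: "nat \<Rightarrow> ((nat \<Rightarrow> nat) \<times> (nat \<Rightarrow> nat)) \<times> int
    \<Rightarrow> (nat \<Rightarrow> int) \<times> (nat \<Rightarrow> int) \<times> (nat \<Rightarrow> int) \<Rightarrow> (nat \<Rightarrow> int) \<times> (nat \<Rightarrow> int) \<times> (nat \<Rightarrow> int)" where
  "act4 n = (\<lambda>((\<pi>, \<rho>), t) (u, v, w).
     if t = 0 then (u \<circ> pinv \<pi>, v \<circ> pinv \<rho>, w) else (v \<circ> pinv \<pi>, u \<circ> pinv \<rho>, w \<circ> reversal n))"

lemma in_carrier_S3_S3_Z2:
  "((\<pi>, \<rho>), t) \<in> carrier S3_S3_Z2 \<longleftrightarrow> \<pi> permutes {1..3} \<and> \<rho> permutes {1..3} \<and> (t = 0 \<or> t = 1)"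
proof -
  have "t \<in> {0..<2} \<longleftrightarrow> t = 0 \<or> t = 1" by auto
  then show ?thesis
    by (auto simp: S3_S3_Z2_def semidirect_product_def sym_group_def carrier_integer_mod_group DirProd_def)
qed

lemma mult_S3_S3_Z2:
  "((\<pi>, \<rho>), s) \<otimes>\<^bsub>S3_S3_Z2\<^esub> ((\<pi>', \<rho>'), t)
     = ((\<pi> \<circ> (if s = 0 then \<pi>' else \<rho>'), \<rho> \<circ> (if s = 0 then \<rho>' else \<pi>')), (s + t) mod 2)"
  by (simp add: S3_S3_Z2_def semidirect_product_def sym_group_def DirProd_def swap_action_def)

lemma one_S3_S3_Z2: "\<one>\<^bsub>S3_S3_Z2\<^esub> = ((id, id), 0)"
  by (simp add: S3_S3_Z2_def semidirect_product_def sym_group_def DirProd_def)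

lemma card_S3_S3_Z2: "card (carrier S3_S3_Z2) = 72"
proof -
  have "carrier S3_S3_Z2 = (carrier (sym_group 3) \<times> carrier (sym_group 3)) \<times> {0..<2}"
    by (simp add: S3_S3_Z2_def semidirect_product_def carrier_integer_mod_group DirProd_def)
  then show ?thesis by (simp add: card_cartesian_product sym_group_card_carrier fact_numeral)
qed

lemma reversal_reversal: "reversal n \<circ> reversal n = id"
  by (auto simp: reversal_def fun_eq_iff)

lemma act4_mult:
  assumes "k \<in> carrier S3_S3_Z2" "l \<in> carrier S3_S3_Z2"
  shows "k \<otimes>\<^bsub>S3_S3_Z2\<^esub> l \<in> carrier S3_S3_Z2" "act4 n (k \<otimes>\<^bsub>S3_S3_Z2\<^esub> l) x = act4 n k (act4 n l x)"
proof -
  obtain \<pi> \<rho> s \<pi>' \<rho>' t where kl: "k = ((\<pi>, \<rho>), s)" "l = ((\<pi>', \<rho>'), t)"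
    by (metis surj_pair)
  have p: "\<pi> permutes {1..3}" "\<rho> permutes {1..3}" "\<pi>' permutes {1..3}" "\<rho>' permutes {1..3}" "s = 0 \<or> s = 1" "t = 0 \<or> t = 1"
    using assms unfolding kl in_carrier_S3_S3_Z2 by auto
  have c: "\<pi> \<circ> \<pi>' permutes {1..3}" "\<rho> \<circ> \<rho>' permutes {1..3}" "\<pi> \<circ> \<rho>' permutes {1..3}" "\<rho> \<circ> \<pi>' permutes {1..3}"
    using p by (auto intro: permutes_compose)
  show "k \<otimes>\<^bsub>S3_S3_Z2\<^esub> l \<in> carrier S3_S3_Z2"
    unfolding kl mult_S3_S3_Z2 in_carrier_S3_S3_Z2 using c p(5,6) by auto
  obtain u v w where x: "x = (u, v, w)" by (metis surj_pair)
  have i: "pinv (\<pi> \<circ> \<pi>') = pinv \<pi>' \<circ> pinv \<pi>" "pinv (\<rho> \<circ> \<rho>') = pinv \<rho>' \<circ> pinv \<rho>"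
      "pinv (\<pi> \<circ> \<rho>') = pinv \<rho>' \<circ> pinv \<pi>" "pinv (\<rho> \<circ> \<pi>') = pinv \<pi>' \<circ> pinv \<rho>"
    using p inv_comp_permutes by auto
  have r: "w \<circ> reversal n \<circ> reversal n = w" by (simp add: o_assoc[symmetric] reversal_reversal)
  show "act4 n (k \<otimes>\<^bsub>S3_S3_Z2\<^esub> l) x = act4 n k (act4 n l x)"
    using p(5,6) unfolding kl mult_S3_S3_Z2 x act4_def by (auto simp: i o_assoc r)
qed

text \<open>The defining relation with index k says that these sums agree for k and k + 1.\<close>

lemma E_set_sum:
  assumes p: "p \<in> E_set n" and n: "4 \<le> n" and k: "1 \<le> k" "k < n"
  shows "p (A k) + p (A (k+1)) + p (B (k+1)) = p (A 1) + p (A 2) + p (B 2)"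
  using k
proof (induction k rule: dec_induct)
  case base
  then show ?case by (simp add: numeral_2_eq_2)
next
  case (step k)
  then have "k \<in> {1..n-2}" using k by auto
  then have "p (A k) + p (B (k+1)) = p (A (k+2)) + p (B (k+2))" using p n by (auto simp: E_set_iff)
  then show ?case using step by simp
qed

lemma triple_simps: "triple a b c 1 = a" "triple a b c 2 = b" "triple a b c 3 = c"
  by (auto simp: triple_def)

text \<open>All a_k are visible in the coordinates, and the first triple gives T. Then b_{k+1} = T -
  a_k - a_{k+1}, b_1 = a_2 and c_n = b_n recover the rest.\<close>

lemma coords4_inj:
  assumes n: "4 \<le> n" shows "inj_on (coords4 n) (E_set n)"
proof (rule inj_onI)
  fix p q assume p: "p \<in> E_set n" and q: "q \<in> E_set n" and "coords4 n p = coords4 n q"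
  then have e1: "triple (p (A 2)) (p (A 1)) (p (B 2)) = triple (q (A 2)) (q (A 1)) (q (B 2))"
    and e2: "triple (p (A (n-1))) (p (A n)) (p (B n)) = triple (q (A (n-1))) (q (A n)) (q (B n))"
    and e3: "(\<lambda>i. if i \<in> {3..n-2} then p (A i) else 0) = (\<lambda>i. if i \<in> {3..n-2} then q (A i) else 0)"
    by (auto simp: coords4_def)
  have t: "a = a' \<and> b = b' \<and> c = c'" if "triple a b c = triple a' b' c'" for a b c a' b' c'
    using that triple_simps by metis
  have A: "p (A k) = q (A k)" if "1 \<le> k" "k \<le> n" for k
  proof -
    have "k = 1 \<or> k = 2 \<or> k \<in> {3..n-2} \<or> k = n - 1 \<or> k = n" using that by auto
    then show ?thesis using t[OF e1] t[OF e2] fun_cong[OF e3, of k] by (elim disjE) simp_all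
  qed
  have B: "p (B k) = q (B k)" if k: "1 \<le> k" "k \<le> n" for k
  proof (cases "k = 1")
    case True
    then show ?thesis using p q n A[of 2] by (auto simp: E_set_iff)
  next
    case False
    then obtain j where j: "k = j + 1" "1 \<le> j" "j < n" using k by (cases k) auto
    then show ?thesis using E_set_sum[OF p n j(2,3)] E_set_sum[OF q n j(2,3)] A[of j] A[of "j+1"] A[of 1] A[of 2] n t[OF e1]
      by simp
  qed
  show "p = q"
  proof (rule params_eqI[OF E_set_extensional[OF p] E_set_extensional[OF q] A B])
    show "p (C k) = q (C k)" if "2 \<le> k" "k \<le> n" for k
    proof (cases "k = n")
      case True
      then show ?thesis using p q n B[of n] by (auto simp: E_set_iff)
    next
      case False
      then have "k \<in> {2..n-1}" using that by auto
      then show ?thesis using p q unfolding E_set_iff by metis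
    qed
  qed
qed

lemma act4_faithful:
  assumes n: "4 \<le> n" and k: "k \<in> carrier S3_S3_Z2" and l: "l \<in> carrier S3_S3_Z2"
    and eq: "\<And>p. p \<in> E_set n \<Longrightarrow> act4 n k (coords4 n p) = act4 n l (coords4 n p)"
  shows "k = l"
proof -
  obtain \<pi> \<rho> s \<pi>' \<rho>' t where kl: "k = ((\<pi>, \<rho>), s)" "l = ((\<pi>', \<rho>'), t)"
    by (metis surj_pair)
  have P: "\<pi> permutes {1..3}" "\<rho> permutes {1..3}" "\<pi>' permutes {1..3}" "\<rho>' permutes {1..3}" and st: "s = 0 \<or> s = 1" "t = 0 \<or> t = 1"
    using k l unfolding kl in_carrier_S3_S3_Z2 by auto
  \<comment> \<open>The triples become (0, 1, 5) and (2, 4, 0). Each has distinct entries, and 1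
    occurs only in the first, which detects the exchange. T = 6 makes b_n = 6 - 2 - 4 = 0 agree with
    c_n.\<close>
  define a :: "nat \<Rightarrow> int" where "a k = (if k = 1 then 1 else if k = n - 1 then 2 else if k = n then 4 else 0)" for k
  define p :: params where "p = (\<lambda>i\<in>coords n. case i of A k \<Rightarrow> a k | B k \<Rightarrow> if k = 1 then 0 else 6 - a (k-1) - a k | C k \<Rightarrow> 0)"
  have a: "a 1 = 1" "a 2 = 0" "a (n-1) = 2" "a n = 4" using n by (auto simp: a_def)
  have pA: "p (A k) = a k" if "1 \<le> k" "k \<le> n" for k using that by (simp add: p_def)
  have pB: "p (B k) = (if k = 1 then 0 else 6 - a (k-1) - a k)" if "1 \<le> k" "k \<le> n" for k using that by (simp add: p_def)
  have pC: "p (C k) = 0" if "2 \<le> k" "k \<le> n" for k using that by (simp add: p_def)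
  have p: "p \<in> E_set n"
  proof -
    have "p (A k) + p (B (k+1)) = p (A (k+2)) + p (B (k+2))" if "k \<in> {1..n-2}" for k
    proof -
      have "1 \<le> k" "k + 2 \<le> n" using that n by auto
      then show ?thesis by (simp add: pA pB)
    qed
    moreover have "p (C k) = 0" if "k \<in> {2..n-1}" for k
    proof -
      have "2 \<le> k" "k \<le> n" using that by auto
      then show ?thesis by (rule pC)
    qed
    moreover have "p (A 2) = p (B 1)" using n a by (simp add: pA pB)
    moreover have "p (B n) = p (C n)" using n a pB[of n] pC[of n] by simp
    moreover have "p \<in> extensional (coords n)" by (simp add: p_def)
    ultimately show ?thesis using n by (simp add: E_set_iff)
  qed
  define u where "u = triple 0 1 5"
  define v where "v = triple 2 4 0"
  define w where "w = (\<lambda>i. if i \<in> {3..n-2} then p (A i) else 0)"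
  have "p (A 2) = 0" "p (A 1) = 1" "p (B 2) = 5" "p (A (n-1)) = 2" "p (A n) = 4" "p (B n) = 0"
    using n a pA[of 1] pA[of 2] pA[of "n-1"] pA[of n] pB[of 2] pB[of n] by simp_all
  then have c: "coords4 n p = (u, v, w)" by (simp add: coords4_def u_def v_def w_def)
  have cases3: "i \<in> {1..3} \<longleftrightarrow> i = 1 \<or> i = 2 \<or> i = 3" for i :: nat by auto
  have inju: "inj_on u {1..3}"
  proof (rule inj_onI)
    fix i j assume "i \<in> {1..3}" "j \<in> {1..3}" "u i = u j"
    then show "i = j" unfolding cases3 by (elim disjE) (simp_all add: u_def triple_simps del: One_nat_def)
  qed
  have injv: "inj_on v {1..3}"
  proof (rule inj_onI)
    fix i j assume "i \<in> {1..3}" "j \<in> {1..3}" "v i = v j"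
    then show "i = j" unfolding cases3 by (elim disjE) (simp_all add: v_def triple_simps del: One_nat_def)
  qed
  have ne: "u \<circ> pinv \<alpha> \<noteq> v \<circ> pinv \<beta>" if "\<alpha> permutes {1..3}" for \<alpha> \<beta>
  proof
    assume "u \<circ> pinv \<alpha> = v \<circ> pinv \<beta>"
    from fun_cong[OF this, of "\<alpha> 2"] have "u 2 = v (pinv \<beta> (\<alpha> 2))"
      using permutes_inverses(2)[OF that] by simp
    moreover have "v i \<noteq> 1" for i by (auto simp: v_def triple_def)
    ultimately show False by (auto simp: u_def triple_simps)
  qed
  have E: "act4 n k (u, v, w) = act4 n l (u, v, w)" using eq[OF p] unfolding c .
  have inj: "\<alpha> = \<beta>" if "x \<circ> pinv \<alpha> = x \<circ> pinv \<beta>" "inj_on x {1..3}" "\<alpha> permutes {1..3}" "\<beta> permutes {1..3}" for x :: "nat \<Rightarrow> int" and \<alpha> \<beta>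
    by (rule permutes_eq_of_inj_on[OF that(3,4,2)]) (use fun_cong[OF that(1)] in auto)
  have "s = t"
  proof (rule ccontr)
    assume "s \<noteq> t"
    with st consider "s = 0" "t = 1" | "s = 1" "t = 0" by auto
    then show False
    proof cases
      case 1
      then have "u \<circ> pinv \<pi> = v \<circ> pinv \<pi>'" using E by (simp add: kl act4_def)
      then show False using ne[OF P(1)] by blast
    next
      case 2
      then have "u \<circ> pinv \<pi>' = v \<circ> pinv \<pi>" using E by (simp add: kl act4_def)
      then show False using ne[OF P(3)] by blast
    qed
  qed
  moreover from this st have "u \<circ> pinv \<pi> = u \<circ> pinv \<pi>' \<and> v \<circ> pinv \<rho> = v \<circ> pinv \<rho>'
     \<or> v \<circ> pinv \<pi> = v \<circ> pinv \<pi>' \<and> u \<circ> pinv \<rho> = u \<circ> pinv \<rho>'"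
    using E by (auto simp: kl act4_def)
  then have "\<pi> = \<pi>'" "\<rho> = \<rho>'" using inj inju injv P by blast+
  ultimately show ?thesis by (simp add: kl)
qed

text \<open>Conjugation by the swap carries (1 3) from the second factor to the first, where it
  forms with (2 3) the star at 3; conjugating back fills the second factor.\<close>

lemma S3_S3_Z2_generated:
  assumes one: "((id, id), 0) \<in> R" and s: "((tr 2 3, id), 0) \<in> R" and p: "((id, id), 1) \<in> R" and f: "((id, tr 1 3), 0) \<in> R"
    and closed: "\<And>k l. k \<in> R \<Longrightarrow> l \<in> R \<Longrightarrow> k \<otimes>\<^bsub>S3_S3_Z2\<^esub> l \<in> R"
  shows "carrier S3_S3_Z2 \<subseteq> R"
proof -
  have swap: "((\<rho>, \<pi>), 0) \<in> R" if "((\<pi>, \<rho>), 0) \<in> R" for \<pi> \<rho>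
    using closed[OF closed[OF p that] p] by (simp add: mult_S3_S3_Z2)
  define P where "P = {\<pi>. ((\<pi>, id), 0) \<in> R}"
  have P: "\<pi> \<in> P" if "\<pi> permutes {1..3}" for \<pi>
  proof (rule permutes_in_closed_set[OF _ _ _ _ _ that, of 3])
    show "id \<in> P" using one by (simp add: P_def)
    show "\<alpha> \<circ> \<beta> \<in> P" if "\<alpha> \<in> P" "\<beta> \<in> P" for \<alpha> \<beta>
      using that closed[of "((\<alpha>, id), 0)" "((\<beta>, id), 0)"] by (simp add: P_def mult_S3_S3_Z2)
    have "tr 3 1 \<in> P" "tr 3 2 \<in> P" using s swap[OF f] by (simp_all add: P_def transpose_commute)
    moreover have "x = 1 \<or> x = 2" if "x \<in> {1..3}" "x \<noteq> 3" for x :: nat using that by auto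
    ultimately show "tr 3 x \<in> P" if "x \<in> {1..3}" "x \<noteq> 3" for x using that by blast
  qed auto
  have 0: "((\<pi>, \<rho>), 0) \<in> R" if "\<pi> permutes {1..3}" "\<rho> permutes {1..3}" for \<pi> \<rho>
    using closed[of "((\<pi>, id), 0)" "((id, \<rho>), 0)"] P[OF that(1)] swap[of \<rho> id] P[OF that(2)]
    by (simp add: P_def mult_S3_S3_Z2)
  show ?thesis
  proof
    fix k assume k: "k \<in> carrier S3_S3_Z2"
    obtain \<pi> \<rho> t where kk: "k = ((\<pi>, \<rho>), t)" by (metis surj_pair)
    have \<pi>: "\<pi> permutes {1..3}" "\<rho> permutes {1..3}" and t: "t = 0 \<or> t = 1"
      using k unfolding kk in_carrier_S3_S3_Z2 by auto
    show "k \<in> R" using t 0[OF \<pi>] closed[OF 0[OF \<pi>] p] by (auto simp: kk mult_S3_S3_Z2)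
  qed
qed

lemma G4_iso:
  assumes n: "4 \<le> n" shows "G n \<cong> S3_S3_Z2"
proof (rule G_iso[where \<Phi>="coords4 n" and act="act4 n" and ks="((tr 2 3, id), 0)" and kp="((id, id), 1)" and kf="((id, tr 1 3), 0)"])
  show "2 \<le> n" using n by simp
  show "inj_on (coords4 n) (E_set n)" by (rule coords4_inj[OF n])
  show "\<one>\<^bsub>S3_S3_Z2\<^esub> \<in> carrier S3_S3_Z2" by (simp add: one_S3_S3_Z2 in_carrier_S3_S3_Z2 permutes_id)
  show "act4 n \<one>\<^bsub>S3_S3_Z2\<^esub> x = x" for x
    by (cases x) (simp add: one_S3_S3_Z2 act4_def)
  show "((tr 2 3, id), 0) \<in> carrier S3_S3_Z2" "((id, id), 1) \<in> carrier S3_S3_Z2" "((id, tr 1 3), 0) \<in> carrier S3_S3_Z2"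
    using permutes_tr[of 2 "{1..3}" 3] permutes_tr[of 1 "{1..3}" 3] by (auto simp: in_carrier_S3_S3_Z2 permutes_id)
  fix p assume p: "p \<in> E_set n"
  \<comment> \<open>With these relations \<open>\<sigma>\<close> exchanges a_1 and b_2 within the
    first triple, and \<open>\<phi>\<close> exchanges a_{n-1} and b_n within the second.\<close>
  have rel: "p (B 1) = p (A 2)" "p (C n) = p (B n)" using p n by (auto simp: E_set_iff)
  have tr: "triple a b c \<circ> tr 2 3 = triple a c b" "triple a b c \<circ> tr 1 3 = triple c b a" for a b c
    by (auto simp: fun_eq_iff triple_def tr_def)
  have mid: "i \<noteq> n - 1" "i \<noteq> n" "i \<noteq> 1" "i \<noteq> 2" "1 \<le> i" "i \<le> n" if "i \<in> {3..n-2}" for i using that n by auto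
  show "coords4 n (\<sigma> n p) = act4 n ((tr 2 3, id), 0) (coords4 n p)"
  proof -
    note s = \<sigma>_simps[OF p]
    have "\<sigma> n p (A 2) = p (A 2)" "\<sigma> n p (A 1) = p (B 2)" "\<sigma> n p (B 2) = p (A 1)"
      "\<sigma> n p (A (n-1)) = p (A (n-1))" "\<sigma> n p (A n) = p (A n)" "\<sigma> n p (B n) = p (B n)"
      using n rel s(1)[of 1] s(1)[of 2] s(2)[of 2] s(1)[of "n-1"] s(1)[of n] s(2)[of n] by auto
    moreover have "(\<lambda>i. if i \<in> {3..n-2} then \<sigma> n p (A i) else 0) = (\<lambda>i. if i \<in> {3..n-2} then p (A i) else 0)"
    proof (rule ext)
      show "(if i \<in> {3..n-2} then \<sigma> n p (A i) else 0) = (if i \<in> {3..n-2} then p (A i) else 0)" for i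
        using mid[of i] s(1)[of i] by (cases "i \<in> {3..n-2}") auto
    qed
    ultimately show ?thesis unfolding coords4_def act4_def by (simp add: tr del: One_nat_def)
  qed
  show "coords4 n (\<phi> n p) = act4 n ((id, tr 1 3), 0) (coords4 n p)"
  proof -
    note s = \<phi>_simps[OF p]
    have n1: "1 \<le> n - 1" "n - 1 \<le> n" using n by auto
    have "\<phi> n p (A 2) = p (A 2)" "\<phi> n p (A 1) = p (A 1)" "\<phi> n p (B 2) = p (B 2)"
      "\<phi> n p (A (n-1)) = p (B n)" "\<phi> n p (A n) = p (A n)" "\<phi> n p (B n) = p (A (n-1))"
      using n rel s(1)[of 1] s(1)[of 2] s(2)[of 2] s(1)[of "n-1", OF n1] s(1)[of n] s(2)[of n] by auto
    moreover have "(\<lambda>i. if i \<in> {3..n-2} then \<phi> n p (A i) else 0) = (\<lambda>i. if i \<in> {3..n-2} then p (A i) else 0)"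
    proof (rule ext)
      show "(if i \<in> {3..n-2} then \<phi> n p (A i) else 0) = (if i \<in> {3..n-2} then p (A i) else 0)" for i
        using mid[of i] s(1)[of i] by (cases "i \<in> {3..n-2}") auto
    qed
    ultimately show ?thesis unfolding coords4_def act4_def by (simp add: tr del: One_nat_def)
  qed
  show "coords4 n (\<psi> n p) = act4 n ((id, id), 1) (coords4 n p)"
  proof -
    note s = \<psi>_simps[OF p]
    have i: "n + 1 - 2 = n - 1" "n + 1 - 1 = n" "n + 2 - 2 = n" "n + 1 - (n - 1) = 2" "n + 1 - n = 1" "n + 2 - n = 2" using n by auto
    have "\<psi> n p (A 2) = p (A (n-1))" "\<psi> n p (A 1) = p (A n)" "\<psi> n p (B 2) = p (B n)"
      "\<psi> n p (A (n-1)) = p (A 2)" "\<psi> n p (A n) = p (A 1)" "\<psi> n p (B n) = p (B 2)"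
      using n s(1)[of 1, unfolded i] s(1)[of 2, unfolded i] s(2)[of 2, unfolded i]
        s(1)[of "n-1", unfolded i] s(1)[of n, unfolded i] s(2)[of n, unfolded i] by auto
    moreover have "(\<lambda>i. if i \<in> {3..n-2} then \<psi> n p (A i) else 0) = (\<lambda>i. if i \<in> {3..n-2} then p (A i) else 0) \<circ> reversal n"
    proof (rule ext)
      fix i
      show "(if i \<in> {3..n-2} then \<psi> n p (A i) else 0) = ((\<lambda>i. if i \<in> {3..n-2} then p (A i) else 0) \<circ> reversal n) i"
      proof (cases "i \<in> {3..n-2}")
        case True
        then have "reversal n i = n + 1 - i" "n + 1 - i \<in> {3..n-2}" by (auto simp: reversal_def)
        then show ?thesis using True mid[OF True] s(1)[of i] by simp
      next
        case False
        then have "reversal n i \<notin> {3..n-2}" using n by (auto simp: reversal_def)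
        then show ?thesis using False by auto
      qed
    qed
    ultimately show ?thesis unfolding coords4_def act4_def by (simp del: One_nat_def)
  qed
next
  fix R :: "(((nat \<Rightarrow> nat) \<times> (nat \<Rightarrow> nat)) \<times> int) set"
  assume "\<one>\<^bsub>S3_S3_Z2\<^esub> \<in> R" and s: "((tr 2 3, id), 0) \<in> R" and p: "((id, id), 1) \<in> R"
    and f: "((id, tr 1 3), 0) \<in> R" and closed: "\<And>k l. k \<in> R \<Longrightarrow> l \<in> R \<Longrightarrow> k \<otimes>\<^bsub>S3_S3_Z2\<^esub> l \<in> R"
  then have one: "((id, id), 0) \<in> R" by (simp add: one_S3_S3_Z2)
  show "carrier S3_S3_Z2 \<subseteq> R"
    by (rule S3_S3_Z2_generated[OF one s p f closed])
qed (use act4_mult act4_faithful[OF n] in blast)+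

lemma order_G4:
  assumes "4 \<le> n" shows "order (G n) = 72"
  using iso_same_card[OF G4_iso[OF assms]] by (simp add: order_def card_S3_S3_Z2)

theorem mainTheorem5:
  fixes n :: nat
  assumes "n \<ge> 2"
  shows "{\<sigma> n, \<psi> n, \<phi> n} \<subseteq> carrier (AutoGroup (E_module n))
    \<and> rhin_viola_group (carrier (G n)) (E_module n) (L n)
    \<and> (n \<ge> 4 \<longrightarrow> G n \<cong> S3_S3_Z2 \<and> order (G n) = 72)
    \<and> (n \<ge> 5 \<longrightarrow> leaves_invariant (carrier (G n)) (E_module n) (L n) (denom_ge5 n))
    \<and> (n = 4 \<longrightarrow> leaves_invariant (carrier (G n)) (E_module n) (L n) denom4)
    \<and> (n = 3 \<longrightarrow> G n \<cong> H_S5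
          \<and> leaves_invariant (carrier (G n)) (E_module n) (L n) denom3)
    \<and> (n = 2 \<longrightarrow> G n \<cong> sym_group 5
          \<and> leaves_invariant (carrier (G n)) (E_module n) (L n) denom2)"
proof -
  consider "n = 2" | "n = 3" | "n = 4" | "5 \<le> n" using assms by linarith
  then show ?thesis
    using generators_in_AutoGroup[OF assms] G2_iso G3_iso G4_iso[of n] order_G4[of n]
      denom2_invariant denom3_invariant denom4_invariant denom_ge5_invariant[of n]
    by cases simp_all
qed

end
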